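(* Let $\theta:\mathbb{R}^n\to(-\infty,\infty]$ be convex piecewise linear with fixed generating data $(a_i,\alpha_i)_{i\in T_1}$, $(d_i,\beta_i)_{i\in T_2}$, let $f:\mathbb{R}^n\times\mathbb{R}^d\to\mathbb{R}^n$, and let $$S(w):=\{x\in\mathbb{R}^n:\ 0\in f(x,w)+\partial\theta(x)\},\qquad w\in\mathbb{R}^d.$$ Let $(\bar w,\bar x)\in\operatorname{gph}S$, let $f$ be strictly differentiable at $(\bar x,\bar w)$, and let $\nabla_wf(\bar x,\bar w)$ be surjective. Denote $\bar v:=-f(\bar x,\bar w)\in\partial\theta(\bar x)$. Then: (i) $S$ is Lipschitz-like around $(\bar w,\bar x)$ if and only if for every $(P_1,Q_1,P_2,Q_2)\in\mathcal{A}$ the implication $$\big[-\nabla_xf(\bar x,\bar w)^*u\in\mathcal{F}_{\{P_1,Q_1\},\{P_2,Q_2\}},\ -u\in\mathcal{G}_{\{P_1,Q_1\},\{P_2,Q_2\}}\big]\Longrightarrow u=0$$ holds. Furthermore, the exact Lipschitzian bound of $S$ around $(\bar w,\bar x)$ is $$\operatorname{lip}S(\bar w,\bar x)=\sup\big\{\|\nabla_wf(\bar x,\bar w)^*u\|:\ -u\in\mathcal{G}_{\{P_1,Q_1\},\{P_2,Q_2\}},\ y\in\mathcal{F}_{\{P_1,Q_1\},\{P_2,Q_2\}},\ (P_1,Q_1,P_2,Q_2)\in\mathcal{A},\ \|y+\nabla_xf(\bar x,\bar w)^*u\|\le1\big\}.$$ (ii) Suppose in addition that AICQ holds at $\bar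 x$. Then $S$ is Lipschitz-like around $(\bar w,\bar x)$ if and only if $u=0$ is the only $u\in\mathbb{R}^n$ satisfying $-u\in\operatorname{dom}\partial^2\theta(\bar x,\bar v)$ and $-\nabla_xf(\bar x,\bar w)^*u\in\mathcal{C}(u)$, where $$\mathcal{C}(u):=\operatorname{span}\{a_i-a_j:i,j\in I_{0,1}(u)\}+\operatorname{cone}\{a_i-a_j:i\in I_{>,1}(u),\,j\in I_{0,1}(u)\}+\operatorname{span}\{d_t:t\in I_{0,2}(u)\}+\operatorname{cone}\{d_t:t\in I_{>,2}(u)\}.$$ Furthermore, the exact Lipschitzian bound of $S$ around $(\bar w,\bar x)$ is $$\operatorname{lip}S(\bar w,\bar x)=\sup\big\{\|\nabla_wf(\bar x,\bar w)^*u\|:\ -u\in\mathcal{G}_{\{J_1,J_1\},\{J_2,J_2\}},\ y\in\mathcal{C}(u),\ \|y+\nabla_xf(\bar x,\bar w)^*u\|\le1\big\}.$$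
   Context: **Convex piecewise linear functions.** $\theta:\mathbb{R}^n\to(-\infty,\infty]$ is convex piecewise linear with generating data $a_i\in\mathbb{R}^n,\alpha_i\in\mathbb{R}$ ($i\in T_1:=\{1,\dots,l\}$), $d_i\in\mathbb{R}^n,\beta_i\in\mathbb{R}$ ($i\in T_2:=\{1,\dots,p\}$) if $\operatorname{dom}\theta=\{z:\langle d_i,z\rangle\le\beta_i,\ i\in T_2\}\ne\emptyset$, $\theta(z)=\max_{i\in T_1}\{\langle a_i,z\rangle-\alpha_i\}$ on $\operatorname{dom}\theta$, and $\theta=\infty$ elsewhere. For $z\in\operatorname{dom}\theta$ let $K(z):=\{i\in T_1:\langle a_i,z\rangle-\alpha_i=\max_{j\in T_1}(\langle a_j,z\rangle-\alpha_j)\}$ and $I(z):=\{i\in T_2:\langle d_i,z\rangle=\beta_i\}$. Then $\partial\theta(z)=\operatorname{conv}\{a_i:i\in K(z)\}+\operatorname{cone}\{d_i:i\in I(z)\}$ (subdifferential of convex analysis). Write $K:=K(\bar x)$, $I:=I(\bar x)$. **Sets $\mathcal{F},\mathcal{G},\mathcal{A}$.** For $P_1\subset Q_1\subset T_1$ and $P_2\subset Q_2\subset T_2$, $\mathcal{F}_{\{P_1,Q_1\},\{P_2,Q_2\}}:=\operatorname{span}\{a_i-a_j:i,j\in P_1\}+\operatorname{cone}\{a_i-a_j:(i,j)\in(Q_1\setminus P_1)\times P_1\}+\operatorname{span}\{d_i:i\in P_2\}+\operatorname{cone}\{d_i:i\in Q_2\setminus P_2\}$; $\mathcal{G}_{\{P_1,Q_1\},\{P_2,Q_2\}}$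 is the set of $u\in\mathbb{R}^n$ with $\langle a_i-a_j,u\rangle=0$ for $i,j\in P_1$, $\langle a_i-a_j,u\rangle\le0$ for $(i,j)\in(Q_1\setminus P_1)\times P_1$, $\langle d_i,u\rangle=0$ for $i\in P_2$, $\langle d_i,u\rangle\le0$ for $i\in Q_2\setminus P_2$. $\mathcal{A}$ is the set of quadruples $(P_1,Q_1,P_2,Q_2)$ with $P_1\subset Q_1\subset K$, $P_2\subset Q_2\subset I$, $\bar v\in\operatorname{conv}\{a_i:i\in P_1\}+\operatorname{cone}\{d_i:i\in P_2\}$, and such that there is $z\in\operatorname{dom}\theta$ with $K(z)=Q_1$, $I(z)=Q_2$. (Conventions: the span and cone of the empty set are $\{0\}$, the convex hull of the empty set is empty.) **Multiplier index sets.** Write $\bar v=\bar v_1+\bar v_2$ with $\bar v_1=\sum_{i\in K}\bar\lambda_ia_i$, $\bar\lambda_i\ge0$, $\sum_{i\in K}\bar\lambda_i=1$, and $\bar v_2=\sum_{i\in I}\bar\mu_id_i$, $\bar\mu_i\ge0$; set $J_1:=\{i\in K:\bar\lambda_i>0\}$, $J_2:=\{i\in I:\bar\mu_i>0\}$. (Under AICQ this representation is unique.) For $u\in\mathbb{R}^n$ with $u\in\operatorname{dom}\partial^2\theta(\bar x,\bar v)$ set $I_{0,1}(u):=\{i\in K:\langle a_i-a_j,u\rangle=0\text{ for }j\in J_1\}$, $I_{>,1}(u):=\{i\in K:\langle a_i-a_j,u\rangle>0\text{ for }j\in J_1\}$, $I_{0,2}(u):=\{t\in I:\langle d_t,u\rangle=0\}$,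 $I_{>,2}(u):=\{t\in I:\langle d_t,u\rangle>0\}$. (The set $\operatorname{dom}\partial^2\theta(\bar x,\bar v)$ is a linear subspace.) **AICQ (affine independence constraint qualification)** at $\bar x$: the vectors $\{(a_i,1):i\in K\}\cup\{(d_t,0):t\in I\}\subset\mathbb{R}^n\times\mathbb{R}$ are linearly independent. **Second-order subdifferential.** For a set $\Omega$ and $\bar y\in\Omega$, $N(\bar y;\Omega)$ is the limiting (Mordukhovich) normal cone: all limits $v=\lim v_k$ with $y_k\to\bar y$, $y_k\in\Omega$, $\limsup_{y\to y_k,\,y\in\Omega}\langle v_k,y-y_k\rangle/\|y-y_k\|\le0$. Then $\partial^2\theta(\bar x,\bar v)(u):=\{w:(w,-u)\in N((\bar x,\bar v);\operatorname{gph}\partial\theta)\}$ and $\operatorname{dom}\partial^2\theta(\bar x,\bar v):=\{u:\partial^2\theta(\bar x,\bar v)(u)\ne\emptyset\}$. **Lipschitz-like (Aubin) property.** $S$ is Lipschitz-like around $(\bar w,\bar x)\in\operatorname{gph}S$ if there are neighborhoods $U$ of $\bar w$, $O$ of $\bar x$ and $\ell>0$ with $S(w_1)\cap O\subset S(w_2)+\ell\|w_1-w_2\|\mathbb{B}$ for all $w_1,w_2\in U$, $\mathbb{B}$ the closed unit ball. $\operatorname{lip}S(\bar w,\bar x)$ is the infimum of all such $\ell$. Norms are Euclidean. *)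

theory Defs
  imports "HOL-Analysis.Analysis"
begin

section \<open>Generalized differentiation\<close>

definition eff_dom :: "('a \<Rightarrow> ereal) \<Rightarrow> 'a set" where
  "eff_dom \<theta> = {z. \<theta> z < \<infinity>}"

definition subdiff :: "('a::real_inner \<Rightarrow> ereal) \<Rightarrow> 'a \<Rightarrow> 'a set" where
  "subdiff \<theta> x = {v. \<bar>\<theta> x\<bar> \<noteq> \<infinity> \<and> (\<forall>y. \<theta> x + ereal (v \<bullet> (y - x)) \<le> \<theta> y)}"

definition gph :: "('a \<Rightarrow> 'b set) \<Rightarrow> ('a \<times> 'b) set" where
  "gph F = {(x, y). y \<in> F x}"

text \<open>At an isolated point of \<open>\<Omega>\<close> the upper limit below is taken over the trivial filter and equals
  \<open>-\<infinity>\<close>, so every vector is a regular normal there.\<close>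

definition regular_normal_cone :: "'a::real_inner \<Rightarrow> 'a set \<Rightarrow> 'a set" where
  "regular_normal_cone y \<Omega> =
     {v. Limsup (at y within \<Omega>) (\<lambda>y'. ereal (v \<bullet> (y' - y) / norm (y' - y))) \<le> 0}"

definition limiting_normal_cone :: "'a::real_inner \<Rightarrow> 'a set \<Rightarrow> 'a set" where
  "limiting_normal_cone y \<Omega> =
     {v. \<exists>ys vs. (\<forall>k::nat. ys k \<in> \<Omega> \<and> vs k \<in> regular_normal_cone (ys k) \<Omega>)
           \<and> ys \<longlonglongrightarrow> y \<and> vs \<longlonglongrightarrow> v}"

definition second_subdiff ::
    "('a::real_inner \<Rightarrow> ereal) \<Rightarrow> 'a \<Rightarrow> 'a \<Rightarrow> 'a \<Rightarrow> 'a set" where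
  "second_subdiff \<theta> x v u = {w. (w, - u) \<in> limiting_normal_cone (x, v) (gph (subdiff \<theta>))}"

definition dom_second_subdiff :: "('a::real_inner \<Rightarrow> ereal) \<Rightarrow> 'a \<Rightarrow> 'a \<Rightarrow> 'a set" where
  "dom_second_subdiff \<theta> x v = {u. second_subdiff \<theta> x v u \<noteq> {}}"

text \<open>On the diagonal \<open>x = x'\<close> the quotient is \<open>0\<close>, so it is harmless that the filter does not
  exclude the diagonal.\<close>

definition has_strict_derivative ::
    "('a::real_normed_vector \<Rightarrow> 'b::real_normed_vector) \<Rightarrow> ('a \<Rightarrow> 'b) \<Rightarrow> 'a \<Rightarrow> bool" where
  "has_strict_derivative f D z \<longleftrightarrow> bounded_linear D \<and>
     ((\<lambda>(x, x'). (f x - f x' - D (x - x')) /\<^sub>R norm (x - x')) \<longlongrightarrow> 0) (nhds z \<times>\<^sub>F nhds z)"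

definition strictly_differentiable_at ::
    "('a::real_normed_vector \<Rightarrow> 'b::real_normed_vector) \<Rightarrow> 'a \<Rightarrow> bool" where
  "strictly_differentiable_at f z \<longleftrightarrow> (\<exists>D. has_strict_derivative f D z)"

definition partial_x ::
    "('a::real_normed_vector \<times> 'c::real_normed_vector \<Rightarrow> 'b::real_normed_vector) \<Rightarrow> 'a \<Rightarrow> 'c \<Rightarrow> 'a \<Rightarrow> 'b"
  where "partial_x f x w = frechet_derivative (\<lambda>x'. f (x', w)) (at x)"

definition partial_w ::
    "('a::real_normed_vector \<times> 'c::real_normed_vector \<Rightarrow> 'b::real_normed_vector) \<Rightarrow> 'a \<Rightarrow> 'c \<Rightarrow> 'c \<Rightarrow> 'b"
  where "partial_w f x w = frechet_derivative (\<lambda>w'. f (x, w')) (at w)"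


section \<open>The Lipschitz-like property\<close>

definition lip_modulus ::
    "('c::real_normed_vector \<Rightarrow> 'a::real_normed_vector set) \<Rightarrow> 'c \<Rightarrow> 'a \<Rightarrow> real \<Rightarrow> bool" where
  "lip_modulus S w x l \<longleftrightarrow> 0 < l \<and>
     (\<exists>U V. open U \<and> w \<in> U \<and> open V \<and> x \<in> V \<and>
        (\<forall>w1\<in>U. \<forall>w2\<in>U. S w1 \<inter> V \<subseteq> S w2 + (\<lambda>b. (l * norm (w1 - w2)) *\<^sub>R b) ` cball 0 1))"

definition lipschitz_like ::
    "('c::real_normed_vector \<Rightarrow> 'a::real_normed_vector set) \<Rightarrow> 'c \<Rightarrow> 'a \<Rightarrow> bool" where
  "lipschitz_like S w x \<longleftrightarrow> (\<exists>l. lip_modulus S w x l)"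

text \<open>Extended-real valued: \<open>\<infinity>\<close> exactly when the mapping is not Lipschitz-like.\<close>

definition lip_bound ::
    "('c::real_normed_vector \<Rightarrow> 'a::real_normed_vector set) \<Rightarrow> 'c \<Rightarrow> 'a \<Rightarrow> ereal" where
  "lip_bound S w x = Inf {ereal l | l. lip_modulus S w x l}"

definition solution_map ::
    "('a::real_inner \<times> 'c \<Rightarrow> 'a) \<Rightarrow> ('a \<Rightarrow> ereal) \<Rightarrow> 'c \<Rightarrow> 'a set" where
  "solution_map f \<theta> w = {x. 0 \<in> {f (x, w)} + subdiff \<theta> x}"


section \<open>Convex piecewise linear functions\<close>

text \<open>The maximum requires \<open>T\<^sub>1\<close> to be nonempty, i.e. \<open>l \<ge> 1\<close>; for \<open>p = 0\<close> there are no constraints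
  and the domain is the whole space.\<close>

definition convex_pl ::
    "('a::real_inner \<Rightarrow> ereal) \<Rightarrow> nat \<Rightarrow> (nat \<Rightarrow> 'a) \<Rightarrow> (nat \<Rightarrow> real) \<Rightarrow>
     nat \<Rightarrow> (nat \<Rightarrow> 'a) \<Rightarrow> (nat \<Rightarrow> real) \<Rightarrow> bool" where
  "convex_pl \<theta> l a \<alpha> p d \<beta> \<longleftrightarrow>
     1 \<le> l \<and> eff_dom \<theta> = {z. \<forall>i\<in>{1..p}. d i \<bullet> z \<le> \<beta> i} \<and> eff_dom \<theta> \<noteq> {} \<and>
     (\<forall>z\<in>eff_dom \<theta>. \<theta> z = ereal (Max ((\<lambda>i. a i \<bullet> z - \<alpha> i) ` {1..l})))"

definition active_max :: "nat \<Rightarrow> (nat \<Rightarrow> 'a::real_inner) \<Rightarrow> (nat \<Rightarrow> real) \<Rightarrow> 'a \<Rightarrow> nat set" where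
  "active_max l a \<alpha> z = {i\<in>{1..l}. a i \<bullet> z - \<alpha> i = Max ((\<lambda>j. a j \<bullet> z - \<alpha> j) ` {1..l})}"

definition active_con :: "nat \<Rightarrow> (nat \<Rightarrow> 'a::real_inner) \<Rightarrow> (nat \<Rightarrow> real) \<Rightarrow> 'a \<Rightarrow> nat set" where
  "active_con p d \<beta> z = {i\<in>{1..p}. d i \<bullet> z = \<beta> i}"

text \<open>The cone generated by a set is \<open>convex_cone hull\<close> (finite nonnegative combinations), which
  like \<open>span\<close> maps \<open>{}\<close> to \<open>{0}\<close>; the constant \<open>cone hull\<close> would only produce nonnegative multiples
  of single vectors. Sums of sets are Minkowski sums.\<close>

definition F_set ::
    "(nat \<Rightarrow> 'a::real_inner) \<Rightarrow> (nat \<Rightarrow> 'a) \<Rightarrow> nat set \<Rightarrow> nat set \<Rightarrow> nat set \<Rightarrow> nat set \<Rightarrow> 'a set" where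
  "F_set a d P1 Q1 P2 Q2 =
     span {a i - a j | i j. i \<in> P1 \<and> j \<in> P1} +
     convex_cone hull {a i - a j | i j. i \<in> Q1 - P1 \<and> j \<in> P1} +
     span {d i | i. i \<in> P2} +
     convex_cone hull {d i | i. i \<in> Q2 - P2}"

definition G_set ::
    "(nat \<Rightarrow> 'a::real_inner) \<Rightarrow> (nat \<Rightarrow> 'a) \<Rightarrow> nat set \<Rightarrow> nat set \<Rightarrow> nat set \<Rightarrow> nat set \<Rightarrow> 'a set" where
  "G_set a d P1 Q1 P2 Q2 =
     {u. (\<forall>i\<in>P1. \<forall>j\<in>P1. (a i - a j) \<bullet> u = 0) \<and>
         (\<forall>i\<in>Q1 - P1. \<forall>j\<in>P1. (a i - a j) \<bullet> u \<le> 0) \<and>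
         (\<forall>i\<in>P2. d i \<bullet> u = 0) \<and>
         (\<forall>i\<in>Q2 - P2. d i \<bullet> u \<le> 0)}"

definition A_set ::
    "('a::real_inner \<Rightarrow> ereal) \<Rightarrow> nat \<Rightarrow> (nat \<Rightarrow> 'a) \<Rightarrow> (nat \<Rightarrow> real) \<Rightarrow>
     nat \<Rightarrow> (nat \<Rightarrow> 'a) \<Rightarrow> (nat \<Rightarrow> real) \<Rightarrow> 'a \<Rightarrow> 'a \<Rightarrow>
     (nat set \<times> nat set \<times> nat set \<times> nat set) set" where
  "A_set \<theta> l a \<alpha> p d \<beta> x v =
     {(P1, Q1, P2, Q2).
        P1 \<subseteq> Q1 \<and> Q1 \<subseteq> active_max l a \<alpha> x \<and> P2 \<subseteq> Q2 \<and> Q2 \<subseteq> active_con p d \<beta> x \<and>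
        v \<in> convex hull {a i | i. i \<in> P1} + convex_cone hull {d i | i. i \<in> P2} \<and>
        (\<exists>z\<in>eff_dom \<theta>. active_max l a \<alpha> z = Q1 \<and> active_con p d \<beta> z = Q2)}"


section \<open>Multipliers and AICQ\<close>

definition multipliers ::
    "(nat \<Rightarrow> 'a::real_vector) \<Rightarrow> (nat \<Rightarrow> 'a) \<Rightarrow> nat set \<Rightarrow> nat set \<Rightarrow> 'a \<Rightarrow>
     (nat \<Rightarrow> real) \<Rightarrow> (nat \<Rightarrow> real) \<Rightarrow> bool" where
  "multipliers a d K I v lam mu \<longleftrightarrow>
     v = (\<Sum>i\<in>K. lam i *\<^sub>R a i) + (\<Sum>i\<in>I. mu i *\<^sub>R d i) \<and>
     (\<forall>i\<in>K. 0 \<le> lam i) \<and> (\<Sum>i\<in>K. lam i) = 1 \<and> (\<forall>i\<in>I. 0 \<le> mu i)"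

definition pos_support :: "nat set \<Rightarrow> (nat \<Rightarrow> real) \<Rightarrow> nat set" where
  "pos_support K lam = {i\<in>K. 0 < lam i}"

definition I01 :: "(nat \<Rightarrow> 'a::real_inner) \<Rightarrow> nat set \<Rightarrow> nat set \<Rightarrow> 'a \<Rightarrow> nat set" where
  "I01 a K J1 u = {i\<in>K. \<forall>j\<in>J1. (a i - a j) \<bullet> u = 0}"

definition Igt1 :: "(nat \<Rightarrow> 'a::real_inner) \<Rightarrow> nat set \<Rightarrow> nat set \<Rightarrow> 'a \<Rightarrow> nat set" where
  "Igt1 a K J1 u = {i\<in>K. \<forall>j\<in>J1. (a i - a j) \<bullet> u > 0}"

definition I02 :: "(nat \<Rightarrow> 'a::real_inner) \<Rightarrow> nat set \<Rightarrow> 'a \<Rightarrow> nat set" where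
  "I02 d I u = {t\<in>I. d t \<bullet> u = 0}"

definition Igt2 :: "(nat \<Rightarrow> 'a::real_inner) \<Rightarrow> nat set \<Rightarrow> 'a \<Rightarrow> nat set" where
  "Igt2 d I u = {t\<in>I. d t \<bullet> u > 0}"

definition C_set ::
    "(nat \<Rightarrow> 'a::real_inner) \<Rightarrow> (nat \<Rightarrow> 'a) \<Rightarrow> nat set \<Rightarrow> nat set \<Rightarrow> nat set \<Rightarrow> 'a \<Rightarrow> 'a set" where
  "C_set a d K I J1 u =
     span {a i - a j | i j. i \<in> I01 a K J1 u \<and> j \<in> I01 a K J1 u} +
     convex_cone hull {a i - a j | i j. i \<in> Igt1 a K J1 u \<and> j \<in> I01 a K J1 u} +
     span {d t | t. t \<in> I02 d I u} +
     convex_cone hull {d t | t. t \<in> Igt2 d I u}"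

text \<open>Linear independence is meant for the indexed family, hence the injectivity condition: two
  indices carrying the same vector violate the qualification.\<close>

definition AICQ ::
    "(nat \<Rightarrow> 'a::real_vector) \<Rightarrow> (nat \<Rightarrow> 'a) \<Rightarrow> nat set \<Rightarrow> nat set \<Rightarrow> bool" where
  "AICQ a d K I \<longleftrightarrow>
     (let g = case_sum (\<lambda>i. (a i, 1::real)) (\<lambda>t. (d t, 0))
      in inj_on g (K <+> I) \<and> independent (g ` (K <+> I)))"

end

theory Submission
  imports Defs
begin

text \<open>The graph of \<open>\<partial>\<theta>\<close> is locally a union of finitely many polyhedral cones. At a point
  \<open>(x, v)\<close> of the graph, with active sets \<open>Q\<^sub>1, Q\<^sub>2\<close> of \<open>x\<close> and positive multipliers of \<open>v\<close> exactly on
  \<open>P\<^sub>1, P\<^sub>2\<close>, the regular normal cone is \<open>\<F> \<times> \<G>\<close>; moving the multipliers and the active sets gives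
  the limiting normal cone as the union of \<open>\<F> \<times> \<G>\<close> over \<open>\<A>\<close>. Since \<open>\<nabla>\<^sub>wf\<close> is surjective, the
  limiting normals of \<open>gph S\<close> are the images of these under the adjoint of \<open>(w, x) \<mapsto> (x, -f(x, w))\<close>;
  as \<open>f\<close> need not be differentiable elsewhere, nearby normals are transported as
  \<open>\<epsilon>\<close>-normals, which have the same limits. Finally \<open>lip S\<close> is the least \<open>\<kappa>\<close> with
  \<open>\<parallel>\<omega>\<parallel> \<le> \<kappa> \<parallel>\<xi>\<parallel>\<close> for all limiting normals \<open>(\<omega>, \<xi>)\<close> of \<open>gph S\<close> (Mordukhovich criterion). Under AICQ
  the multipliers are unique and all active sets occur, so that for each \<open>u\<close> one member of \<open>\<A>\<close>
  yields the largest \<open>\<F>\<close>.\<close>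

section \<open>Normal cones\<close>

text \<open>What replaces derivatives away from the base point is uniformity: for each \<epsilon>,
  strict differentiability gives one radius around \<open>(xb, wb)\<close> inside which all
  increments of \<open>f\<close> are linear up to \<epsilon>. A normal at any point within that
  radius stays a normal up to a multiple of \<epsilon>, and projection recovers genuine normals
  close by. The two directions of the transport are not symmetric. From \<open>\<Gamma>\<close> to
  \<open>gph S\<close> the increment estimate and one lifted point are enough; in the other
  direction every nearby solution of the linearized inclusion must be matched by a point of
  \<open>gph S\<close>, which takes an inverse-function argument in the parameter. The Lipschitz
  constant has to come out sharp, so the criterion works with a \<open>\<kappa>'\<close> strictly
  between the bound on normals and the claimed modulus. Without AICQ the multipliers of a
  subgradient are not unique, but any choice of them describes the same regular normal cone, so one
  may be picked at each point.\<close>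

definition eps_normal_cone :: "real \<Rightarrow> 'a::real_inner \<Rightarrow> 'a set \<Rightarrow> 'a set" where
  "eps_normal_cone \<epsilon> y \<Omega> =
     {v. \<exists>\<delta>>0. \<forall>y'\<in>\<Omega>. norm (y' - y) < \<delta> \<longrightarrow> v \<bullet> (y' - y) \<le> \<epsilon> * norm (y' - y)}"

lemma eps_normal_coneI:
  assumes "0 < \<delta>" "\<And>y'. \<lbrakk>y' \<in> \<Omega>; norm (y' - y) < \<delta>\<rbrakk> \<Longrightarrow> v \<bullet> (y' - y) \<le> \<epsilon> * norm (y' - y)"
  shows "v \<in> eps_normal_cone \<epsilon> y \<Omega>"
  using assms unfolding eps_normal_cone_def by blast

lemma eps_normal_coneE:
  assumes "v \<in> eps_normal_cone \<epsilon> y \<Omega>"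
  obtains \<delta> where "0 < \<delta>"
    "\<And>y'. \<lbrakk>y' \<in> \<Omega>; norm (y' - y) < \<delta>\<rbrakk> \<Longrightarrow> v \<bullet> (y' - y) \<le> \<epsilon> * norm (y' - y)"
proof -
  obtain \<delta> where "0 < \<delta>"
    "\<forall>y'\<in>\<Omega>. norm (y' - y) < \<delta> \<longrightarrow> v \<bullet> (y' - y) \<le> \<epsilon> * norm (y' - y)"
    using assms unfolding eps_normal_cone_def by blast
  then show thesis
    by (intro that[of \<delta>]) simp_all
qed

text \<open>The error \<open>(v' - v) \<bullet> (y' - y)\<close> is linear in the distance, so
  changing the vector only costs slack. This lets a sequence of normals be replaced by its
  limit.\<close>

lemma eps_normal_cone_perturb:
  assumes "v \<in> eps_normal_cone \<epsilon> y \<Omega>" and "norm (v' - v) + \<epsilon> \<le> \<epsilon>'"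
  shows "v' \<in> eps_normal_cone \<epsilon>' y \<Omega>"
proof -
  obtain \<delta> where \<delta>: "0 < \<delta>"
    "\<And>y'. \<lbrakk>y' \<in> \<Omega>; norm (y' - y) < \<delta>\<rbrakk> \<Longrightarrow> v \<bullet> (y' - y) \<le> \<epsilon> * norm (y' - y)"
    using assms(1) by (rule eps_normal_coneE) blast
  show ?thesis
  proof (rule eps_normal_coneI[OF \<delta>(1)])
    fix y' assume "y' \<in> \<Omega>" "norm (y' - y) < \<delta>"
    have "v' \<bullet> (y' - y) = v \<bullet> (y' - y) + (v' - v) \<bullet> (y' - y)"
      by (simp add: inner_diff_left)
    also have "\<dots> \<le> \<epsilon> * norm (y' - y) + norm (v' - v) * norm (y' - y)"
      by (intro add_mono \<delta>(2) norm_cauchy_schwarz) fact+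
    also have "\<dots> \<le> \<epsilon>' * norm (y' - y)"
      using mult_right_mono[OF assms(2) norm_ge_zero[of "y' - y"]] by (simp add: algebra_simps)
    finally show "v' \<bullet> (y' - y) \<le> \<epsilon>' * norm (y' - y)" .
  qed
qed

text \<open>Multiplying the quotient out by the norm removes the punctured filter: at
  \<open>y' = y\<close> the inequality is trivial, and an isolated point is no special case.\<close>

lemma regular_normal_cone_eq: "regular_normal_cone y \<Omega> = (\<Inter>\<epsilon>\<in>{0<..}. eps_normal_cone \<epsilon> y \<Omega>)"
proof -
  have "v \<in> regular_normal_cone y \<Omega> \<longleftrightarrow> (\<forall>\<epsilon>>0. v \<in> eps_normal_cone \<epsilon> y \<Omega>)" (is "?L \<longleftrightarrow> ?R") for v
  proof
    assume ?L
    show ?R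
    proof (intro allI impI)
      fix \<epsilon> :: real assume "0 < \<epsilon>"
      then have "\<forall>\<^sub>F y' in at y within \<Omega>. ereal (v \<bullet> (y' - y) / norm (y' - y)) < ereal \<epsilon>"
        using \<open>?L\<close> unfolding regular_normal_cone_def Limsup_le_iff mem_Collect_eq by (blast intro: ereal_less(2)[THEN iffD2])
      then obtain \<delta> where \<delta>: "0 < \<delta>"
        "\<And>y'. \<lbrakk>y' \<in> \<Omega>; y' \<noteq> y; dist y' y < \<delta>\<rbrakk> \<Longrightarrow> v \<bullet> (y' - y) / norm (y' - y) < \<epsilon>"
        unfolding eventually_at by auto
      show "v \<in> eps_normal_cone \<epsilon> y \<Omega>"
      proof (rule eps_normal_coneI[OF \<delta>(1)])
        fix y' assume "y' \<in> \<Omega>" "norm (y' - y) < \<delta>"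
        then show "v \<bullet> (y' - y) \<le> \<epsilon> * norm (y' - y)"
          using \<delta>(2)[of y'] by (cases "y' = y") (auto simp: dist_norm pos_divide_less_eq less_imp_le)
      qed
    qed
  next
    assume R: ?R
    have "\<forall>\<^sub>F y' in at y within \<Omega>. ereal (v \<bullet> (y' - y) / norm (y' - y)) < c" if "0 < c" for c
    proof -
      obtain \<epsilon> where \<epsilon>: "0 < \<epsilon>" "ereal \<epsilon> < c"
        using ereal_dense2[OF \<open>0 < c\<close>] by (auto simp: zero_ereal_def)
      obtain \<delta> where \<delta>: "0 < \<delta>"
        "\<And>y'. \<lbrakk>y' \<in> \<Omega>; norm (y' - y) < \<delta>\<rbrakk> \<Longrightarrow> v \<bullet> (y' - y) \<le> \<epsilon> * norm (y' - y)"
        using R \<epsilon>(1) by (metis eps_normal_coneE)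
      have "ereal (v \<bullet> (y' - y) / norm (y' - y)) < c"
        if "y' \<in> \<Omega>" "y' \<noteq> y" "dist y' y < \<delta>" for y'
      proof -
        have "v \<bullet> (y' - y) / norm (y' - y) \<le> \<epsilon>"
          using \<delta>(2)[of y'] that by (simp add: dist_norm pos_divide_le_eq)
        then show ?thesis
          using \<epsilon>(2) by (meson ereal_less_eq(3) le_less_trans)
      qed
      then show ?thesis
        unfolding eventually_at using \<delta>(1) by blast
    qed
    then show ?L
      unfolding regular_normal_cone_def Limsup_le_iff by simp
  qed
  then show ?thesis by auto
qed

text \<open>A quadratic bound is of smaller order than \<open>\<epsilon> * norm (y' - y)\<close>.
  Regular normals are produced below in this way: from a projection, from a smooth penalty, or with
  \<open>L = 0\<close> from polyhedral structure.\<close>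

lemma proximal_normal_imp_regular:
  assumes "0 < \<delta>"
    and "\<And>y'. \<lbrakk>y' \<in> \<Omega>; norm (y' - y) < \<delta>\<rbrakk> \<Longrightarrow> v \<bullet> (y' - y) \<le> L * (norm (y' - y))\<^sup>2"
  shows "v \<in> regular_normal_cone y \<Omega>"
  unfolding regular_normal_cone_eq
proof
  fix \<epsilon> :: real assume "\<epsilon> \<in> {0<..}"
  then have "0 < \<epsilon>" by simp
  show "v \<in> eps_normal_cone \<epsilon> y \<Omega>"
  proof (rule eps_normal_coneI)
    \<comment> \<open>\<open>\<bar>L\<bar> + 1\<close> is positive and dominates \<open>L\<close>,
      whatever the sign of \<open>L\<close>.\<close>
    show "0 < min \<delta> (\<epsilon> / (\<bar>L\<bar> + 1))"
      using assms(1) \<open>0 < \<epsilon>\<close> by simp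
  next
    fix y' assume y': "y' \<in> \<Omega>" "norm (y' - y) < min \<delta> (\<epsilon> / (\<bar>L\<bar> + 1))"
    have "(\<bar>L\<bar> + 1) * norm (y' - y) \<le> \<epsilon>"
      using y'(2) by (simp add: pos_less_divide_eq mult.commute)
    then have "((\<bar>L\<bar> + 1) * norm (y' - y)) * norm (y' - y) \<le> \<epsilon> * norm (y' - y)"
      by (rule mult_right_mono) simp
    moreover have "L * (norm (y' - y))\<^sup>2 \<le> (\<bar>L\<bar> + 1) * (norm (y' - y))\<^sup>2"
      by (rule mult_right_mono) simp_all
    ultimately show "v \<bullet> (y' - y) \<le> \<epsilon> * norm (y' - y)"
      using assms(2)[of y'] y' by (simp add: power2_eq_square mult.assoc)
  qed
qed

text \<open>Whatever the slopes, a strict inequality survives a short step along a ray; this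
  disposes of inactive constraints and nonmaximal pieces below.\<close>

lemma eventually_affine_less:
  fixes c :: real
  assumes "c < c'"
  shows "\<forall>\<^sub>F t in at_right 0. c + t * e < c' + t * e'"
proof -
  have "((\<lambda>t. (c' + t * e') - (c + t * e)) \<longlongrightarrow> (c' + 0 * e') - (c + 0 * e)) (at_right 0)"
    by (intro tendsto_intros)
  then have "\<forall>\<^sub>F t in at_right 0. 0 < (c' + t * e') - (c + t * e)"
    by (rule order_tendstoD) (use assms in simp)
  then show ?thesis
    by eventually_elim simp
qed

text \<open>Dividing the normal inequality along the ray by the step length leaves
  \<open>n \<bullet> g \<le> \<epsilon> * norm g\<close>. For the graph of a polyhedral
  subdifferential, such rays yield all inequalities that describe the normal cone.\<close>

lemma regular_normal_ray:
  assumes reg: "n \<in> regular_normal_cone z \<Omega>"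
    and ray: "\<forall>\<^sub>F t in at_right 0. z + t *\<^sub>R g \<in> \<Omega>"
  shows "n \<bullet> g \<le> 0"
proof (rule field_le_epsilon)
  fix e :: real assume "0 < e"
  define \<epsilon> where "\<epsilon> = e / (norm g + 1)"
  have *: "0 < norm g + 1"
    by (simp add: add_nonneg_pos)
  have "0 < \<epsilon>"
    using \<open>0 < e\<close> * by (simp add: \<epsilon>_def)
  then have "n \<in> eps_normal_cone \<epsilon> z \<Omega>"
    using reg by (auto simp: regular_normal_cone_eq)
  then obtain \<delta> where \<delta>: "0 < \<delta>" "\<And>y'. \<lbrakk>y' \<in> \<Omega>; norm (y' - z) < \<delta>\<rbrakk> \<Longrightarrow>
      n \<bullet> (y' - z) \<le> \<epsilon> * norm (y' - z)"
    by (rule eps_normal_coneE) blast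
  have "\<forall>\<^sub>F t in at_right 0. 0 + t * norm g < \<delta> + t * 0"
    by (rule eventually_affine_less) (use \<delta> in simp)
  moreover have "\<forall>\<^sub>F t in at_right (0::real). 0 < t"
    by (rule eventually_at_right_less)
  ultimately have "\<forall>\<^sub>F t in at_right 0. z + t *\<^sub>R g \<in> \<Omega> \<and> t * norm g < \<delta> \<and> 0 < t"
    using ray by eventually_elim simp
  then obtain t where t: "z + t *\<^sub>R g \<in> \<Omega>" "t * norm g < \<delta>" "0 < t"
    using eventually_happens'[OF trivial_limit_at_right_real] by blast
  then have "n \<bullet> (t *\<^sub>R g) \<le> \<epsilon> * norm (t *\<^sub>R g)"
    using \<delta>(2)[of "z + t *\<^sub>R g"] by simp
  then have "t * (n \<bullet> g) \<le> t * (\<epsilon> * norm g)"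
    using t(3) by (simp add: mult_ac)
  then have "n \<bullet> g \<le> \<epsilon> * norm g"
    using t(3) by (rule mult_left_le_imp_le)
  also have "\<dots> \<le> \<epsilon> * (norm g + 1)"
    using \<open>0 < \<epsilon>\<close> by simp
  also have "\<dots> = e"
    using * by (simp add: \<epsilon>_def)
  finally show "n \<bullet> g \<le> 0 + e" by simp
qed

lemma limiting_normal_coneI:
  assumes "\<And>\<epsilon>. 0 < \<epsilon> \<Longrightarrow>
    \<exists>y'\<in>\<Omega>. \<exists>v'\<in>regular_normal_cone y' \<Omega>. dist y' y < \<epsilon> \<and> dist v' v < \<epsilon>"
  shows "v \<in> limiting_normal_cone y \<Omega>"
proof -
  have "\<forall>k. \<exists>y' v'. y' \<in> \<Omega> \<and> v' \<in> regular_normal_cone y' \<Omega> \<and>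
          dist y' y < inverse (real (Suc k)) \<and> dist v' v < inverse (real (Suc k))"
    using assms by (metis inverse_positive_iff_positive of_nat_0_less_iff zero_less_Suc)
  then obtain ys vs where *: "\<And>k. ys k \<in> \<Omega>" "\<And>k. vs k \<in> regular_normal_cone (ys k) \<Omega>"
    "\<And>k. dist (ys k) y < inverse (real (Suc k))" "\<And>k. dist (vs k) v < inverse (real (Suc k))"
    by metis
  have "(\<lambda>k. dist (ys k) y) \<longlonglongrightarrow> 0" "(\<lambda>k. dist (vs k) v) \<longlonglongrightarrow> 0"
    by (rule Lim_null_comparison[OF _ LIMSEQ_inverse_real_of_nat],
        use *(3,4) in \<open>auto intro!: always_eventually less_imp_le\<close>)+
  then have "ys \<longlonglongrightarrow> y" "vs \<longlonglongrightarrow> v"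
    using tendsto_dist_iff by blast+
  then show ?thesis
    unfolding limiting_normal_cone_def using *(1,2) by blast
qed

text \<open>Half of \<epsilon> pays for replacing the regular normal \<open>vs k\<close> by
  \<open>v\<close>. The result concerns the fixed vector \<open>v\<close>, so later estimates need
  not carry a sequence of normals.\<close>

lemma limiting_normal_cone_imp_eps:
  assumes "v \<in> limiting_normal_cone y \<Omega>" "0 < \<epsilon>"
  shows "\<exists>y'\<in>\<Omega>. dist y' y < \<epsilon> \<and> v \<in> eps_normal_cone \<epsilon> y' \<Omega>"
proof -
  obtain ys vs where *: "\<And>k::nat. ys k \<in> \<Omega>" "\<And>k. vs k \<in> regular_normal_cone (ys k) \<Omega>"
    "ys \<longlonglongrightarrow> y" "vs \<longlonglongrightarrow> v"
    using assms(1) unfolding limiting_normal_cone_def by blast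
  have "\<forall>\<^sub>F k in sequentially. dist (ys k) y < \<epsilon> \<and> dist (vs k) v < \<epsilon> / 2"
    using \<open>0 < \<epsilon>\<close> by (intro eventually_conj tendstoD *(3,4)) simp_all
  then obtain k where k: "dist (ys k) y < \<epsilon>" "dist (vs k) v < \<epsilon> / 2"
    using eventually_happens'[OF sequentially_bot] by blast
  have "vs k \<in> eps_normal_cone (\<epsilon> / 2) (ys k) \<Omega>"
    using *(2)[of k] \<open>0 < \<epsilon>\<close> unfolding regular_normal_cone_eq by auto
  then have "v \<in> eps_normal_cone \<epsilon> (ys k) \<Omega>"
    by (rule eps_normal_cone_perturb) (use k(2) in \<open>simp add: dist_norm norm_minus_commute\<close>)
  then show ?thesis
    using *(1) k(1) by blast
qed

text \<open>Project \<open>z + t v\<close> onto \<open>\<Omega>\<close>: the projection residual, divided by \<open>t\<close>, is a proximal normal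
  at the projected point, and the \<open>\<epsilon>\<close>-normality of \<open>v\<close> keeps it within \<open>2 \<epsilon>\<close> of \<open>v\<close>.\<close>

lemma eps_normal_near_regular_normal:
  fixes z :: "'a::euclidean_space"
  assumes cl: "closed (\<Omega> \<inter> cball c R)" and z: "z \<in> \<Omega>" "dist z c < R"
    and v: "v \<in> eps_normal_cone \<epsilon> z \<Omega>" and "0 \<le> \<epsilon>" "0 < \<eta>"
  shows "\<exists>p\<in>\<Omega>. \<exists>m\<in>regular_normal_cone p \<Omega>. dist p z < \<eta> \<and> dist m v \<le> 2 * \<epsilon>"
proof -
  obtain \<delta> where \<delta>: "0 < \<delta>"
    "\<And>y'. \<lbrakk>y' \<in> \<Omega>; norm (y' - z) < \<delta>\<rbrakk> \<Longrightarrow> v \<bullet> (y' - z) \<le> \<epsilon> * norm (y' - z)"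
    using v by (rule eps_normal_coneE) blast
  \<comment> \<open>Three radii at once: \<delta> for the test inequality at \<open>p\<close>,
    \<eta> for closeness, and the distance of \<open>z\<close> to the boundary of
    \<open>cball c R\<close>, so that the truncation of \<open>\<Omega>\<close> is invisible near
    \<open>p\<close>.\<close>
  define \<mu> where "\<mu> = min (min \<delta> \<eta>) (R - dist z c)"
  have "0 < \<mu>"
    using \<delta>(1) \<open>0 < \<eta>\<close> z(2) by (simp add: \<mu>_def)
  define t where "t = \<mu> / (2 * norm v + 1)"
  have t: "0 < t" "2 * t * norm v < \<mu>"
  proof -
    have *: "0 < 2 * norm v + 1"
      by (simp add: add_nonneg_pos)
    then show "0 < t"
      using \<open>0 < \<mu>\<close> by (simp add: t_def)
    show "2 * t * norm v < \<mu>"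
      using \<open>0 < \<mu>\<close> * by (simp add: t_def pos_divide_less_eq algebra_simps)
  qed
  let ?z = "z + t *\<^sub>R v"
  have "\<Omega> \<inter> cball c R \<noteq> {}"
    using z by (auto simp: dist_commute)
  then obtain p where p: "p \<in> \<Omega> \<inter> cball c R" "\<And>y. y \<in> \<Omega> \<inter> cball c R \<Longrightarrow> dist ?z p \<le> dist ?z y"
    using distance_attains_inf[OF cl] by blast
  have "dist ?z p \<le> dist ?z z"
    using p(2) z by (auto simp: dist_commute)
  then have le: "norm (p - ?z) \<le> t * norm v"
    using t(1) by (simp add: dist_norm norm_minus_commute)
  have "norm (p - z) \<le> norm (p - ?z) + norm (?z - z)"
    by (metis diff_add_cancel add_diff_eq norm_triangle_ineq)
  also have "\<dots> \<le> 2 * t * norm v"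
    using le t(1) by simp
  finally have pz: "norm (p - z) < \<mu>"
    using t(2) by linarith
  \<comment> \<open>Expanding the square, \<open>p\<close> can be as close to \<open>?z\<close> as
    \<open>z\<close> only if \<open>v\<close> points towards \<open>p - z\<close>. The
    \<epsilon>-normality limits this, and dividing by \<open>norm (p - z)\<close> leaves a bound
    proportional to \<open>t\<close>.\<close>
  have "(norm (p - ?z))\<^sup>2 \<le> (t * norm v)\<^sup>2"
    using le by (rule power_mono) simp
  moreover have "(norm (p - ?z))\<^sup>2 = (norm (p - z))\<^sup>2 - 2 * t * (v \<bullet> (p - z)) + (t * norm v)\<^sup>2"
    unfolding power_mult_distrib power2_norm_eq_inner
    by (simp add: algebra_simps inner_commute power2_eq_square)
  ultimately have "(norm (p - z))\<^sup>2 \<le> 2 * t * (v \<bullet> (p - z))"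
    by simp
  also have "\<dots> \<le> 2 * t * (\<epsilon> * norm (p - z))"
    using \<delta>(2)[of p] p(1) pz t(1) by (intro mult_left_mono) (auto simp: \<mu>_def)
  finally have "norm (p - z) * norm (p - z) \<le> (2 * t * \<epsilon>) * norm (p - z)"
    by (simp add: power2_eq_square algebra_simps)
  then have pz': "norm (p - z) \<le> 2 * t * \<epsilon>"
    using t(1) \<open>0 \<le> \<epsilon>\<close> by (cases "p = z") auto
  define m where "m = (?z - p) /\<^sub>R t"
  have "m - v = (z - p) /\<^sub>R t"
    using t(1) by (simp add: m_def algebra_simps)
  then have "dist m v \<le> 2 * \<epsilon>"
    using pz' t(1) by (simp add: dist_norm norm_minus_commute[of z] pos_divide_le_eq divide_inverse_commute[symmetric] mult_ac)
  \<comment> \<open>\<open>p\<close> is a nearest point to \<open>?z\<close>, so expanding the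
    square once more bounds \<open>m \<bullet> (y - p)\<close> by a quadratic with factor
    \<open>1 / (2 * t)\<close>.\<close>
  moreover have "m \<in> regular_normal_cone p \<Omega>"
  proof (rule proximal_normal_imp_regular)
    show "0 < R - dist p c"
      using pz dist_triangle[of p c z] by (simp add: \<mu>_def dist_norm)
  next
    fix y assume y: "y \<in> \<Omega>" "norm (y - p) < R - dist p c"
    have "y \<in> cball c R"
      using y(2) dist_triangle[of y c p] by (simp add: dist_norm norm_minus_commute)
    then have "norm (?z - p) \<le> norm (?z - y)"
      using p(2) y(1) by (simp add: dist_norm)
    then have "(norm (?z - p))\<^sup>2 \<le> (norm (?z - y))\<^sup>2"
      by (rule power_mono) simp
    moreover have "(norm (?z - y))\<^sup>2 = (norm (?z - p))\<^sup>2 - 2 * ((?z - p) \<bullet> (y - p)) + (norm (y - p))\<^sup>2"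
      unfolding power2_norm_eq_inner by (simp add: algebra_simps inner_commute)
    ultimately have "2 * ((?z - p) \<bullet> (y - p)) \<le> (norm (y - p))\<^sup>2"
      by simp
    then show "m \<bullet> (y - p) \<le> 1 / (2 * t) * (norm (y - p))\<^sup>2"
      using t(1) by (simp add: m_def divide_inverse_commute[symmetric] pos_divide_le_eq mult_ac)
  qed
  ultimately show ?thesis
    using p(1) pz by (force simp: \<mu>_def dist_norm)
qed

text \<open>The nontrivial direction projects, hence the local closedness. Starting from a quarter
  of \<epsilon>, the projected point stays within \<open>\<epsilon> / 2\<close> of \<open>z\<close>
  and the vector changes by at most \<open>\<epsilon> / 2\<close>.\<close>

lemma limiting_normal_cone_iff_eps:
  fixes z :: "'a::euclidean_space"
  assumes cl: "closed (\<Omega> \<inter> cball z R)" and "0 < R"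
  shows "v \<in> limiting_normal_cone z \<Omega> \<longleftrightarrow>
    (\<forall>\<epsilon>>0. \<exists>z'\<in>\<Omega>. dist z' z < \<epsilon> \<and> v \<in> eps_normal_cone \<epsilon> z' \<Omega>)" (is "_ \<longleftrightarrow> ?R")
proof
  assume R: ?R
  show "v \<in> limiting_normal_cone z \<Omega>"
  proof (rule limiting_normal_coneI)
    fix \<epsilon> :: real assume "0 < \<epsilon>"
    define \<epsilon>' where "\<epsilon>' = min (\<epsilon> / 4) R"
    have "0 < \<epsilon>'"
      using \<open>0 < \<epsilon>\<close> \<open>0 < R\<close> by (simp add: \<epsilon>'_def)
    then obtain z' where z': "z' \<in> \<Omega>" "dist z' z < \<epsilon>'" "v \<in> eps_normal_cone \<epsilon>' z' \<Omega>"
      using R by blast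
    have "dist z' z < R"
      using z'(2) by (simp add: \<epsilon>'_def)
    from eps_normal_near_regular_normal[OF cl z'(1) this z'(3) _ \<open>0 < \<epsilon>'\<close>]
    obtain p m where pm: "p \<in> \<Omega>" "m \<in> regular_normal_cone p \<Omega>" "dist p z' < \<epsilon>'" "dist m v \<le> 2 * \<epsilon>'"
      using \<open>0 < \<epsilon>'\<close> by auto
    have "dist p z < \<epsilon>"
      using pm(3) z'(2) dist_triangle[of p z z'] \<open>0 < \<epsilon>\<close> by (auto simp: \<epsilon>'_def)
    moreover have "dist m v < \<epsilon>"
      using pm(4) \<open>0 < \<epsilon>\<close> by (auto simp: \<epsilon>'_def)
    ultimately show "\<exists>y'\<in>\<Omega>. \<exists>v'\<in>regular_normal_cone y' \<Omega>. dist y' z < \<epsilon> \<and> dist v' v < \<epsilon>"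
      using pm(1,2) by blast
  qed
qed (use limiting_normal_cone_imp_eps in blast)

lemma limiting_normal_cone_zero:
  assumes "z \<in> \<Omega>"
  shows "0 \<in> limiting_normal_cone z \<Omega>"
proof (rule limiting_normal_coneI)
  fix \<epsilon> :: real assume "0 < \<epsilon>"
  have "0 \<in> regular_normal_cone z \<Omega>"
    by (rule proximal_normal_imp_regular[of 1 _ _ _ 0]) simp_all
  then show "\<exists>y'\<in>\<Omega>. \<exists>v'\<in>regular_normal_cone y' \<Omega>. dist y' z < \<epsilon> \<and> dist v' 0 < \<epsilon>"
    using assms \<open>0 < \<epsilon>\<close> by (metis dist_self)
qed

text \<open>Homogeneity justifies normalizing normals in the compactness and supremum arguments.
  Dividing \<epsilon> by \<open>t + 1\<close> admits \<open>t = 0\<close>.\<close>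

lemma limiting_normal_cone_scale:
  assumes "v \<in> limiting_normal_cone z \<Omega>" "0 \<le> t"
  shows "t *\<^sub>R v \<in> limiting_normal_cone z \<Omega>"
proof -
  have reg: "t *\<^sub>R n \<in> regular_normal_cone y \<Omega>" if n: "n \<in> regular_normal_cone y \<Omega>" for n y
    unfolding regular_normal_cone_eq
  proof
    fix \<epsilon> :: real assume "\<epsilon> \<in> {0<..}"
    then have "0 < \<epsilon>" by simp
    then have "n \<in> eps_normal_cone (\<epsilon> / (t + 1)) y \<Omega>"
      using n assms(2) unfolding regular_normal_cone_eq by auto
    then obtain \<delta> where \<delta>: "0 < \<delta>" "\<And>y'. \<lbrakk>y' \<in> \<Omega>; norm (y' - y) < \<delta>\<rbrakk> \<Longrightarrow>
        n \<bullet> (y' - y) \<le> \<epsilon> / (t + 1) * norm (y' - y)"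
      by (rule eps_normal_coneE) blast
    show "t *\<^sub>R n \<in> eps_normal_cone \<epsilon> y \<Omega>"
    proof (rule eps_normal_coneI[OF \<delta>(1)])
      fix y' assume "y' \<in> \<Omega>" "norm (y' - y) < \<delta>"
      then have "t * (n \<bullet> (y' - y)) \<le> t * (\<epsilon> / (t + 1) * norm (y' - y))"
        by (intro mult_left_mono \<delta>(2) assms(2))
      also have "\<dots> = (t / (t + 1)) * (\<epsilon> * norm (y' - y))"
        by simp
      also have "\<dots> \<le> 1 * (\<epsilon> * norm (y' - y))"
        using assms(2) \<open>0 < \<epsilon>\<close> by (intro mult_right_mono) auto
      finally show "(t *\<^sub>R n) \<bullet> (y' - y) \<le> \<epsilon> * norm (y' - y)"
        by simp
    qed
  qed
  obtain ys vs where "\<And>k::nat. ys k \<in> \<Omega>" "\<And>k. vs k \<in> regular_normal_cone (ys k) \<Omega>"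
    "ys \<longlonglongrightarrow> z" "vs \<longlonglongrightarrow> v"
    using assms(1) unfolding limiting_normal_cone_def by blast
  then show ?thesis
    unfolding limiting_normal_cone_def mem_Collect_eq
    by (intro exI[of _ ys] exI[of _ "\<lambda>k. t *\<^sub>R vs k"]) (auto intro: reg tendsto_scaleR)
qed

text \<open>A diagonal choice: a normal near \<open>v\<close>, then a late term of its sequence.
  Closedness supplies the compact set on which the coderivative condition becomes
  quantitative.\<close>

lemma closed_limiting_normal_cone: "closed (limiting_normal_cone z \<Omega>)"
  unfolding closure_subset_eq[symmetric]
proof
  fix v assume "v \<in> closure (limiting_normal_cone z \<Omega>)"
  then have v: "\<forall>e>0. \<exists>y\<in>limiting_normal_cone z \<Omega>. dist y v < e"
    by (simp add: closure_approachable)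
  show "v \<in> limiting_normal_cone z \<Omega>"
  proof (rule limiting_normal_coneI)
    fix \<epsilon> :: real assume "0 < \<epsilon>"
    then obtain n where n: "n \<in> limiting_normal_cone z \<Omega>" "dist n v < \<epsilon> / 2"
      using v by (meson half_gt_zero)
    obtain ys vs where *: "\<And>k::nat. ys k \<in> \<Omega>" "\<And>k. vs k \<in> regular_normal_cone (ys k) \<Omega>"
      "ys \<longlonglongrightarrow> z" "vs \<longlonglongrightarrow> n"
      using n(1) unfolding limiting_normal_cone_def by blast
    have "\<forall>\<^sub>F k in sequentially. dist (ys k) z < \<epsilon> \<and> dist (vs k) n < \<epsilon> / 2"
      using \<open>0 < \<epsilon>\<close> by (intro eventually_conj tendstoD *(3,4)) simp_all
    then obtain k where k: "dist (ys k) z < \<epsilon>" "dist (vs k) n < \<epsilon> / 2"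
      using eventually_happens'[OF sequentially_bot] by blast
    have "dist (vs k) v < \<epsilon>"
      using k(2) n(2) dist_triangle[of "vs k" v n] by simp
    then show "\<exists>y'\<in>\<Omega>. \<exists>v'\<in>regular_normal_cone y' \<Omega>. dist y' z < \<epsilon> \<and> dist v' v < \<epsilon>"
      using *(1,2) k(1) by blast
  qed
qed

section \<open>The coderivative criterion\<close>

text \<open>Moving the parameter by \<open>t\<close> along \<open>\<omega>\<close> gains
  \<open>t * norm \<omega>\<close>. The Lipschitz property keeps the accompanying move of
  \<open>x\<close> within \<open>l * t\<close>, which costs at most
  \<open>l * t * norm \<xi>\<close>, and a normal allows no net gain beyond an \<epsilon>
  share.\<close>

lemma lip_modulus_imp_normal_bound:
  fixes S :: "'c::real_inner \<Rightarrow> 'a::real_inner set"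
  assumes lip: "lip_modulus S w x l" and N: "(\<omega>, \<xi>) \<in> limiting_normal_cone (w, x) (gph S)"
  shows "norm \<omega> \<le> l * norm \<xi>"
proof (cases "\<omega> = 0")
  case True
  then show ?thesis using lip by (simp add: lip_modulus_def)
next
  case False
  obtain U V where UV: "0 < l" "open U" "w \<in> U" "open V" "x \<in> V"
    "\<And>w1 w2. \<lbrakk>w1 \<in> U; w2 \<in> U\<rbrakk> \<Longrightarrow>
       S w1 \<inter> V \<subseteq> S w2 + (\<lambda>b. (l * norm (w1 - w2)) *\<^sub>R b) ` cball 0 1"
    using lip unfolding lip_modulus_def by metis
  have "open (U \<times> V)" "(w, x) \<in> U \<times> V"
    using UV by (auto intro: open_Times)
  then obtain r where r: "0 < r" "ball (w, x) r \<subseteq> U \<times> V"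
    using open_contains_ball by blast
  have *: "norm \<omega> \<le> l * norm \<xi> + \<epsilon> * (1 + l)" if "0 < \<epsilon>" for \<epsilon>
  proof -
    have "0 < min \<epsilon> r"
      using \<open>0 < \<epsilon>\<close> r(1) by simp
    from limiting_normal_cone_imp_eps[OF N this] obtain w' x' where
      wx: "(w', x') \<in> gph S" "dist (w', x') (w, x) < r"
      and eps: "(\<omega>, \<xi>) \<in> eps_normal_cone (min \<epsilon> r) (w', x') (gph S)"
      by (auto simp del: dist_Pair_Pair)
    obtain \<delta> where \<delta>: "0 < \<delta>" "\<And>y'. \<lbrakk>y' \<in> gph S; norm (y' - (w', x')) < \<delta>\<rbrakk> \<Longrightarrow>
        (\<omega>, \<xi>) \<bullet> (y' - (w', x')) \<le> min \<epsilon> r * norm (y' - (w', x'))"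
      using eps by (rule eps_normal_coneE) blast
    have UV': "w' \<in> U" "x' \<in> V"
      using r(2) wx(2) by (auto simp: subset_iff dist_commute simp del: dist_Pair_Pair)
    obtain r' where r': "0 < r'" "ball w' r' \<subseteq> U"
      using UV(2) UV'(1) open_contains_ball by blast
    \<comment> \<open>\<open>r' / 2\<close> keeps the new parameter in \<open>U\<close>; the total
      displacement is at most \<open>t * (1 + l)\<close> and has to stay below \<delta>.\<close>
    define t where "t = min (r' / 2) (\<delta> / (2 * (1 + l)))"
    have "0 < \<delta> / (2 * (1 + l))"
      using \<delta>(1) UV(1) by simp
    then have t: "0 < t" "t < r'"
      using r'(1) by (simp_all add: t_def)
    have "t * (1 + l) \<le> \<delta> / (2 * (1 + l)) * (1 + l)"
      using UV(1) by (intro mult_right_mono) (simp_all add: t_def)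
    also have "\<dots> = \<delta> / 2"
      using UV(1) by (simp add: field_simps)
    also have "\<dots> < \<delta>"
      using \<delta>(1) by simp
    finally have t3: "t * (1 + l) < \<delta>" .
    define e where "e = \<omega> /\<^sub>R norm \<omega>"
    have e: "norm e = 1" "\<omega> \<bullet> e = norm \<omega>"
      using False by (auto simp: e_def dot_square_norm power2_eq_square)
    have "w' + t *\<^sub>R e \<in> U"
      using r'(2) t e by (auto simp: subset_iff dist_norm)
    then have "S w' \<inter> V \<subseteq> S (w' + t *\<^sub>R e) + (\<lambda>b. (l * norm (w' - (w' + t *\<^sub>R e))) *\<^sub>R b) ` cball 0 1"
      using UV(6) UV'(1) by blast
    moreover have "x' \<in> S w' \<inter> V"
      using wx(1) UV'(2) by (simp add: gph_def)
    ultimately obtain x'' b where x'': "x'' \<in> S (w' + t *\<^sub>R e)" "norm b \<le> 1"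
      "x' = x'' + (l * t) *\<^sub>R b"
      using t(1) e(1) by (auto simp: set_plus_def)
    have nx: "norm (x'' - x') \<le> l * t"
      using x''(2,3) UV(1) t(1) mult_left_mono[OF x''(2), of "l * t"] by (simp add: norm_minus_commute)
    have "norm (w' + t *\<^sub>R e - w', x'' - x') \<le> norm (t *\<^sub>R e) + norm (x'' - x')"
      using norm_Pair_le[of "w' + t *\<^sub>R e - w'"] by simp
    also have "\<dots> \<le> t * (1 + l)"
      using nx e(1) t(1) by (simp add: algebra_simps)
    finally have n: "norm (w' + t *\<^sub>R e - w', x'' - x') \<le> t * (1 + l)" .
    have "(w' + t *\<^sub>R e, x'') \<in> gph S"
      using x''(1) by (simp add: gph_def)
    then have "(\<omega>, \<xi>) \<bullet> ((w' + t *\<^sub>R e, x'') - (w', x')) \<le> min \<epsilon> r * norm ((w' + t *\<^sub>R e, x'') - (w', x'))"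
      by (rule \<delta>(2)) (use n t3 in simp)
    also have "\<dots> \<le> \<epsilon> * (t * (1 + l))"
      using n \<open>0 < \<epsilon>\<close> by (intro mult_mono) auto
    finally have "t * norm \<omega> + \<xi> \<bullet> (x'' - x') \<le> t * (\<epsilon> * (1 + l))"
      using e(2) by (simp add: mult_ac)
    moreover have "- (\<xi> \<bullet> (x'' - x')) \<le> norm \<xi> * (l * t)"
      using Cauchy_Schwarz_ineq2[of \<xi> "x'' - x'"] mult_left_mono[OF nx norm_ge_zero[of \<xi>]] by linarith
    ultimately have "t * norm \<omega> \<le> t * (l * norm \<xi> + \<epsilon> * (1 + l))"
      by (simp add: algebra_simps)
    then show ?thesis
      using t(1) by simp
  qed
  show ?thesis
  proof (rule field_le_epsilon)
    fix e :: real assume "0 < e"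
    then show "norm \<omega> \<le> l * norm \<xi> + e"
      using *[of "e / (1 + l)"] UV(1) by simp
  qed
qed

text \<open>Concavity of the root, in the form \<open>0 \<le> (sqrt s' - sqrt s)\<^sup>2\<close>.
  Applied to squared norms, it bounds a norm from above by a quadratic that touches it at a given
  nonzero point.\<close>

lemma sqrt_le_tangent:
  assumes "0 < s" "0 \<le> s'"
  shows "sqrt s' \<le> sqrt s + (s' - s) / (2 * sqrt s)"
proof -
  define q where "q = sqrt s"
  have q: "0 < q" "s = q\<^sup>2"
    using assms(1) by (auto simp: q_def)
  have "0 \<le> (sqrt s' - q)\<^sup>2"
    by simp
  then have "2 * (sqrt s' * q) \<le> s' + q\<^sup>2"
    using assms(2) by (simp add: power2_diff)
  then show ?thesis
    unfolding q_def[symmetric] using q by (simp add: field_simps power2_eq_square)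
qed

text \<open>The normal is found at a minimizer of the smooth penalty
  \<open>norm (w - w2) + sqrt (norm (x - x1)\<^sup>2 + \<delta>\<^sup>2) / \<kappa>'\<close> over the graph: the failure of the estimate
  at \<open>(w1, x1, w2)\<close> keeps the minimizer off the fibre over \<open>w2\<close>.\<close>

lemma lip_failure_imp_regular_normal:
  fixes S :: "'c::euclidean_space \<Rightarrow> 'a::euclidean_space set"
  assumes cl: "closed (gph S \<inter> cball (w, x) R)"
    and \<kappa>: "0 < \<kappa>'" "\<kappa>' < \<kappa>"
    and r: "0 < r" "(2 + 2 * \<kappa> + 2 * (\<kappa> / \<kappa>')) * r < R"
    and near: "dist w1 w < r" "dist w2 w < r" "dist x1 x < r" "x1 \<in> S w1"
    and fail: "\<And>x2. x2 \<in> S w2 \<Longrightarrow> \<kappa> * norm (w1 - w2) < norm (x1 - x2)"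
  shows "\<exists>z\<in>gph S. \<exists>\<omega> \<xi>. dist z (w, x) \<le> (2 + 2 * \<kappa> + 2 * (\<kappa> / \<kappa>')) * r \<and>
    norm \<omega> = 1 \<and> norm \<xi> \<le> 1 / \<kappa>' \<and> (\<omega>, \<xi>) \<in> regular_normal_cone z (gph S)"
proof -
  define N where "N = norm (w1 - w2)"
  have "w1 \<noteq> w2"
    using fail[of x1] near(4) by auto
  then have "0 < N"
    by (simp add: N_def)
  have "N \<le> 2 * r"
    using dist_triangle2[of w1 w2 w] near(1,2) by (simp add: N_def dist_norm)
  \<comment> \<open>With this \<delta> the penalty at \<open>(w1, x1)\<close> is exactly
    \<open>N * (\<kappa> / \<kappa>')\<close>. A minimizer over \<open>w2\<close> would then lie
    within \<open>\<kappa> * N\<close> of \<open>x1\<close>, which the failure excludes.\<close>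
  define \<delta> where "\<delta> = (\<kappa> - \<kappa>') * N"
  have "0 < \<delta>"
    using \<open>0 < N\<close> \<kappa> by (simp add: \<delta>_def)
  \<comment> \<open>The root with \<delta> rounds off the kink of the norm at \<open>x1\<close>. The
    kink of the first term at \<open>w2\<close> is harmless once the minimizer is known to avoid
    that fibre.\<close>
  define \<psi> where "\<psi> z = norm (fst z - w2) + sqrt ((norm (snd z - x1))\<^sup>2 + \<delta>\<^sup>2) / \<kappa>'" for z :: "'c \<times> 'a"
  define M where "M = gph S \<inter> cball (w, x) R"
  have dist_le: "dist (u, v) (w, x) \<le> dist u w + dist v x" for u :: 'c and v :: 'a
    unfolding dist_norm by (simp add: norm_Pair_le)
  have "compact M"
    using cl unfolding M_def compact_eq_bounded_closed by (meson bounded_Int bounded_cball)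
  moreover have "continuous_on M \<psi>"
    unfolding \<psi>_def by (intro continuous_intros) (use \<kappa> in auto)
  moreover have 1: "(w1, x1) \<in> M"
  proof -
    have "2 * r < R"
    proof -
      have "2 * r \<le> (2 + 2 * \<kappa> + 2 * (\<kappa> / \<kappa>')) * r"
        using \<kappa> r(1) by (intro mult_right_mono) auto
      with r(2) show ?thesis by simp
    qed
    then have "dist (w1, x1) (w, x) \<le> R"
      using dist_le[of w1 x1] near by simp
    then show ?thesis
      using near(4) by (auto simp: M_def gph_def dist_commute simp del: dist_Pair_Pair)
  qed
  ultimately obtain z where z: "z \<in> M" "\<And>y. y \<in> M \<Longrightarrow> \<psi> z \<le> \<psi> y"
    using continuous_attains_inf[of M \<psi>] by blast
  obtain w' x' where zeq: "z = (w', x')"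
    by (cases z)
  define E where "E = norm (w' - w2)"
  define Q where "Q = sqrt ((norm (x' - x1))\<^sup>2 + \<delta>\<^sup>2)"
  have "0 < Q"
    using \<open>0 < \<delta>\<close> by (simp add: Q_def add_nonneg_pos)
  have Qx: "norm (x' - x1) \<le> Q"
    unfolding Q_def by (rule real_le_rsqrt) simp
  have "E + Q / \<kappa>' \<le> N + \<delta> / \<kappa>'"
    using z(2)[OF 1] \<open>0 < \<delta>\<close> by (simp add: \<psi>_def zeq E_def Q_def N_def)
  also have "N + \<delta> / \<kappa>' = N * (\<kappa> / \<kappa>')"
    using \<kappa>(1) by (simp add: \<delta>_def field_simps)
  finally have EQ: "E + Q / \<kappa>' \<le> N * (\<kappa> / \<kappa>')" .
  have "0 \<le> E"
    by (simp add: E_def)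
  have "Q / \<kappa>' \<le> N * \<kappa> / \<kappa>'"
    using EQ \<open>0 \<le> E\<close> by simp
  then have "Q \<le> N * \<kappa>"
    using \<kappa>(1) by (simp add: divide_le_cancel)
  have "0 < E"
  proof (rule ccontr)
    assume "\<not> 0 < E"
    then have "w' = w2" by (simp add: E_def)
    then have "x' \<in> S w2"
      using z(1) by (simp add: M_def zeq gph_def)
    then have "\<kappa> * N < norm (x1 - x')"
      using fail by (simp add: N_def)
    then show False
      using Qx \<open>Q \<le> N * \<kappa>\<close> by (simp add: norm_minus_commute mult.commute)
  qed
  have zS: "z \<in> gph S"
    using z(1) by (simp add: M_def)
  \<comment> \<open>The terms are \<open>2 * r * (\<kappa> / \<kappa>')\<close> for
    \<open>E\<close>, \<open>2 * r * \<kappa>\<close> for \<open>Q\<close>, and one \<open>r\<close>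
    each for passing from \<open>w2\<close> to \<open>w\<close> and from \<open>x1\<close> to
    \<open>x\<close>. The sum is below \<open>R\<close>, so the minimizer is interior to the
    ball.\<close>
  have dz: "dist z (w, x) \<le> (2 + 2 * \<kappa> + 2 * (\<kappa> / \<kappa>')) * r"
  proof -
    have "E \<le> 2 * r * (\<kappa> / \<kappa>')"
    proof -
      have "0 < Q / \<kappa>'"
        using \<open>0 < Q\<close> \<kappa>(1) by simp
      moreover have "N * (\<kappa> / \<kappa>') \<le> 2 * r * (\<kappa> / \<kappa>')"
        using \<open>N \<le> 2 * r\<close> \<kappa> by (intro mult_right_mono) auto
      ultimately show ?thesis
        using EQ by linarith
    qed
    moreover have "Q \<le> 2 * r * \<kappa>"
      using \<open>Q \<le> N * \<kappa>\<close> mult_right_mono[OF \<open>N \<le> 2 * r\<close>, of \<kappa>] \<kappa> by linarith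
    moreover have "dist w' w \<le> E + r"
      using dist_triangle[of w' w w2] near(2) by (simp add: E_def dist_norm)
    moreover have "dist x' x \<le> Q + r"
      using dist_triangle[of x' x x1] near(3) Qx by (simp add: dist_norm)
    ultimately show ?thesis
      using dist_le[of w' x'] by (simp add: zeq algebra_simps)
  qed
  \<comment> \<open>The pair is the negative gradient of the penalty at the minimizer: a unit vector
    from the first term, a vector of norm at most \<open>1 / \<kappa>'\<close> from the
    second.\<close>
  define \<omega> where "\<omega> = (w2 - w') /\<^sub>R E"
  define \<xi> where "\<xi> = (x1 - x') /\<^sub>R (\<kappa>' * Q)"
  have "norm \<omega> = 1"
    using \<open>0 < E\<close> by (simp add: \<omega>_def E_def norm_minus_commute)
  moreover have "norm \<xi> \<le> 1 / \<kappa>'"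
  proof -
    have "norm \<xi> = norm (x' - x1) / (\<kappa>' * Q)"
      using \<kappa>(1) \<open>0 < Q\<close> by (simp add: \<xi>_def norm_minus_commute divide_inverse_commute)
    also have "\<dots> \<le> Q / (\<kappa>' * Q)"
      using Qx \<kappa>(1) \<open>0 < Q\<close> by (intro divide_right_mono) auto
    finally show ?thesis
      using \<open>0 < Q\<close> by simp
  qed
  moreover have "(\<omega>, \<xi>) \<in> regular_normal_cone z (gph S)"
  proof (rule proximal_normal_imp_regular)
    show "0 < R - dist z (w, x)"
      using dz r(2) by simp
  next
    fix y assume y: "y \<in> gph S" "norm (y - z) < R - dist z (w, x)"
    obtain w'' x'' where yeq: "y = (w'', x'')"
      by (cases y)
    define h where "h = x'' - x'"
    define k where "k = w'' - w'"
    have hk: "norm h \<le> norm (y - z)" "norm k \<le> norm (y - z)"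
      by (simp_all add: yeq zeq h_def k_def norm_fst_le norm_snd_le)
    have "y \<in> M"
      using y dist_triangle[of y "(w, x)" z]
      by (simp add: M_def dist_norm[of y z] dist_commute[of _ y])
    then have "\<psi> z \<le> \<psi> y"
      by (rule z(2))
    also have "\<psi> y \<le> (E + (2 * ((w' - w2) \<bullet> k) + (norm k)\<^sup>2) / (2 * E)) +
        (Q + (2 * ((x' - x1) \<bullet> h) + (norm h)\<^sup>2) / (2 * Q)) / \<kappa>'"
    proof -
      have "norm (w'' - w2) = sqrt ((norm (w'' - w2))\<^sup>2)"
        by simp
      also have "\<dots> \<le> sqrt (E\<^sup>2) + ((norm (w'' - w2))\<^sup>2 - E\<^sup>2) / (2 * sqrt (E\<^sup>2))"
        using \<open>0 < E\<close> by (intro sqrt_le_tangent) auto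
      also have "(norm (w'' - w2))\<^sup>2 = E\<^sup>2 + (2 * ((w' - w2) \<bullet> k) + (norm k)\<^sup>2)"
        unfolding E_def k_def power2_norm_eq_inner by (simp add: algebra_simps inner_commute)
      finally have A: "norm (w'' - w2) \<le> E + (2 * ((w' - w2) \<bullet> k) + (norm k)\<^sup>2) / (2 * E)"
        using \<open>0 < E\<close> by simp
      have Q2: "Q\<^sup>2 = (norm (x' - x1))\<^sup>2 + \<delta>\<^sup>2"
        by (simp add: Q_def)
      have "sqrt ((norm (x'' - x1))\<^sup>2 + \<delta>\<^sup>2)
          \<le> sqrt (Q\<^sup>2) + ((norm (x'' - x1))\<^sup>2 + \<delta>\<^sup>2 - Q\<^sup>2) / (2 * sqrt (Q\<^sup>2))"
        using \<open>0 < Q\<close> by (intro sqrt_le_tangent) auto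
      also have "(norm (x'' - x1))\<^sup>2 + \<delta>\<^sup>2 - Q\<^sup>2 = 2 * ((x' - x1) \<bullet> h) + (norm h)\<^sup>2"
        unfolding Q2 h_def power2_norm_eq_inner by (simp add: algebra_simps inner_commute)
      finally have B: "sqrt ((norm (x'' - x1))\<^sup>2 + \<delta>\<^sup>2)
          \<le> Q + (2 * ((x' - x1) \<bullet> h) + (norm h)\<^sup>2) / (2 * Q)"
        using \<open>0 < Q\<close> by simp
      show ?thesis
        using A divide_right_mono[OF B, of \<kappa>'] \<kappa>(1) by (simp add: \<psi>_def yeq)
    qed
    also have "\<psi> z = E + Q / \<kappa>'"
      by (simp add: \<psi>_def zeq E_def Q_def)
    finally have "0 \<le> (2 * ((w' - w2) \<bullet> k) + (norm k)\<^sup>2) / (2 * E) +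
        ((2 * ((x' - x1) \<bullet> h) + (norm h)\<^sup>2) / (2 * Q)) / \<kappa>'"
      by (simp add: add_divide_distrib)
    moreover have "(2 * ((w' - w2) \<bullet> k) + (norm k)\<^sup>2) / (2 * E) = - (\<omega> \<bullet> k) + 1 / (2 * E) * (norm k)\<^sup>2"
      using \<open>0 < E\<close> by (simp add: \<omega>_def inner_diff_left field_simps)
    moreover have "((2 * ((x' - x1) \<bullet> h) + (norm h)\<^sup>2) / (2 * Q)) / \<kappa>'
        = - (\<xi> \<bullet> h) + 1 / (2 * Q * \<kappa>') * (norm h)\<^sup>2"
      using \<open>0 < Q\<close> \<kappa>(1) by (simp add: \<xi>_def inner_diff_left field_simps)
    moreover have "1 / (2 * E) * (norm k)\<^sup>2 \<le> 1 / (2 * E) * (norm (y - z))\<^sup>2"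
      using hk(2) \<open>0 < E\<close> by (intro mult_left_mono power_mono) auto
    moreover have "1 / (2 * Q * \<kappa>') * (norm h)\<^sup>2 \<le> 1 / (2 * Q * \<kappa>') * (norm (y - z))\<^sup>2"
      using hk(1) \<open>0 < Q\<close> \<kappa>(1) by (intro mult_left_mono power_mono) auto
    moreover have "(\<omega>, \<xi>) \<bullet> (y - z) = \<omega> \<bullet> k + \<xi> \<bullet> h"
      by (simp add: yeq zeq h_def k_def)
    ultimately show "(\<omega>, \<xi>) \<bullet> (y - z) \<le> (1 / (2 * E) + 1 / (2 * Q * \<kappa>')) * (norm (y - z))\<^sup>2"
      unfolding distrib_right by linarith
  qed
  ultimately show ?thesis
    using zS dz by blast
qed

text \<open>Failures at radii tending to zero produce normals with \<open>norm \<omega> = 1\<close>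
  and \<open>norm \<xi> \<le> 1 / \<kappa>'\<close>. A limit of these would give
  \<open>1 \<le> \<kappa>0 / \<kappa>'\<close>, contrary to the choice of \<open>\<kappa>'\<close>
  above \<open>\<kappa>0\<close>.\<close>

lemma normal_bound_imp_lip_modulus:
  fixes S :: "'c::euclidean_space \<Rightarrow> 'a::euclidean_space set"
  assumes cl: "closed (gph S \<inter> cball (w, x) R)" and "0 < R"
    and bound: "\<And>\<omega> \<xi>. (\<omega>, \<xi>) \<in> limiting_normal_cone (w, x) (gph S) \<Longrightarrow> norm \<omega> \<le> \<kappa>0 * norm \<xi>"
    and \<kappa>: "0 \<le> \<kappa>0" "\<kappa>0 < \<kappa>"
  shows "lip_modulus S w x \<kappa>"
proof (rule ccontr)
  assume no: "\<not> lip_modulus S w x \<kappa>"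
  define \<kappa>' where "\<kappa>' = (\<kappa>0 + \<kappa>) / 2"
  have \<kappa>': "0 < \<kappa>'" "\<kappa>0 < \<kappa>'" "\<kappa>' < \<kappa>"
    using \<kappa> by (auto simp: \<kappa>'_def)
  define C where "C = 2 + 2 * \<kappa> + 2 * (\<kappa> / \<kappa>')"
  have "0 < C"
    using \<kappa> \<kappa>' by (auto simp: C_def intro!: add_pos_nonneg)
  have step: "\<exists>z\<in>gph S. \<exists>\<omega> \<xi>. dist z (w, x) \<le> C * r \<and> norm \<omega> = 1 \<and> norm \<xi> \<le> 1 / \<kappa>' \<and>
      (\<omega>, \<xi>) \<in> regular_normal_cone z (gph S)" if r: "0 < r" "C * r < R" for r
  proof -
    have "\<not> (\<forall>w1\<in>ball w r. \<forall>w2\<in>ball w r.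
        S w1 \<inter> ball x r \<subseteq> S w2 + (\<lambda>b. (\<kappa> * norm (w1 - w2)) *\<^sub>R b) ` cball 0 1)"
      using no r(1) \<kappa> unfolding lip_modulus_def
      by (metis centre_in_ball le_less_trans open_ball)
    then obtain w1 w2 x1 where w: "w1 \<in> ball w r" "w2 \<in> ball w r" "x1 \<in> S w1" "x1 \<in> ball x r"
      and x1: "x1 \<notin> S w2 + (\<lambda>b. (\<kappa> * norm (w1 - w2)) *\<^sub>R b) ` cball 0 1"
      by blast
    have "\<kappa> * norm (w1 - w2) < norm (x1 - x2)" if "x2 \<in> S w2" for x2
    proof (rule ccontr)
      assume asm: "\<not> ?thesis"
      define c where "c = \<kappa> * norm (w1 - w2)"
      \<comment> \<open>For \<open>c = 0\<close> the two points coincide and division by zero yields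
        \<open>b = 0\<close>, which is the right value.\<close>
      define b where "b = (x1 - x2) /\<^sub>R c"
      have c: "norm (x1 - x2) \<le> c" "0 \<le> c"
        using asm \<kappa> by (auto simp: c_def)
      have "norm b = norm (x1 - x2) / c"
        using c(2) by (simp add: b_def divide_inverse_commute)
      also have "\<dots> \<le> 1"
        using c by (cases "c = 0") (simp_all add: pos_divide_le_eq)
      finally have "b \<in> cball 0 1"
        by simp
      moreover have "x1 = x2 + (\<kappa> * norm (w1 - w2)) *\<^sub>R b"
        unfolding c_def[symmetric] using c by (cases "c = 0") (simp_all add: b_def)
      ultimately show False
        using x1 that unfolding set_plus_def by blast
    qed
    then show ?thesis
      using lip_failure_imp_regular_normal[OF cl \<kappa>'(1,3) r(1), of w1 w2 x1] r(2) w
      by (simp add: C_def dist_commute)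
  qed
  \<comment> \<open>Scaled so that \<open>C * r k\<close> is \<open>R / 2\<close> divided by
    \<open>k + 1\<close>: below \<open>R\<close> and tending to zero.\<close>
  define r where "r k = R / (2 * C) * inverse (real (Suc k))" for k
  have r: "0 < r k" "C * r k < R" "C * r k = R / 2 * inverse (real (Suc k))" for k
  proof -
    show "0 < r k"
      using \<open>0 < R\<close> \<open>0 < C\<close> by (simp add: r_def)
    show *: "C * r k = R / 2 * inverse (real (Suc k))"
      using \<open>0 < C\<close> by (simp add: r_def)
    have "R / 2 * inverse (real (Suc k)) \<le> R / 2 * 1"
      using \<open>0 < R\<close> by (intro mult_left_mono) (auto simp: field_simps)
    then show "C * r k < R"
      using * \<open>0 < R\<close> by linarith
  qed
  have "\<forall>k. \<exists>z \<omega> \<xi>. z \<in> gph S \<and> dist z (w, x) \<le> C * r k \<and> norm \<omega> = 1 \<and> norm \<xi> \<le> 1 / \<kappa>' \<and>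
      (\<omega>, \<xi>) \<in> regular_normal_cone z (gph S)"
    using step[OF r(1,2)] by blast
  then obtain z \<omega> \<xi> where z: "\<And>k. z k \<in> gph S" "\<And>k. dist (z k) (w, x) \<le> C * r k"
    and n: "\<And>k. norm (\<omega> k) = 1" "\<And>k. norm (\<xi> k) \<le> 1 / \<kappa>'"
      "\<And>k. (\<omega> k, \<xi> k) \<in> regular_normal_cone (z k) (gph S)"
    by metis
  have "z \<longlonglongrightarrow> (w, x)"
  proof (rule metric_tendsto_imp_tendsto[OF tendsto_mult_right_zero[OF LIMSEQ_inverse_real_of_nat, of "R / 2"]])
    show "\<forall>\<^sub>F k in sequentially. dist (z k) (w, x) \<le> dist (R / 2 * inverse (real (Suc k))) 0"
      using z(2) \<open>0 < R\<close> unfolding r(3) by (auto intro!: always_eventually)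
  qed
  have cpt: "compact (sphere (0::'c) 1 \<times> cball (0::'a) (1 / \<kappa>'))"
    by (intro compact_Times compact_sphere compact_cball)
  have mem: "\<forall>k. (\<omega> k, \<xi> k) \<in> sphere 0 1 \<times> cball 0 (1 / \<kappa>')"
    using n(1,2) by simp
  obtain v s where v: "v \<in> sphere (0::'c) 1 \<times> cball (0::'a) (1 / \<kappa>')"
    and s: "strict_mono (s :: nat \<Rightarrow> nat)" "((\<lambda>k. (\<omega> k, \<xi> k)) \<circ> s) \<longlonglongrightarrow> v"
    by (rule seq_compactE[OF compact_imp_seq_compact[OF cpt] mem])
  have "v \<in> limiting_normal_cone (w, x) (gph S)"
    unfolding limiting_normal_cone_def mem_Collect_eq
    by (intro exI[of _ "z \<circ> s"] exI[of _ "(\<lambda>k. (\<omega> k, \<xi> k)) \<circ> s"] conjI allI s(2)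
        LIMSEQ_subseq_LIMSEQ[OF \<open>z \<longlonglongrightarrow> (w, x)\<close> s(1)]) (simp_all add: z(1) n(3))
  then have "norm (fst v) \<le> \<kappa>0 * norm (snd v)"
    using bound[of "fst v" "snd v"] by simp
  also have "\<dots> \<le> \<kappa>0 * (1 / \<kappa>')"
    using v \<kappa>(1) by (intro mult_left_mono) (auto simp: mem_Times_iff)
  also have "\<dots> < 1"
    using \<kappa>' by simp
  finally show False
    using v by (auto simp: mem_Times_iff)
qed

section \<open>Parametric inclusions\<close>

text \<open>The limit over pairs is a limit at the point \<open>(z, z)\<close> of the product, so
  one radius serves all pairs. It is halved because a distance in the product is at most the sum of
  the two distances.\<close>

lemma strict_derivative_bound:
  assumes "has_strict_derivative f D z" "0 < \<epsilon>"
  shows "\<exists>\<rho>>0. \<forall>p\<in>ball z \<rho>. \<forall>p'\<in>ball z \<rho>. norm (f p - f p' - D (p - p')) \<le> \<epsilon> * norm (p - p')"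
proof -
  have "((\<lambda>(x, x'). (f x - f x' - D (x - x')) /\<^sub>R norm (x - x')) \<longlongrightarrow> 0) (nhds (z, z))"
    using assms(1) unfolding has_strict_derivative_def nhds_prod by blast
  then have "\<forall>\<^sub>F y in nhds (z, z). dist ((\<lambda>(x, x'). (f x - f x' - D (x - x')) /\<^sub>R norm (x - x')) y) 0 < \<epsilon>"
    using assms(2) by (rule tendstoD)
  then obtain r where r: "0 < r" "\<And>y. dist y (z, z) < r \<Longrightarrow>
      dist ((\<lambda>(x, x'). (f x - f x' - D (x - x')) /\<^sub>R norm (x - x')) y) 0 < \<epsilon>"
    unfolding eventually_nhds_metric by blast
  have "norm (f p - f p' - D (p - p')) \<le> \<epsilon> * norm (p - p')"
    if "p \<in> ball z (r / 2)" "p' \<in> ball z (r / 2)" for p p'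
  proof (cases "p = p'")
    case True
    then show ?thesis
      using assms(1) by (simp add: has_strict_derivative_def linear_simps)
  next
    case False
    have "dist (p, p') (z, z) \<le> dist p z + dist p' z"
      unfolding dist_norm by (simp add: norm_Pair_le)
    also have "\<dots> < r"
      using that by (simp add: dist_commute)
    finally have "norm ((f p - f p' - D (p - p')) /\<^sub>R norm (p - p')) < \<epsilon>"
      using r(2)[of "(p, p')"] by simp
    then have "norm (f p - f p' - D (p - p')) / norm (p - p') < \<epsilon>"
      by (simp add: divide_inverse_commute)
    then show ?thesis
      using False by (simp add: pos_divide_less_eq)
  qed
  then show ?thesis
    using r(1) by (intro exI[of _ "r / 2"]) simp
qed

lemma has_strict_derivative_imp_has_derivative:
  assumes "has_strict_derivative f D z"
  shows "(f has_derivative D) (at z)"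
  unfolding has_derivative_within_alt
proof (intro conjI allI impI)
  show "bounded_linear D"
    using assms by (simp add: has_strict_derivative_def)
  fix e :: real assume "0 < e"
  then obtain \<rho> where \<rho>: "0 < \<rho>" "\<And>p p'. \<lbrakk>p \<in> ball z \<rho>; p' \<in> ball z \<rho>\<rbrakk> \<Longrightarrow>
      norm (f p - f p' - D (p - p')) \<le> e * norm (p - p')"
    using strict_derivative_bound[OF assms] by meson
  then show "\<exists>d>0. \<forall>y\<in>UNIV. norm (y - z) < d \<longrightarrow> norm (f y - f z - D (y - z)) \<le> e * norm (y - z)"
    by (intro exI[of _ \<rho>]) (simp add: dist_norm norm_minus_commute)
qed

text \<open>Uniqueness of the Frechet derivative identifies the derivatives of the two sections with
  the blocks of \<open>D\<close>.\<close>

lemma has_derivative_partial: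
  assumes "(f has_derivative D) (at (x, w))"
  shows "partial_x f x w = (\<lambda>h. D (h, 0))" "partial_w f x w = (\<lambda>k. D (0, k))"
proof -
  have "((\<lambda>x'. f (x', w)) has_derivative (\<lambda>h. D (h, 0))) (at x)"
    by (rule has_derivative_compose[of "\<lambda>x'. (x', w)" "\<lambda>h. (h, 0)" x UNIV f D])
      (auto intro!: derivative_eq_intros assms)
  then show "partial_x f x w = (\<lambda>h. D (h, 0))"
    unfolding partial_x_def by (metis frechet_derivative_at)
  have "((\<lambda>w'. f (x, w')) has_derivative (\<lambda>k. D (0, k))) (at w)"
    by (rule has_derivative_compose[of "\<lambda>w'. (x, w')" "\<lambda>k. (0, k)" w UNIV f D])
      (auto intro!: derivative_eq_intros assms)
  then show "partial_w f x w = (\<lambda>k. D (0, k))"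
    unfolding partial_w_def by (metis frechet_derivative_at)
qed

section \<open>Solvability in the parameter near the base point\<close>

locale strict_parametrization =
  fixes f :: "'a::euclidean_space \<times> 'c::euclidean_space \<Rightarrow> 'a"
    and A :: "'a \<Rightarrow> 'a" and B :: "'c \<Rightarrow> 'a" and xb :: 'a and wb :: 'c
  assumes strict: "has_strict_derivative f (\<lambda>(h, k). A h + B k) (xb, wb)"
    and linA: "linear A" and linB: "linear B" and surjB: "surj B"
begin

lemma strict_bound:
  assumes "0 < \<epsilon>"
  obtains \<rho> where "0 < \<rho>"
    "\<And>x w x' w'. \<lbrakk>norm (x - xb) + norm (w - wb) < \<rho>; norm (x' - xb) + norm (w' - wb) < \<rho>\<rbrakk> \<Longrightarrow>
       norm (f (x, w) - f (x', w') - (A (x - x') + B (w - w'))) \<le> \<epsilon> * (norm (x - x') + norm (w - w'))"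
proof -
  obtain \<rho> where \<rho>: "0 < \<rho>" "\<And>p p'. \<lbrakk>p \<in> ball (xb, wb) \<rho>; p' \<in> ball (xb, wb) \<rho>\<rbrakk> \<Longrightarrow>
      norm (f p - f p' - (\<lambda>(h, k). A h + B k) (p - p')) \<le> \<epsilon> * norm (p - p')"
    using strict_derivative_bound[OF strict assms] by meson
  have ball: "(x, w) \<in> ball (xb, wb) \<rho>" if "norm (x - xb) + norm (w - wb) < \<rho>" for x w
    using norm_Pair_le[of "x - xb" "w - wb"] that
    by (simp add: dist_commute[of _ "(x, w)"] dist_norm[of "(x, w)"] del: dist_Pair_Pair)
  show thesis
  proof (rule that[OF \<rho>(1)])
    fix x w x' w' assume "norm (x - xb) + norm (w - wb) < \<rho>" "norm (x' - xb) + norm (w' - wb) < \<rho>"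
    then have "norm (f (x, w) - f (x', w') - (A (x - x') + B (w - w'))) \<le> \<epsilon> * norm (x - x', w - w')"
      using \<rho>(2)[OF ball ball] by fastforce
    also have "\<dots> \<le> \<epsilon> * (norm (x - x') + norm (w - w'))"
      using assms by (intro mult_left_mono norm_Pair_le) simp
    finally show "norm (f (x, w) - f (x', w') - (A (x - x') + B (w - w'))) \<le>
        \<epsilon> * (norm (x - x') + norm (w - w'))" .
  qed
qed

text \<open>A Lyusternik--Graves theorem: Banach iteration through a linear right inverse of \<open>B\<close>.\<close>

lemma parameter_correction:
  assumes "0 < \<epsilon>"
  obtains \<rho> where "0 < \<rho>"
    "\<And>x w h k. \<lbrakk>norm (x - xb) + norm (w - wb) < \<rho>; norm h + norm k < \<rho>\<rbrakk> \<Longrightarrow>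
       \<exists>k'. norm (k' - k) \<le> \<epsilon> * (norm h + norm k) \<and> f (x + h, w + k') = f (x, w) + A h + B k"
proof -
  obtain R where R: "linear R" "B \<circ> R = id"
    using linear_surjective_right_inverse[OF linB surjB] by blast
  then have BR: "B (R v) = v" for v
    by (metis comp_apply id_apply)
  obtain L where L: "0 < L" "\<And>v. norm (R v) \<le> norm v * L"
    using bounded_linear.pos_bounded linear_conv_bounded_linear R(1) by blast
  \<comment> \<open>Makes \<open>\<eta> * L\<close> at most 1/2, the contraction factor, and keeps
    the correction \<open>R s\<close> below both the displacement and \<epsilon> times the
    displacement.\<close>
  define \<eta> where "\<eta> = min \<epsilon> 1 / (2 * L)"
  have \<eta>: "0 < \<eta>" "\<eta> * L \<le> 1 / 2" "2 * \<eta> * L \<le> \<epsilon>" "2 * \<eta> * L \<le> 1"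
    using L(1) assms by (auto simp: \<eta>_def field_simps)
  obtain \<sigma> where \<sigma>: "0 < \<sigma>"
    "\<And>x w x' w'. \<lbrakk>norm (x - xb) + norm (w - wb) < \<sigma>; norm (x' - xb) + norm (w' - wb) < \<sigma>\<rbrakk> \<Longrightarrow>
       norm (f (x, w) - f (x', w') - (A (x - x') + B (w - w'))) \<le> \<eta> * (norm (x - x') + norm (w - w'))"
    using strict_bound[OF \<eta>(1)] by blast
  show thesis
  proof (rule that[of "\<sigma> / 4"])
    \<comment> \<open>Offset from the base point, displacement and correction each stay below a
      quarter of \<sigma>, so every evaluation of \<open>f\<close> remains within the radius of the
      estimate.\<close>
    show "0 < \<sigma> / 4"
      using \<sigma>(1) by simp
  next
    fix x h :: 'a and w k :: 'c
    assume xw: "norm (x - xb) + norm (w - wb) < \<sigma> / 4" and hk: "norm h + norm k < \<sigma> / 4"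
    define m where "m = norm h + norm k"
    \<comment> \<open>A fixed point is a zero of the residual. Since \<open>B (R s) = s\<close>, the
      linear part cancels, and differences of \<open>T\<close> are pure linearization error of
      \<open>f\<close>.\<close>
    define T where "T s = s - (f (x + h, w + k + R s) - f (x, w) - A h - B k)" for s
    \<comment> \<open>\<open>norm (T 0) \<le> \<eta> * m\<close> and contraction by 1/2 make the
      ball of twice that radius invariant.\<close>
    define X where "X = cball (0::'a) (2 * \<eta> * m)"
    have "0 \<le> m"
      by (simp add: m_def)
    have Rm: "norm (R s) \<le> m" "norm (R s) \<le> \<epsilon> * m" if "s \<in> X" for s
    proof -
      have "norm (R s) \<le> norm s * L"
        by (rule L(2))
      also have "\<dots> \<le> (2 * \<eta> * m) * L"
        using that L(1) by (intro mult_right_mono) (auto simp: X_def)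
      also have "\<dots> = (2 * \<eta> * L) * m"
        by simp
      finally show "norm (R s) \<le> m" "norm (R s) \<le> \<epsilon> * m"
        using mult_right_mono[OF \<eta>(3) \<open>0 \<le> m\<close>] mult_right_mono[OF \<eta>(4) \<open>0 \<le> m\<close>] by linarith+
    qed
    have near: "norm (x + h - xb) + norm (w + k + R s - wb) < \<sigma>" if "s \<in> X" for s
    proof -
      have "norm (x + h - xb) \<le> norm (x - xb) + norm h"
        using norm_triangle_ineq[of "x - xb" h] by (simp add: algebra_simps)
      moreover have "norm (w + k + R s - wb) \<le> norm (w - wb) + norm k + norm (R s)"
        using norm_triangle_ineq[of "w - wb + k" "R s"] norm_triangle_ineq[of "w - wb" k]
        by (simp add: algebra_simps)
      ultimately show ?thesis
        using Rm(1)[OF that] xw hk norm_ge_zero[of h] norm_ge_zero[of k] \<sigma>(1) unfolding m_def by linarith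
    qed
    have lip: "dist (T s) (T s') \<le> 1 / 2 * dist s s'" if "s \<in> X" "s' \<in> X" for s s'
    proof -
      have "T s - T s' = - (f (x + h, w + k + R s) - f (x + h, w + k + R s') - (A 0 + B (R s - R s')))"
        by (simp add: T_def BR linear_diff[OF linB] linear_0[OF linA])
      then have "norm (T s - T s') \<le> \<eta> * norm (R s - R s')"
        using \<sigma>(2)[OF near[OF that(1)] near[OF that(2)]] by (simp add: norm_minus_commute)
      also have "norm (R s - R s') \<le> norm (s - s') * L"
        using L(2)[of "s - s'"] by (simp add: linear_diff[OF R(1)])
      finally have "norm (T s - T s') \<le> (\<eta> * L) * norm (s - s')"
        using \<eta>(1) by (simp add: mult_ac)
      also have "\<dots> \<le> 1 / 2 * norm (s - s')"
        by (intro mult_right_mono \<eta>(2)) simp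
      finally show ?thesis
        by (simp add: dist_norm)
    qed
    have "0 \<in> X"
      using \<eta>(1) \<open>0 \<le> m\<close> by (simp add: X_def)
    have T0: "norm (T 0) \<le> \<eta> * m"
    proof -
      have "norm (x - xb) + norm (w - wb) < \<sigma>"
        using xw \<sigma>(1) by linarith
      from \<sigma>(2)[OF near[OF \<open>0 \<in> X\<close>] this]
      have "norm (f (x + h, w + k) - f (x, w) - (A h + B k)) \<le> \<eta> * m"
        by (simp add: linear_0[OF R(1)] m_def)
      then show ?thesis
        by (simp add: T_def linear_0[OF R(1)] norm_minus_commute algebra_simps)
    qed
    have "\<exists>!s\<in>X. T s = s"
    proof (rule Banach_fix[of X "1 / 2" T])
      show "complete X"
        unfolding X_def by (rule compact_imp_complete) simp
      show "X \<noteq> {}"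
        using \<open>0 \<in> X\<close> by blast
      show "T ` X \<subseteq> X"
      proof
        fix y assume "y \<in> T ` X"
        then obtain s where s: "s \<in> X" "y = T s" by blast
        have "norm y \<le> norm (T s - T 0) + norm (T 0)"
          using norm_triangle_ineq[of "T s - T 0" "T 0"] s(2) by simp
        also have "norm (T s - T 0) \<le> \<eta> * m"
          using lip[OF s(1) \<open>0 \<in> X\<close>] s(1) by (simp add: dist_norm X_def)
        finally show "y \<in> X"
          using T0 by (simp add: X_def)
      qed
    qed (use lip in auto)
    then obtain s where s: "s \<in> X" "T s = s" by blast
    have "f (x + h, w + (k + R s)) = f (x, w) + A h + B k"
      using s(2) by (simp add: T_def algebra_simps)
    then show "\<exists>k'. norm (k' - k) \<le> \<epsilon> * (norm h + norm k) \<and> f (x + h, w + k') = f (x, w) + A h + B k"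
      using Rm(2)[OF s(1)] by (intro exI[of _ "k + R s"]) (simp add: m_def)
  qed
qed

lemma linear_bounds:
  obtains \<alpha> \<beta> where "0 < \<alpha>" "\<And>h. norm (A h) \<le> \<alpha> * norm h" "0 < \<beta>" "\<And>k. norm (B k) \<le> \<beta> * norm k"
proof -
  obtain \<alpha> where "0 < \<alpha>" "\<And>h. norm (A h) \<le> norm h * \<alpha>"
    using bounded_linear.pos_bounded linear_conv_bounded_linear linA by blast
  moreover obtain \<beta> where "0 < \<beta>" "\<And>k. norm (B k) \<le> norm k * \<beta>"
    using bounded_linear.pos_bounded linear_conv_bounded_linear linB by blast
  ultimately show thesis
    using that by (simp add: mult.commute)
qed

text \<open>For a displacement \<open>(h, v)\<close> in \<open>\<Gamma>\<close>, the parameter move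
  \<open>k = - R (v + A h)\<close> solves \<open>- (A h + B k) = v\<close>; the constant
  \<open>L\<close> controls its size.\<close>

lemma bounded_right_inverse:
  obtains R L where "linear R" "\<And>v. B (R v) = v" "1 \<le> L"
    "\<And>h v. norm h + norm (R (v + A h)) \<le> L * norm (h, v)"
proof -
  obtain R where R: "linear R" "B \<circ> R = id"
    using linear_surjective_right_inverse[OF linB surjB] by blast
  obtain \<mu> where \<mu>: "0 < \<mu>" "\<And>v. norm (R v) \<le> norm v * \<mu>"
    using bounded_linear.pos_bounded linear_conv_bounded_linear R(1) by blast
  obtain \<alpha> where \<alpha>: "0 < \<alpha>" "\<And>h. norm (A h) \<le> \<alpha> * norm h"
    using linear_bounds by metis
  show thesis
  proof (rule that[OF R(1)])
    show "B (R v) = v" for v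
      using R(2) by (metis comp_apply id_apply)
    show "1 \<le> 1 + (1 + \<alpha>) * \<mu>"
      using \<mu>(1) \<alpha>(1) by simp
    fix h v :: 'a
    have *: "norm h \<le> norm (h, v)" "norm v \<le> norm (h, v)"
      by (simp_all add: norm_fst_le norm_snd_le)
    have "norm (R (v + A h)) \<le> (norm v + norm (A h)) * \<mu>"
      using \<mu>(2)[of "v + A h"] mult_right_mono[OF norm_triangle_ineq[of v "A h"], of \<mu>] \<mu>(1) by linarith
    also have "\<dots> \<le> (norm (h, v) + \<alpha> * norm (h, v)) * \<mu>"
      using * \<alpha>(2)[of h] mult_left_mono[OF *(1), of \<alpha>] \<alpha>(1) \<mu>(1)
      by (intro mult_right_mono add_mono) linarith+
    finally show "norm h + norm (R (v + A h)) \<le> (1 + (1 + \<alpha>) * \<mu>) * norm (h, v)"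
      using *(1) by (simp add: algebra_simps)
  qed
qed

end

section \<open>Transport of normals between \<open>gph S\<close> and \<open>\<Gamma>\<close>\<close>

locale parametric_inclusion = strict_parametrization f A B xb wb
  for f :: "'a::euclidean_space \<times> 'c::euclidean_space \<Rightarrow> 'a" and A B xb wb +
  fixes \<Gamma> :: "('a \<times> 'a) set" and S :: "'c \<Rightarrow> 'a set" and vb :: 'a
  assumes closed_\<Gamma>: "closed \<Gamma>"
    and S: "S w = {x. (x, - f (x, w)) \<in> \<Gamma>}"
    and vb: "vb = - f (xb, wb)"
begin

lemma gph_iff: "(w, x) \<in> gph S \<longleftrightarrow> (x, - f (x, w)) \<in> \<Gamma>"
  by (simp add: gph_def S)

text \<open>The increment estimate makes \<open>f\<close> Lipschitz, hence continuous, on a small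
  ball around the base point. Within that ball the graph is a continuous preimage of
  \<open>\<Gamma>\<close>.\<close>

lemma locally_closed_gph:
  obtains R where "0 < R" "closed (gph S \<inter> cball (wb, xb) R)"
proof -
  obtain \<alpha> \<beta> where \<alpha>: "0 < \<alpha>" "\<And>h. norm (A h) \<le> \<alpha> * norm h"
    and \<beta>: "0 < \<beta>" "\<And>k. norm (B k) \<le> \<beta> * norm k"
    using linear_bounds by metis
  obtain \<rho> where \<rho>: "0 < \<rho>"
    "\<And>x w x' w'. \<lbrakk>norm (x - xb) + norm (w - wb) < \<rho>; norm (x' - xb) + norm (w' - wb) < \<rho>\<rbrakk> \<Longrightarrow>
       norm (f (x, w) - f (x', w') - (A (x - x') + B (w - w'))) \<le> 1 * (norm (x - x') + norm (w - w'))"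
    using strict_bound[of 1] by (metis zero_less_one)
  define C where "C = cball (wb, xb) (\<rho> / 4)"
  have near: "norm (x - xb) + norm (w - wb) < \<rho>" if "(w, x) \<in> C" for w x
  proof -
    have "norm (w - wb, x - xb) \<le> \<rho> / 4"
      using that by (simp add: C_def dist_commute[of _ "(w, x)"] dist_norm[of "(w, x)"] del: dist_Pair_Pair)
    then show ?thesis
      using norm_fst_le[of "w - wb" "x - xb"] norm_snd_le[of "x - xb" "w - wb"] \<rho>(1) by linarith
  qed
  have "(2 + \<alpha> + \<beta>)-lipschitz_on ((\<lambda>(w, x). (x, w)) ` C) f"
  proof (rule lipschitz_onI)
    fix p p' assume "p \<in> (\<lambda>(w, x). (x, w)) ` C" "p' \<in> (\<lambda>(w, x). (x, w)) ` C"
    then obtain x w x' w' where p: "p = (x, w)" "p' = (x', w')" "(w, x) \<in> C" "(w', x') \<in> C"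
      by auto
    have "norm (f p - f p') \<le> norm (f p - f p' - (A (x - x') + B (w - w'))) + norm (A (x - x') + B (w - w'))"
      using norm_triangle_ineq[of "f p - f p' - (A (x - x') + B (w - w'))" "A (x - x') + B (w - w')"]
      by simp
    also have "\<dots> \<le> (norm (x - x') + norm (w - w')) + (\<alpha> * norm (x - x') + \<beta> * norm (w - w'))"
      using \<rho>(2)[OF near near, OF p(3,4)] \<alpha>(2)[of "x - x'"] \<beta>(2)[of "w - w'"]
        norm_triangle_ineq[of "A (x - x')" "B (w - w')"] by (simp add: p)
    also have "\<dots> = (1 + \<alpha>) * norm (x - x') + (1 + \<beta>) * norm (w - w')"
      by (simp add: algebra_simps)
    also have "\<dots> \<le> (1 + \<alpha>) * norm (p - p') + (1 + \<beta>) * norm (p - p')"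
      using \<alpha>(1) \<beta>(1) norm_fst_le[of "x - x'" "w - w'"] norm_snd_le[of "w - w'" "x - x'"]
      by (intro add_mono mult_left_mono) (simp_all add: p)
    finally show "dist (f p) (f p') \<le> (2 + \<alpha> + \<beta>) * dist p p'"
      by (simp add: dist_norm algebra_simps)
  qed (use \<alpha> \<beta> in auto)
  then have "continuous_on ((\<lambda>(w, x). (x, w)) ` C) f"
    by (rule lipschitz_on_continuous_on)
  then have "continuous_on C (f \<circ> (\<lambda>(w, x). (x, w)))"
    by (intro continuous_on_compose) (auto simp: split_def intro!: continuous_intros)
  then have "continuous_on C (\<lambda>z. (snd z, - f (snd z, fst z)))"
    by (intro continuous_intros) (simp add: o_def split_def)
  then have "closed (C \<inter> (\<lambda>z. (snd z, - f (snd z, fst z))) -` \<Gamma>)"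
    by (rule continuous_closed_preimage) (use closed_\<Gamma> in \<open>auto simp: C_def\<close>)
  moreover have "C \<inter> (\<lambda>z. (snd z, - f (snd z, fst z))) -` \<Gamma> = gph S \<inter> cball (wb, xb) (\<rho> / 4)"
    by (auto simp: C_def gph_iff simp del: mem_cball)
  ultimately show thesis
    using that[of "\<rho> / 4"] \<rho>(1) by simp
qed

text \<open>A solution of the linearized inclusion becomes a point of \<open>gph S\<close> after
  replacing \<open>k\<close> by a nearby \<open>k'\<close>. The factor collects
  \<open>norm (k', h) \<le> 2 * (norm h + norm k)\<close> and the loss
  \<open>norm \<omega> * norm (k' - k)\<close>; the radius \<open>\<rho>\<close> does not depend on
  the point or the normal.\<close>

lemma eps_normal_gph_linearized:
  assumes "0 < \<epsilon>" "\<epsilon> \<le> 1"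
  obtains \<rho> where "0 < \<rho>"
    "\<And>w x \<omega> \<xi>. \<lbrakk>norm (x - xb) + norm (w - wb) < \<rho>; (\<omega>, \<xi>) \<in> eps_normal_cone \<epsilon> (w, x) (gph S)\<rbrakk> \<Longrightarrow>
      \<exists>\<sigma>>0. \<forall>h k. norm h + norm k < \<sigma> \<and> (x + h, - f (x, w) - (A h + B k)) \<in> \<Gamma> \<longrightarrow>
        \<omega> \<bullet> k + \<xi> \<bullet> h \<le> \<epsilon> * (2 + norm \<omega>) * (norm h + norm k)"
proof -
  obtain \<rho> where \<rho>: "0 < \<rho>"
    "\<And>x w h k. \<lbrakk>norm (x - xb) + norm (w - wb) < \<rho>; norm h + norm k < \<rho>\<rbrakk> \<Longrightarrow>
       \<exists>k'. norm (k' - k) \<le> \<epsilon> * (norm h + norm k) \<and> f (x + h, w + k') = f (x, w) + A h + B k"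
    using parameter_correction[OF assms(1)] by metis
  show thesis
  proof (rule that[OF \<rho>(1)])
    fix w x \<omega> \<xi>
    assume near: "norm (x - xb) + norm (w - wb) < \<rho>"
      and "(\<omega>, \<xi>) \<in> eps_normal_cone \<epsilon> (w, x) (gph S)"
    then obtain \<delta> where \<delta>: "0 < \<delta>" "\<And>y'. \<lbrakk>y' \<in> gph S; norm (y' - (w, x)) < \<delta>\<rbrakk> \<Longrightarrow>
        (\<omega>, \<xi>) \<bullet> (y' - (w, x)) \<le> \<epsilon> * norm (y' - (w, x))"
      by (elim eps_normal_coneE) blast
    have "\<omega> \<bullet> k + \<xi> \<bullet> h \<le> \<epsilon> * (2 + norm \<omega>) * (norm h + norm k)"
      if hk: "norm h + norm k < min \<rho> (\<delta> / 2)" and \<Gamma>: "(x + h, - f (x, w) - (A h + B k)) \<in> \<Gamma>" for h k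
    proof -
      define m where "m = norm h + norm k"
      have "0 \<le> m" by (simp add: m_def)
      obtain k' where k': "norm (k' - k) \<le> \<epsilon> * m" "f (x + h, w + k') = f (x, w) + A h + B k"
        using \<rho>(2)[OF near, of h k] hk by (auto simp: m_def)
      have "\<epsilon> * m \<le> 1 * m"
        using assms(2) \<open>0 \<le> m\<close> by (rule mult_right_mono)
      then have "norm (k', h) \<le> 2 * m"
        using norm_Pair_le[of k' h] norm_triangle_ineq[of "k' - k" k] k'(1) by (simp add: m_def)
      moreover have "(w + k', x + h) \<in> gph S"
        using \<Gamma> by (simp add: gph_iff k'(2) diff_diff_eq)
      ultimately have "\<omega> \<bullet> k' + \<xi> \<bullet> h \<le> \<epsilon> * norm (k', h)"
        using \<delta>(2)[of "(w + k', x + h)"] hk by (simp add: m_def)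
      also have "\<dots> \<le> \<epsilon> * (2 * m)"
        using \<open>norm (k', h) \<le> 2 * m\<close> assms(1) by (intro mult_left_mono) auto
      finally have "\<omega> \<bullet> k' + \<xi> \<bullet> h \<le> \<epsilon> * (2 * m)" .
      moreover have "\<omega> \<bullet> k - \<omega> \<bullet> k' \<le> norm \<omega> * (\<epsilon> * m)"
      proof -
        have "\<omega> \<bullet> (k - k') \<le> norm \<omega> * norm (k - k')"
          by (rule norm_cauchy_schwarz)
        also have "\<dots> \<le> norm \<omega> * (\<epsilon> * m)"
          using k'(1) by (intro mult_left_mono) (auto simp: norm_minus_commute)
        finally show ?thesis by (simp add: inner_diff_right)
      qed
      ultimately show ?thesis
        by (simp add: m_def[symmetric] algebra_simps)
    qed
    then show "\<exists>\<sigma>>0. \<forall>h k. norm h + norm k < \<sigma> \<and> (x + h, - f (x, w) - (A h + B k)) \<in> \<Gamma> \<longrightarrow>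
        \<omega> \<bullet> k + \<xi> \<bullet> h \<le> \<epsilon> * (2 + norm \<omega>) * (norm h + norm k)"
      using \<rho>(1) \<delta>(1) by (intro exI[of _ "min \<rho> (\<delta> / 2)"]) auto
  qed
qed

text \<open>The factor \<open>2 + norm \<omega>\<close> is absorbed by shrinking \<epsilon>, which
  is possible because \<open>\<omega>\<close> is a fixed vector and not a term of a
  sequence.\<close>

lemma limiting_normal_gph_linearized:
  assumes "(\<omega>, \<xi>) \<in> limiting_normal_cone (wb, xb) (gph S)" "0 < \<epsilon>" "0 < \<tau>"
  obtains w x \<sigma> where "(w, x) \<in> gph S" "dist (w, x) (wb, xb) < \<tau>" "0 < \<sigma>"
    "\<And>h k. \<lbrakk>norm h + norm k < \<sigma>; (x + h, - f (x, w) - (A h + B k)) \<in> \<Gamma>\<rbrakk> \<Longrightarrow>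
        \<omega> \<bullet> k + \<xi> \<bullet> h \<le> \<epsilon> * (norm h + norm k)"
proof -
  define \<epsilon>' where "\<epsilon>' = min 1 (\<epsilon> / (2 + norm \<omega>))"
  have *: "0 < 2 + norm \<omega>"
    by (simp add: add_pos_nonneg)
  then have \<epsilon>': "0 < \<epsilon>'" "\<epsilon>' \<le> 1" "\<epsilon>' * (2 + norm \<omega>) \<le> \<epsilon>"
    using assms(2) by (auto simp: \<epsilon>'_def min_mult_distrib_right)
  obtain \<rho> where \<rho>: "0 < \<rho>"
    "\<And>w x \<omega> \<xi>. \<lbrakk>norm (x - xb) + norm (w - wb) < \<rho>; (\<omega>, \<xi>) \<in> eps_normal_cone \<epsilon>' (w, x) (gph S)\<rbrakk> \<Longrightarrow>
      \<exists>\<sigma>>0. \<forall>h k. norm h + norm k < \<sigma> \<and> (x + h, - f (x, w) - (A h + B k)) \<in> \<Gamma> \<longrightarrow>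
        \<omega> \<bullet> k + \<xi> \<bullet> h \<le> \<epsilon>' * (2 + norm \<omega>) * (norm h + norm k)"
    using eps_normal_gph_linearized[OF \<epsilon>'(1,2)] by metis
  define \<eta> where "\<eta> = min \<epsilon>' (min \<tau> (\<rho> / 2))"
  have "0 < \<eta>"
    using \<epsilon>'(1) \<rho>(1) assms(3) by (simp add: \<eta>_def)
  from limiting_normal_cone_imp_eps[OF assms(1) this]
  obtain w x where wx: "(w, x) \<in> gph S" "dist (w, x) (wb, xb) < \<eta>"
    "(\<omega>, \<xi>) \<in> eps_normal_cone \<eta> (w, x) (gph S)"
    by (auto simp del: dist_Pair_Pair)
  have "norm (w - wb, x - xb) < \<rho> / 2"
    using wx(2) by (simp add: \<eta>_def dist_norm[of "(w, x)"] del: dist_Pair_Pair)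
  then have "norm (x - xb) + norm (w - wb) < \<rho>"
    using norm_fst_le[of "w - wb" "x - xb"] norm_snd_le[of "x - xb" "w - wb"] by linarith
  moreover have "(\<omega>, \<xi>) \<in> eps_normal_cone \<epsilon>' (w, x) (gph S)"
    using wx(3) by (rule eps_normal_cone_perturb) (simp add: \<eta>_def)
  ultimately obtain \<sigma> where \<sigma>: "0 < \<sigma>"
    "\<And>h k. \<lbrakk>norm h + norm k < \<sigma>; (x + h, - f (x, w) - (A h + B k)) \<in> \<Gamma>\<rbrakk> \<Longrightarrow>
      \<omega> \<bullet> k + \<xi> \<bullet> h \<le> \<epsilon>' * (2 + norm \<omega>) * (norm h + norm k)"
    using \<rho>(2) by meson
  show thesis
  proof (rule that[OF wx(1) _ \<sigma>(1)])
    show "dist (w, x) (wb, xb) < \<tau>"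
      using wx(2) by (simp add: \<eta>_def)
    fix h k assume "norm h + norm k < \<sigma>" "(x + h, - f (x, w) - (A h + B k)) \<in> \<Gamma>"
    then have "\<omega> \<bullet> k + \<xi> \<bullet> h \<le> \<epsilon>' * (2 + norm \<omega>) * (norm h + norm k)"
      by (rule \<sigma>(2))
    also have "\<dots> \<le> \<epsilon> * (norm h + norm k)"
      by (intro mult_right_mono \<epsilon>'(3)) simp
    finally show "\<omega> \<bullet> k + \<xi> \<bullet> h \<le> \<epsilon> * (norm h + norm k)" .
  qed
qed

lemma isCont_f: "isCont f (xb, wb)"
  using has_strict_derivative_imp_has_derivative[OF strict] by (rule has_derivative_continuous)

text \<open>A parameter move in the kernel of \<open>B\<close> leaves the linearized value
  unchanged, so \<open>\<omega>\<close> vanishes on that kernel and lies in the range of the adjoint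
  of \<open>B\<close>. The remaining inequality, tested on moves within \<open>\<Gamma>\<close>,
  says that \<open>(y, q)\<close> is an \<epsilon>-normal there.\<close>

lemma limiting_normal_gph_imp:
  assumes N: "(\<omega>, \<xi>) \<in> limiting_normal_cone (wb, xb) (gph S)"
  obtains y q where "(y, q) \<in> limiting_normal_cone (xb, vb) \<Gamma>"
    "\<omega> = - adjoint B q" "\<xi> = y - adjoint A q"
proof -
  obtain R L where R: "linear R" "\<And>v. B (R v) = v"
    and L: "1 \<le> L" "\<And>h v. norm h + norm (R (v + A h)) \<le> L * norm (h, v)"
    using bounded_right_inverse by metis
  have ker: "\<omega> \<bullet> k \<le> 0" if "B k = 0" for k
  proof (rule field_le_epsilon)
    fix e :: real assume "0 < e"
    have *: "0 < norm k + 1"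
      by (simp add: add_nonneg_pos)
    then obtain w x \<sigma> where wx: "(w, x) \<in> gph S" "0 < \<sigma>"
      "\<And>h k'. \<lbrakk>norm h + norm k' < \<sigma>; (x + h, - f (x, w) - (A h + B k')) \<in> \<Gamma>\<rbrakk> \<Longrightarrow>
        \<omega> \<bullet> k' + \<xi> \<bullet> h \<le> e / (norm k + 1) * (norm h + norm k')"
      using limiting_normal_gph_linearized[OF N, of "e / (norm k + 1)" 1] \<open>0 < e\<close> by (metis divide_pos_pos zero_less_one)
    define t where "t = \<sigma> / (norm k + 1)"
    have "0 < t" "t * norm k < \<sigma>"
      using wx(2) * by (simp_all add: t_def pos_divide_less_eq)
    then have "\<omega> \<bullet> (t *\<^sub>R k) \<le> e / (norm k + 1) * (t * norm k)"
      using wx(3)[of 0 "t *\<^sub>R k"] wx(1) \<open>B k = 0\<close>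
      by (simp add: gph_iff linear_scale[OF linB] linear_0[OF linA])
    then have "t * (\<omega> \<bullet> k) \<le> t * (e / (norm k + 1) * norm k)"
      by (simp add: mult_ac)
    then have "\<omega> \<bullet> k \<le> e / (norm k + 1) * norm k"
      using \<open>0 < t\<close> by (rule mult_left_le_imp_le)
    also have "\<dots> \<le> e / (norm k + 1) * (norm k + 1)"
      using \<open>0 < e\<close> * by (intro mult_left_mono) auto
    also have "\<dots> = e"
      using * by simp
    finally show "\<omega> \<bullet> k \<le> 0 + e" by simp
  qed
  \<comment> \<open>Forced by \<open>\<omega> = - adjoint B q\<close>: applying the adjoint of
    \<open>R\<close> to both sides gives \<open>- q\<close>, because \<open>B\<close> undoes
    \<open>R\<close>.\<close>
  define q where "q = - adjoint R \<omega>"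
  define y where "y = \<xi> + adjoint A q"
  have "\<omega> = - adjoint B q"
  proof -
    have "\<omega> \<bullet> k = (- adjoint B q) \<bullet> k" for k
    proof -
      have "B (k - R (B k)) = 0" "B (R (B k) - k) = 0"
        by (simp_all add: linear_diff[OF linB] R(2))
      then have "\<omega> \<bullet> k = \<omega> \<bullet> R (B k)"
        using ker[of "k - R (B k)"] ker[of "R (B k) - k"] by (simp add: inner_diff_right)
      also have "\<dots> = (- adjoint B q) \<bullet> k"
        unfolding q_def using linear_neg[OF adjoint_linear[OF linB]]
        by (simp add: adjoint_works[OF R(1)] adjoint_works[OF linB] inner_commute)
      finally show ?thesis .
    qed
    then show ?thesis
      using vector_eq_rdot by blast
  qed
  moreover have "\<xi> = y - adjoint A q"
    by (simp add: y_def)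
  moreover have "(y, q) \<in> limiting_normal_cone (xb, vb) \<Gamma>"
  proof (subst limiting_normal_cone_iff_eps[where R = 1])
    show "closed (\<Gamma> \<inter> cball (xb, vb) 1)"
      using closed_\<Gamma> by blast
    show "\<forall>\<epsilon>>0. \<exists>z'\<in>\<Gamma>. dist z' (xb, vb) < \<epsilon> \<and> (y, q) \<in> eps_normal_cone \<epsilon> z' \<Gamma>"
    proof (intro allI impI)
      fix \<epsilon> :: real assume "0 < \<epsilon>"
      obtain \<tau> where \<tau>: "0 < \<tau>" "\<And>p. dist p (xb, wb) < \<tau> \<Longrightarrow> dist (f p) (f (xb, wb)) < \<epsilon> / 2"
        using isCont_f \<open>0 < \<epsilon>\<close> unfolding continuous_at_eps_delta by (metis half_gt_zero)
      have "0 < \<epsilon> / L" "0 < min \<tau> (\<epsilon> / 2)"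
        using \<open>0 < \<epsilon>\<close> \<tau>(1) L(1) by simp_all
      then obtain w x \<sigma> where wx: "(w, x) \<in> gph S" "dist (w, x) (wb, xb) < min \<tau> (\<epsilon> / 2)" "0 < \<sigma>"
        "\<And>h k. \<lbrakk>norm h + norm k < \<sigma>; (x + h, - f (x, w) - (A h + B k)) \<in> \<Gamma>\<rbrakk> \<Longrightarrow>
            \<omega> \<bullet> k + \<xi> \<bullet> h \<le> \<epsilon> / L * (norm h + norm k)"
        using limiting_normal_gph_linearized[OF N] by metis
      define v where "v = - f (x, w)"
      have "(x, v) \<in> \<Gamma>"
        using wx(1) by (simp add: gph_iff v_def)
      moreover have "dist (x, v) (xb, vb) < \<epsilon>"
      proof -
        have "dist (x, w) (xb, wb) = dist (w, x) (wb, xb)"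
          by (simp add: dist_Pair_Pair add.commute)
        then have "dist (f (x, w)) (f (xb, wb)) < \<epsilon> / 2"
          using \<tau>(2) wx(2) by simp
        then have "norm (v - vb) < \<epsilon> / 2"
          by (simp add: v_def vb dist_norm norm_minus_commute)
        moreover have "norm (x - xb) < \<epsilon> / 2"
          using wx(2) norm_snd_le[of "x - xb" "w - wb"] by (simp add: dist_norm[of "(w, x)"] del: dist_Pair_Pair)
        ultimately show ?thesis
          using norm_Pair_le[of "x - xb" "v - vb"] by (simp add: dist_norm[of "(x, v)"] del: dist_Pair_Pair)
      qed
      moreover have "(y, q) \<in> eps_normal_cone \<epsilon> (x, v) \<Gamma>"
      proof (rule eps_normal_coneI)
        show "0 < \<sigma> / L"
          using wx(3) L(1) by simp
        fix z assume z: "z \<in> \<Gamma>" "norm (z - (x, v)) < \<sigma> / L"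
        obtain h c where zeq: "z - (x, v) = (h, c)"
          by (cases "z - (x, v)")
        \<comment> \<open>This parameter move realizes the given displacement \<open>(h, c)\<close>
          of \<open>\<Gamma>\<close> exactly in the linearized inclusion.\<close>
        define k where "k = - R (c + A h)"
        have le: "norm h + norm k \<le> L * norm (h, c)"
          using L(2)[of h c] by (simp add: k_def)
        also have "\<dots> < \<sigma>"
          using z(2) L(1) unfolding zeq by (simp add: pos_less_divide_eq mult.commute)
        finally have "norm h + norm k < \<sigma>" .
        moreover have "(x + h, - f (x, w) - (A h + B k)) = z"
          using zeq by (cases z) (auto simp: k_def linear_neg[OF linB] R(2) v_def algebra_simps)
        ultimately have "\<omega> \<bullet> k + \<xi> \<bullet> h \<le> \<epsilon> / L * (norm h + norm k)"
          using wx(4) z(1) by metis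
        also have "\<dots> \<le> \<epsilon> / L * (L * norm (h, c))"
          using \<open>0 < \<epsilon>\<close> L(1) by (intro mult_left_mono le) auto
        also have "\<dots> = \<epsilon> * norm (h, c)"
          using L(1) by simp
        also have "\<omega> \<bullet> k + \<xi> \<bullet> h = y \<bullet> h + q \<bullet> c"
        proof -
          have "\<omega> \<bullet> k = q \<bullet> (c + A h)"
            using adjoint_works[OF R(1), of "c + A h" \<omega>] by (simp add: k_def q_def inner_commute)
          then show ?thesis
            using adjoint_works[OF linA, of h q]
            by (simp add: y_def inner_add_left inner_add_right inner_commute)
        qed
        finally show "(y, q) \<bullet> (z - (x, v)) \<le> \<epsilon> * norm (z - (x, v))"
          by (simp add: zeq)
      qed
      ultimately show "\<exists>z'\<in>\<Gamma>. dist z' (xb, vb) < \<epsilon> \<and> (y, q) \<in> eps_normal_cone \<epsilon> z' \<Gamma>"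
        by blast
    qed
  qed simp
  ultimately show thesis
    using that by blast
qed

text \<open>A point of \<open>\<Gamma>\<close> near \<open>(xb, vb)\<close> is lifted to
  \<open>gph S\<close> by solving for the parameter from the base point. Points of
  \<open>gph S\<close> near the lifted one map into \<open>\<Gamma>\<close> with a displacement that
  is linear up to \<open>\<epsilon>1\<close>, so the normal inequality carries over.\<close>

lemma limiting_normal_gphI:
  assumes N: "(y, q) \<in> limiting_normal_cone (xb, vb) \<Gamma>"
  shows "(- adjoint B q, y - adjoint A q) \<in> limiting_normal_cone (wb, xb) (gph S)"
proof -
  obtain r where r: "0 < r" "closed (gph S \<inter> cball (wb, xb) r)"
    using locally_closed_gph by blast
  obtain R L where R: "linear R" "\<And>v. B (R v) = v"
    and L: "1 \<le> L" "\<And>h v. norm h + norm (R (v + A h)) \<le> L * norm (h, v)"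
    using bounded_right_inverse by metis
  obtain \<alpha> \<beta> where \<alpha>: "0 < \<alpha>" "\<And>h. norm (A h) \<le> \<alpha> * norm h"
    and \<beta>: "0 < \<beta>" "\<And>k. norm (B k) \<le> \<beta> * norm k"
    using linear_bounds by metis
  define M where "M = 2 + \<alpha> + \<beta>"
  have "0 < M"
    using \<alpha>(1) \<beta>(1) by (simp add: M_def)
  obtain \<rho>1 where \<rho>1: "0 < \<rho>1"
    "\<And>x w h k. \<lbrakk>norm (x - xb) + norm (w - wb) < \<rho>1; norm h + norm k < \<rho>1\<rbrakk> \<Longrightarrow>
       \<exists>k'. norm (k' - k) \<le> 1 * (norm h + norm k) \<and> f (x + h, w + k') = f (x, w) + A h + B k"
    using parameter_correction[of 1] by (metis zero_less_one)
  have "\<exists>z'\<in>gph S. dist z' (wb, xb) < \<epsilon> \<and>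
      (- adjoint B q, y - adjoint A q) \<in> eps_normal_cone \<epsilon> z' (gph S)" if "0 < \<epsilon>" for \<epsilon>
  proof -
    \<comment> \<open>\<open>M\<close> bounds the displacement in \<open>\<Gamma>\<close>, and
      \<open>norm q\<close> weighs the linearization error. The 2 is the price of passing from the
      norm of a pair to the sum of the norms.\<close>
    define \<epsilon>1 where "\<epsilon>1 = min 1 (\<epsilon> / 2 / (M + norm q))"
    have *: "0 < M + norm q"
      using \<open>0 < M\<close> by (simp add: add_pos_nonneg)
    have "\<epsilon>1 \<le> \<epsilon> / 2 / (M + norm q)"
      unfolding \<epsilon>1_def by (rule min.cobounded2)
    then have "\<epsilon>1 * (M + norm q) \<le> \<epsilon> / 2"
      using pos_le_divide_eq[OF *] by blast
    moreover have "0 < \<epsilon>1" "\<epsilon>1 \<le> 1"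
      using * \<open>0 < \<epsilon>\<close> by (simp_all add: \<epsilon>1_def)
    ultimately have \<epsilon>1: "0 < \<epsilon>1" "\<epsilon>1 \<le> 1" "\<epsilon>1 * (M + norm q) * 2 \<le> \<epsilon>"
      by simp_all
    obtain \<rho> where \<rho>: "0 < \<rho>"
      "\<And>x w x' w'. \<lbrakk>norm (x - xb) + norm (w - wb) < \<rho>; norm (x' - xb) + norm (w' - wb) < \<rho>\<rbrakk> \<Longrightarrow>
       norm (f (x, w) - f (x', w') - (A (x - x') + B (w - w'))) \<le> \<epsilon>1 * (norm (x - x') + norm (w - w'))"
      using strict_bound[OF \<epsilon>1(1)] by metis
    \<comment> \<open>Lifting costs a factor \<open>2 * L\<close>: the lifted point has to stay
      within \<epsilon> and \<open>\<rho>\<close>, and the move leading to it within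
      \<open>\<rho>1\<close>.\<close>
    define \<tau> where "\<tau> = min \<epsilon>1 (min \<rho>1 (min \<epsilon> \<rho>) / (2 * L))"
    have \<tau>: "0 < \<tau>" "\<tau> \<le> \<epsilon>1" "2 * (L * \<tau>) \<le> min \<rho>1 (min \<epsilon> \<rho>)"
    proof -
      show "0 < \<tau>"
        using \<epsilon>1(1) \<rho>(1) \<rho>1(1) \<open>0 < \<epsilon>\<close> L(1) by (simp add: \<tau>_def)
      show "\<tau> \<le> \<epsilon>1"
        by (simp add: \<tau>_def)
      have "2 * (L * \<tau>) \<le> 2 * (L * (min \<rho>1 (min \<epsilon> \<rho>) / (2 * L)))"
        using L(1) by (intro mult_left_mono) (auto simp: \<tau>_def)
      also have "\<dots> = min \<rho>1 (min \<epsilon> \<rho>)"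
        using L(1) by simp
      finally show "2 * (L * \<tau>) \<le> min \<rho>1 (min \<epsilon> \<rho>)" .
    qed
    from limiting_normal_cone_imp_eps[OF N \<tau>(1)] obtain x v where
      xv: "(x, v) \<in> \<Gamma>" "dist (x, v) (xb, vb) < \<tau>" "(y, q) \<in> eps_normal_cone \<tau> (x, v) \<Gamma>"
      by (auto simp del: dist_Pair_Pair)
    obtain \<delta> where \<delta>: "0 < \<delta>" "\<And>z. \<lbrakk>z \<in> \<Gamma>; norm (z - (x, v)) < \<delta>\<rbrakk> \<Longrightarrow>
        (y, q) \<bullet> (z - (x, v)) \<le> \<tau> * norm (z - (x, v))"
      using xv(3) by (rule eps_normal_coneE) blast
    \<comment> \<open>The linearized solution of \<open>- f (x, w) = v\<close> around the base
      point; \<open>k'\<close> corrects it to an exact one.\<close>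
    define k where "k = - R (v - vb + A (x - xb))"
    have small: "norm (x - xb) + norm k < L * \<tau>"
    proof -
      have "norm (x - xb) + norm k \<le> L * norm (x - xb, v - vb)"
        using L(2)[of "x - xb" "v - vb"] by (simp add: k_def)
      also have "\<dots> < L * \<tau>"
        using xv(2) L(1) by (simp add: dist_norm[of "(x, v)"] del: dist_Pair_Pair)
      finally show ?thesis .
    qed
    have "0 < L * \<tau>"
      using \<tau>(1) L(1) by simp
    then have "norm (x - xb) + norm k < \<rho>1"
      using small \<tau>(3) by simp
    then obtain k' where k': "norm (k' - k) \<le> norm (x - xb) + norm k"
      "f (xb + (x - xb), wb + k') = f (xb, wb) + A (x - xb) + B k"
      using \<rho>1(2)[of xb wb "x - xb" k] \<rho>1(1) by auto
    define w where "w = wb + k'"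
    have v: "v = - f (x, w)"
      using k'(2) by (simp add: w_def k_def linear_neg[OF linB] R(2) vb algebra_simps)
    then have "(w, x) \<in> gph S"
      using xv(1) by (simp add: gph_iff)
    have near: "norm (x - xb) + norm (w - wb) < min \<epsilon> \<rho>"
    proof -
      have "norm k' \<le> norm (x - xb) + norm k + norm k"
        using norm_triangle_ineq[of "k' - k" k] k'(1) by simp
      then have "norm (x - xb) + norm (w - wb) \<le> 2 * (norm (x - xb) + norm k)"
        by (simp add: w_def)
      then show ?thesis
        using small \<tau>(3) by simp
    qed
    have "dist (w, x) (wb, xb) < \<epsilon>"
      using near norm_Pair_le[of "w - wb" "x - xb"] by (simp add: dist_norm[of "(w, x)"] del: dist_Pair_Pair)
    moreover have "(- adjoint B q, y - adjoint A q) \<in> eps_normal_cone \<epsilon> (w, x) (gph S)"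
    proof (rule eps_normal_coneI)
      define \<rho>' where "\<rho>' = \<rho> - (norm (x - xb) + norm (w - wb))"
      show "0 < min (\<delta> / (2 * M)) (\<rho>' / 2)"
        using \<delta>(1) \<open>0 < M\<close> near by (simp add: \<rho>'_def)
      fix z assume z: "z \<in> gph S" "norm (z - (w, x)) < min (\<delta> / (2 * M)) (\<rho>' / 2)"
      obtain w' x' where zeq: "z = (w', x')"
        by (cases z)
      define h where "h = x' - x"
      define k where "k = w' - w"
      define m where "m = norm h + norm k"
      \<comment> \<open>The actual displacement of the second component in \<open>\<Gamma>\<close>,
        equal to \<open>- (A h + B k)\<close> up to \<open>\<epsilon>1 * m\<close>.\<close>
      define c where "c = f (x, w) - f (x', w')"
      have m: "0 \<le> m" "m \<le> 2 * norm (z - (w, x))"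
        using norm_fst_le[of k h] norm_snd_le[of h k] by (simp_all add: m_def zeq h_def k_def)
      have "norm (x' - xb) + norm (w' - wb) \<le> norm (x - xb) + norm (w - wb) + m"
        using norm_triangle_ineq[of "x - xb" h] norm_triangle_ineq[of "w - wb" k]
        by (simp add: h_def k_def m_def)
      also have "\<dots> < \<rho>"
        using m(2) z(2) by (simp add: \<rho>'_def)
      finally have "norm (f (x', w') - f (x, w) - (A h + B k)) \<le> \<epsilon>1 * m"
        unfolding h_def k_def m_def using near by (intro \<rho>(2)) auto
      then have err: "norm (c + (A h + B k)) \<le> \<epsilon>1 * m"
        by (simp add: c_def norm_minus_commute algebra_simps)
      have "norm c \<le> (1 + \<alpha> + \<beta>) * m"
      proof -
        have "norm c \<le> norm (c + (A h + B k)) + (norm (A h) + norm (B k))"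
          using norm_triangle_ineq4[of "c + (A h + B k)" "A h + B k"] norm_triangle_ineq[of "A h" "B k"]
          by simp
        also have "\<dots> \<le> 1 * m + (\<alpha> * m + \<beta> * m)"
        proof (intro add_mono)
          show "norm (c + (A h + B k)) \<le> 1 * m"
            using err mult_right_mono[OF \<epsilon>1(2) m(1)] by linarith
          show "norm (A h) \<le> \<alpha> * m"
            by (rule order_trans[OF \<alpha>(2) mult_left_mono]) (use \<alpha>(1) in \<open>simp_all add: m_def\<close>)
          show "norm (B k) \<le> \<beta> * m"
            by (rule order_trans[OF \<beta>(2) mult_left_mono]) (use \<beta>(1) in \<open>simp_all add: m_def\<close>)
        qed
        finally show ?thesis
          by (simp add: algebra_simps)
      qed
      moreover have "norm h \<le> m"
        by (simp add: m_def)
      ultimately have hc: "norm (h, c) \<le> M * m"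
        using norm_Pair_le[of h c] by (simp add: M_def algebra_simps)
      have "M * m < \<delta>"
      proof -
        have "M * m \<le> M * (2 * norm (z - (w, x)))"
          using m(2) \<open>0 < M\<close> by simp
        also have "\<dots> < \<delta>"
          using z(2) \<open>0 < M\<close> by (simp add: pos_less_divide_eq mult_ac)
        finally show ?thesis .
      qed
      moreover have "(x', - f (x', w')) \<in> \<Gamma>" "(x', - f (x', w')) - (x, v) = (h, c)"
        using z(1) by (simp_all add: zeq gph_iff h_def c_def v)
      ultimately have "(y, q) \<bullet> (h, c) \<le> \<tau> * norm (h, c)"
        using \<delta>(2)[of "(x', - f (x', w'))"] hc by simp
      also have "\<dots> \<le> \<epsilon>1 * (M * m)"
        using \<tau>(1,2) hc \<open>0 < M\<close> m(1) by (intro mult_mono) auto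
      finally have 1: "y \<bullet> h + q \<bullet> c \<le> \<epsilon>1 * (M * m)"
        by simp
      have 2: "- (q \<bullet> (c + (A h + B k))) \<le> norm q * (\<epsilon>1 * m)"
        using Cauchy_Schwarz_ineq2[of q "c + (A h + B k)"] mult_left_mono[OF err, of "norm q"] by simp
      have "(- adjoint B q, y - adjoint A q) \<bullet> (z - (w, x)) = - (q \<bullet> B k) + (y \<bullet> h - q \<bullet> A h)"
        using adjoint_works[OF linB, of k q] adjoint_works[OF linA, of h q]
        by (simp add: zeq h_def[symmetric] k_def[symmetric] inner_diff_left inner_commute[of _ k]
            inner_commute[of _ h] inner_diff_right inner_commute[of "A h"] inner_commute[of "B k"])
      also have "\<dots> = (y \<bullet> h + q \<bullet> c) - q \<bullet> (c + (A h + B k))"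
        by (simp add: inner_add_right)
      also have "\<dots> \<le> (\<epsilon>1 * (M + norm q)) * m"
        using 1 2 by (simp add: algebra_simps)
      also have "\<dots> \<le> (\<epsilon>1 * (M + norm q)) * (2 * norm (z - (w, x)))"
        using m(2) \<epsilon>1(1) * by (intro mult_left_mono) auto
      also have "\<dots> \<le> \<epsilon> * norm (z - (w, x))"
        using mult_right_mono[OF \<epsilon>1(3) norm_ge_zero[of "z - (w, x)"]] by (simp only: mult_ac)
      finally show "(- adjoint B q, y - adjoint A q) \<bullet> (z - (w, x)) \<le> \<epsilon> * norm (z - (w, x))" .
    qed
    ultimately show ?thesis
      using \<open>(w, x) \<in> gph S\<close> by blast
  qed
  then show ?thesis
    using limiting_normal_cone_iff_eps[OF r(2,1)] by blast
qed

end

section \<open>The Lipschitz criterion and the exact bound in terms of normals to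
  \<open>\<Gamma>\<close>\<close>

context parametric_inclusion
begin

lemma lip_modulus_imp_bound:
  assumes "lip_modulus S wb xb \<kappa>" "(y, q) \<in> limiting_normal_cone (xb, vb) \<Gamma>"
  shows "norm (adjoint B q) \<le> \<kappa> * norm (y - adjoint A q)"
  using lip_modulus_imp_normal_bound[OF assms(1) limiting_normal_gphI[OF assms(2)]] by simp

lemma bound_imp_lip_modulus:
  assumes bound: "\<And>y q. (y, q) \<in> limiting_normal_cone (xb, vb) \<Gamma> \<Longrightarrow>
      norm (adjoint B q) \<le> \<kappa>0 * norm (y - adjoint A q)"
    and "0 \<le> \<kappa>0" "\<kappa>0 < \<kappa>"
  shows "lip_modulus S wb xb \<kappa>"
proof -
  obtain R where R: "0 < R" "closed (gph S \<inter> cball (wb, xb) R)"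
    by (rule locally_closed_gph)
  show ?thesis
  proof (rule normal_bound_imp_lip_modulus[OF R(2,1) _ assms(2,3)])
    fix \<omega> \<xi> assume "(\<omega>, \<xi>) \<in> limiting_normal_cone (wb, xb) (gph S)"
    then show "norm \<omega> \<le> \<kappa>0 * norm \<xi>"
      by (rule limiting_normal_gph_imp) (use bound in force)
  qed
qed

lemma adjoint_B_eq_0: "adjoint B u = 0 \<Longrightarrow> u = 0"
proof -
  assume *: "adjoint B u = 0"
  obtain k where "u = B k"
    using surjB by blast
  then have "u \<bullet> u = k \<bullet> adjoint B u"
    by (simp add: adjoint_works[OF linB])
  then show "u = 0"
    using * by simp
qed

lemma adjoint_A_neg: "adjoint A (- u) = - adjoint A u" and adjoint_B_neg: "adjoint B (- u) = - adjoint B u"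
  by (simp_all add: linear_neg[OF adjoint_linear] linA linB)

text \<open>Necessity: with \<open>y = - adjoint A u\<close> and \<open>q = - u\<close> the right
  side of the normal bound vanishes, and the adjoint of a surjection is injective. Sufficiency: the
  condition excludes zeros of \<open>g\<close> on normalized normals, and compactness turns this
  into a positive lower bound.\<close>

theorem lipschitz_like_iff:
  "lipschitz_like S wb xb \<longleftrightarrow>
    (\<forall>u. (- adjoint A u, - u) \<in> limiting_normal_cone (xb, vb) \<Gamma> \<longrightarrow> u = 0)" (is "_ \<longleftrightarrow> ?R")
proof
  assume "lipschitz_like S wb xb"
  then obtain \<kappa> where "lip_modulus S wb xb \<kappa>"
    unfolding lipschitz_like_def by blast
  show ?R
  proof (intro allI impI)
    fix u assume "(- adjoint A u, - u) \<in> limiting_normal_cone (xb, vb) \<Gamma>"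
    from lip_modulus_imp_bound[OF \<open>lip_modulus S wb xb \<kappa>\<close> this] show "u = 0"
      by (intro adjoint_B_eq_0) (simp add: adjoint_A_neg adjoint_B_neg)
  qed
next
  assume R: ?R
  define N where "N = limiting_normal_cone (xb, vb) \<Gamma>"
  define g where "g z = norm (fst z - adjoint A (snd z))" for z :: "'a \<times> 'a"
  \<comment> \<open>\<open>norm (snd z) = 1\<close> leaves \<open>fst z\<close> unbounded. The cut
    \<open>g z \<le> 1\<close> restores boundedness and drops only normals with
    \<open>g z > 1\<close>, which is why the final constant is \<open>min 1 m\<close>.\<close>
  define X where "X = N \<inter> {z. norm (snd z) = 1} \<inter> {z. g z \<le> 1}"
  have cont: "continuous_on UNIV g"
  proof -
    have "continuous_on UNIV (\<lambda>z::'a \<times> 'a. adjoint A (snd z))"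
      by (rule linear_continuous_on_compose[OF _ adjoint_linear[OF linA]]) (intro continuous_intros)
    then show ?thesis
      unfolding g_def by (intro continuous_intros)
  qed
  obtain \<beta> where \<beta>: "0 < \<beta>" "\<And>q. norm (adjoint B q) \<le> norm q * \<beta>"
    using bounded_linear.pos_bounded linear_conv_bounded_linear adjoint_linear[OF linB] by blast
  obtain \<alpha> where \<alpha>: "0 < \<alpha>" "\<And>q. norm (adjoint A q) \<le> norm q * \<alpha>"
    using bounded_linear.pos_bounded linear_conv_bounded_linear adjoint_linear[OF linA] by blast
  have gpos: "0 < g z" if "z \<in> X" for z
  proof (rule ccontr)
    assume "\<not> 0 < g z"
    then have "fst z = - adjoint A (- snd z)"
      by (simp add: g_def adjoint_A_neg)
    then have "(- adjoint A (- snd z), - (- snd z)) \<in> N"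
      using that by (metis IntD1 X_def minus_minus prod.collapse)
    then have "- snd z = 0"
      using R N_def by blast
    then show False
      using that by (simp add: X_def)
  qed
  have "closed X"
    unfolding X_def N_def
    by (intro closed_Int closed_limiting_normal_cone closed_Collect_eq closed_Collect_le cont continuous_intros)
  moreover have "bounded X"
  proof (rule boundedI)
    fix z assume z: "z \<in> X"
    have "norm z \<le> norm (fst z) + norm (snd z)"
      by (metis norm_Pair_le prod.collapse)
    also have "norm (fst z) \<le> g z + norm (adjoint A (snd z))"
      unfolding g_def by (metis add_diff_cancel diff_add_cancel norm_triangle_ineq)
    also have "norm (adjoint A (snd z)) \<le> \<alpha>"
      using \<alpha>(2)[of "snd z"] z by (simp add: X_def)
    finally show "norm z \<le> 2 + \<alpha>"
      using z by (simp add: X_def)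
  qed
  ultimately have "compact X"
    by (simp add: compact_eq_bounded_closed)
  have "\<exists>m>0. \<forall>z\<in>X. m \<le> g z"
  proof (cases "X = {}")
    case True
    then show ?thesis by (intro exI[of _ 1]) simp
  next
    case False
    then obtain z where "z \<in> X" "\<forall>y\<in>X. g z \<le> g y"
      using continuous_attains_inf[OF \<open>compact X\<close> _ continuous_on_subset[OF cont]] by blast
    then show ?thesis
      using gpos by blast
  qed
  then obtain m where m: "0 < m" "\<And>z. z \<in> X \<Longrightarrow> m \<le> g z"
    by blast
  define m' where "m' = min 1 m"
  have "0 < m'"
    using m(1) by (simp add: m'_def)
  have lower: "m' * norm q \<le> norm (y - adjoint A q)" if "(y, q) \<in> N" for y q
  proof (cases "q = 0")
    case True
    then show ?thesis by simp
  next
    case False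
    define z where "z = (1 / norm q) *\<^sub>R (y, q)"
    have "z \<in> N"
      unfolding z_def N_def using that by (intro limiting_normal_cone_scale) (simp_all add: N_def)
    moreover have "norm (snd z) = 1"
      using False by (simp add: z_def)
    ultimately have "m' \<le> g z"
      using m(2)[of z] by (cases "g z \<le> 1") (auto simp: X_def m'_def)
    also have "g z = norm ((1 / norm q) *\<^sub>R (y - adjoint A q))"
      by (simp add: g_def z_def linear_scale[OF adjoint_linear[OF linA]] scaleR_right_diff_distrib)
    also have "\<dots> = norm (y - adjoint A q) / norm q"
      by simp
    finally show ?thesis
      using False by (simp add: pos_le_divide_eq)
  qed
  have "lip_modulus S wb xb (\<beta> / m' + 1)"
  proof (rule bound_imp_lip_modulus[of "\<beta> / m'"])
    fix y q assume "(y, q) \<in> limiting_normal_cone (xb, vb) \<Gamma>"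
    then have "norm q \<le> norm (y - adjoint A q) / m'"
      using lower[of y q] \<open>0 < m'\<close> by (simp add: N_def pos_le_divide_eq mult.commute)
    then have "norm q * \<beta> \<le> norm (y - adjoint A q) / m' * \<beta>"
      using \<beta>(1) by (intro mult_right_mono) auto
    then show "norm (adjoint B q) \<le> \<beta> / m' * norm (y - adjoint A q)"
      using \<beta>(2)[of q] by (simp add: mult.commute)
  qed (use \<beta>(1) \<open>0 < m'\<close> in auto)
  then show "lipschitz_like S wb xb"
    unfolding lipschitz_like_def by blast
qed

text \<open>By homogeneity, a finite supremum over \<open>norm (y + adjoint A u) \<le> 1\<close> is
  the least constant in the normal bound, and each larger number is a modulus. If \<open>S\<close>
  is not Lipschitz-like, the infimum over the empty set of moduli is already
  \<open>\<infinity>\<close>.\<close>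

theorem lip_bound_eq:
  assumes "(xb, vb) \<in> \<Gamma>"
  shows "lip_bound S wb xb = Sup {ereal (norm (adjoint B u)) | u y.
    (y, - u) \<in> limiting_normal_cone (xb, vb) \<Gamma> \<and> norm (y + adjoint A u) \<le> 1}" (is "_ = Sup ?Z")
proof (rule antisym)
  let ?N = "limiting_normal_cone (xb, vb) \<Gamma>"
  show "Sup ?Z \<le> lip_bound S wb xb"
    unfolding lip_bound_def
  proof (intro Sup_least Inf_greatest)
    fix s r assume "s \<in> ?Z" "r \<in> {ereal l |l. lip_modulus S wb xb l}"
    then obtain u y \<kappa> where *: "s = ereal (norm (adjoint B u))" "(y, - u) \<in> ?N"
      "norm (y + adjoint A u) \<le> 1" "r = ereal \<kappa>" "lip_modulus S wb xb \<kappa>"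
      by blast
    have "norm (adjoint B u) \<le> \<kappa> * norm (y + adjoint A u)"
      using lip_modulus_imp_bound[OF *(5,2)] by (simp add: adjoint_A_neg adjoint_B_neg)
    also have "\<dots> \<le> \<kappa> * 1"
      using *(3,5) by (intro mult_left_mono) (auto simp: lip_modulus_def)
    finally show "s \<le> r"
      using * by simp
  qed
  \<comment> \<open>The zero normal keeps the supremum from being \<open>-\<infinity>\<close>, so a
    finite supremum is a nonnegative real.\<close>
  have "(0, 0) \<in> ?N"
    using limiting_normal_cone_zero[OF assms] by (simp add: zero_prod_def)
  then have "ereal (norm (adjoint B 0)) \<in> ?Z"
    by (intro CollectI exI[of _ 0]) (simp add: linear_0[OF adjoint_linear[OF linA]])
  then have "0 \<le> Sup ?Z"
    by (rule Sup_upper2) (simp add: zero_ereal_def)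
  show "lip_bound S wb xb \<le> Sup ?Z"
  proof (cases "Sup ?Z = \<infinity>")
    case False
    then obtain \<kappa>0 where \<kappa>0: "Sup ?Z = ereal \<kappa>0" "0 \<le> \<kappa>0"
      using \<open>0 \<le> Sup ?Z\<close> by (cases "Sup ?Z") auto
    have bound: "norm (adjoint B q) \<le> \<kappa>0 * norm (y - adjoint A q)" if n: "(y, q) \<in> ?N" for y q
    proof -
      define g where "g = norm (y - adjoint A q)"
      have scaled: "t * norm (adjoint B q) \<le> \<kappa>0" if "0 \<le> t" "t * g \<le> 1" for t
      proof -
        have "(t *\<^sub>R y, - (- t *\<^sub>R q)) \<in> ?N"
          using limiting_normal_cone_scale[OF n that(1)] by simp
        moreover have "norm (t *\<^sub>R y + adjoint A (- t *\<^sub>R q)) = t * g"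
          using that(1) by (simp add: linear_scale[OF adjoint_linear[OF linA]] adjoint_A_neg g_def
              scaleR_right_diff_distrib[symmetric])
        ultimately have "ereal (norm (adjoint B (- t *\<^sub>R q))) \<in> ?Z"
          using that(2) by (intro CollectI exI[of _ "- t *\<^sub>R q"] exI[of _ "t *\<^sub>R y"]) auto
        then have "ereal (norm (adjoint B (- t *\<^sub>R q))) \<le> ereal \<kappa>0"
          unfolding \<kappa>0(1)[symmetric] by (rule Sup_upper)
        then show ?thesis
          using that(1) by (simp add: linear_scale[OF adjoint_linear[OF linB]] adjoint_B_neg)
      qed
      show ?thesis
      proof (cases "g = 0")
        case True
        \<comment> \<open>Here every multiple of \<open>(y, q)\<close> is admissible in the
          supremum, so its finiteness forces the value zero.\<close>
        have "norm (adjoint B q) = 0"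
        proof (rule ccontr)
          assume *: "norm (adjoint B q) \<noteq> 0"
          have "(\<kappa>0 + 1) / norm (adjoint B q) * norm (adjoint B q) \<le> \<kappa>0"
            using scaled[of "(\<kappa>0 + 1) / norm (adjoint B q)"] True \<kappa>0(2) by simp
          then show False
            using * by simp
        qed
        then show ?thesis
          using True by (simp add: g_def)
      next
        case False
        then have "0 < g"
          by (simp add: g_def)
        then have "1 / g * norm (adjoint B q) \<le> \<kappa>0"
          using scaled[of "1 / g"] by simp
        then show ?thesis
          using \<open>0 < g\<close> by (simp add: g_def pos_divide_le_eq)
      qed
    qed
    have "lip_bound S wb xb \<le> ereal \<kappa>0 + ereal e" if "0 < e" for e
    proof -
      have "lip_modulus S wb xb (\<kappa>0 + e)"
        using bound_imp_lip_modulus[OF bound \<kappa>0(2)] that by simp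
      then show ?thesis
        unfolding lip_bound_def by (intro Inf_lower) auto
    qed
    then show ?thesis
      unfolding \<kappa>0(1) by (rule ereal_le_epsilon2[rule_format])
  qed simp
qed

end

section \<open>Finitely generated cones\<close>

text \<open>The generators are closed under negation, hence so is their cone. Writing spans as cones
  makes \<F> a single finitely generated cone.\<close>

lemma span_eq_convex_cone_hull: "span X = convex_cone hull (X \<union> uminus ` X)"
proof
  let ?C = "convex_cone hull (X \<union> uminus ` X)"
  have neg: "- x \<in> ?C" if "x \<in> ?C" for x
  proof -
    have "uminus ` ?C = convex_cone hull (uminus ` (X \<union> uminus ` X))"
      by (rule convex_cone_hull_linear_image[symmetric]) (simp add: linear_uminus)
    also have "uminus ` (X \<union> uminus ` X) = X \<union> uminus ` X"
      by (auto simp: image_Un image_image)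
    finally show ?thesis
      using that by blast
  qed
  have "subspace ?C"
  proof (rule subspaceI)
    fix c :: real and x assume "x \<in> ?C"
    then show "c *\<^sub>R x \<in> ?C"
      using neg[of "\<bar>c\<bar> *\<^sub>R x"] convex_cone_hull_mul[of x _ "\<bar>c\<bar>"] by (cases "0 \<le> c") auto
  qed (auto intro: convex_cone_hull_contains_0 convex_cone_hull_add)
  moreover have "X \<subseteq> ?C"
    by (meson hull_subset le_supE)
  ultimately show "span X \<subseteq> ?C"
    by (simp add: span_minimal)
  show "?C \<subseteq> span X"
  proof (rule hull_minimal)
    show "X \<union> uminus ` X \<subseteq> span X"
      by (auto intro: span_base span_neg)
    show "convex_cone (span X)"
      unfolding convex_cone_iff by (auto intro: span_0 span_add span_scale)
  qed
qed

lemma convex_cone_hull_Un_plus: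
  "convex_cone hull (S \<union> T) = convex_cone hull S + convex_cone hull T"
  by (auto simp: convex_cone_hull_Un set_plus_def)

text \<open>Farkas' lemma: a finitely generated cone is closed, so a point outside is strictly
  separated from it.\<close>

lemma convex_cone_hull_iff_polar:
  fixes V :: "'a::euclidean_space set"
  assumes "finite V"
  shows "y \<in> convex_cone hull V \<longleftrightarrow> (\<forall>h. (\<forall>v\<in>V. v \<bullet> h \<le> 0) \<longrightarrow> y \<bullet> h \<le> 0)" (is "_ \<longleftrightarrow> ?R")
proof
  assume y: "y \<in> convex_cone hull V"
  show ?R
  proof (intro allI impI)
    fix h assume "\<forall>v\<in>V. v \<bullet> h \<le> 0"
    then have "convex_cone hull V \<subseteq> {x. h \<bullet> x \<le> 0}"
      by (intro hull_minimal convex_cone_halfspace_le) (auto simp: inner_commute)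
    then show "y \<bullet> h \<le> 0"
      using y by (auto simp: inner_commute)
  qed
next
  assume R: ?R
  show "y \<in> convex_cone hull V"
  proof (rule ccontr)
    assume "\<not> ?thesis"
    then obtain a b where ab: "a \<bullet> y < b" "\<And>x. x \<in> convex_cone hull V \<Longrightarrow> b < a \<bullet> x"
      using separating_hyperplane_closed_point[OF convex_convex_cone_hull closed_convex_cone_hull[OF assms]]
      by blast
    have "b < 0"
      using ab(2)[OF convex_cone_hull_contains_0] by simp
    have "v \<bullet> (- a) \<le> 0" if "v \<in> V" for v
    proof (rule ccontr)
      assume "\<not> ?thesis"
      then have neg: "a \<bullet> v < 0"
        by (simp add: inner_commute)
      \<comment> \<open>A generator on the wrong side would have this multiple exactly on the
        hyperplane \<open>a \<bullet> x = b\<close>, against strict separation.\<close>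
      have "(b / (a \<bullet> v)) *\<^sub>R v \<in> convex_cone hull V"
        using that neg \<open>b < 0\<close> by (intro convex_cone_hull_mul hull_inc) (auto simp: divide_nonpos_neg)
      from ab(2)[OF this] show False
        using neg by simp
    qed
    then have "y \<bullet> (- a) \<le> 0"
      using R by blast
    then show False
      using ab(1) \<open>b < 0\<close> by (simp add: inner_commute)
  qed
qed

lemma convex_cone_sum:
  assumes "convex_cone C" "\<And>i. i \<in> Q \<Longrightarrow> f i \<in> C"
  shows "sum f Q \<in> C"
  using assms(2)
  by (induction Q rule: infinite_finite_induct)
    (auto intro: convex_cone_contains_0[OF assms(1)] convex_cone_add[OF assms(1)])

text \<open>Coefficients belong to indices and not to vectors, since distinct indices may carry the
  same vector and the multipliers distinguish them.\<close>

lemma convex_hull_indexed_family: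
  assumes "finite Q"
  shows "convex hull {a i | i. i \<in> Q} =
    {\<Sum>i\<in>Q. c i *\<^sub>R a i | c. (\<forall>i\<in>Q. 0 \<le> c i) \<and> sum c Q = (1::real)}" (is "_ = ?R")
proof
  show "convex hull {a i | i. i \<in> Q} \<subseteq> ?R"
  proof (rule hull_minimal)
    show "{a i | i. i \<in> Q} \<subseteq> ?R"
    proof clarify
      fix i assume "i \<in> Q"
      then show "\<exists>c. a i = (\<Sum>i\<in>Q. c i *\<^sub>R a i) \<and> (\<forall>i\<in>Q. 0 \<le> c i) \<and> sum c Q = 1"
        using assms by (intro exI[of _ "\<lambda>j. if j = i then 1 else 0"]) (simp add: if_distrib[of "\<lambda>c. c *\<^sub>R _"] cong: if_cong)
    qed
    show "convex ?R"
    proof (rule convexI, clarify)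
      fix u v :: real and c e :: "'a \<Rightarrow> real"
      assume *: "0 \<le> u" "0 \<le> v" "u + v = 1" "\<forall>i\<in>Q. 0 \<le> c i" "sum c Q = 1"
        "\<forall>i\<in>Q. 0 \<le> e i" "sum e Q = 1"
      show "\<exists>g. u *\<^sub>R (\<Sum>i\<in>Q. c i *\<^sub>R a i) + v *\<^sub>R (\<Sum>i\<in>Q. e i *\<^sub>R a i) = (\<Sum>i\<in>Q. g i *\<^sub>R a i) \<and>
          (\<forall>i\<in>Q. 0 \<le> g i) \<and> sum g Q = 1"
        using * by (intro exI[of _ "\<lambda>i. u * c i + v * e i"])
          (simp add: scaleR_left_distrib sum.distrib scaleR_right.sum sum_distrib_left[symmetric])
    qed
  qed
  show "?R \<subseteq> convex hull {a i | i. i \<in> Q}"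
  proof clarify
    fix c :: "_ \<Rightarrow> real" assume "\<forall>i\<in>Q. 0 \<le> c i" "sum c Q = 1"
    then show "(\<Sum>i\<in>Q. c i *\<^sub>R a i) \<in> convex hull {a i | i. i \<in> Q}"
      using assms by (intro convex_sum) (auto intro: hull_inc)
  qed
qed

lemma convex_cone_hull_indexed_family:
  assumes "finite Q"
  shows "convex_cone hull {a i | i. i \<in> Q} = {\<Sum>i\<in>Q. c i *\<^sub>R a i | c. \<forall>i\<in>Q. 0 \<le> (c i :: real)}" (is "_ = ?R")
proof
  show "convex_cone hull {a i | i. i \<in> Q} \<subseteq> ?R"
  proof (rule hull_minimal)
    show "{a i | i. i \<in> Q} \<subseteq> ?R"
    proof clarify
      fix i assume "i \<in> Q"
      then show "\<exists>c. a i = (\<Sum>i\<in>Q. c i *\<^sub>R a i) \<and> (\<forall>i\<in>Q. 0 \<le> c i)"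
        using assms by (intro exI[of _ "\<lambda>j. if j = i then 1 else 0"]) (simp add: if_distrib[of "\<lambda>c. c *\<^sub>R _"] cong: if_cong)
    qed
    show "convex_cone ?R"
      unfolding convex_cone_iff
    proof (intro conjI ballI allI impI)
      show "0 \<in> ?R"
        by (rule CollectI, rule exI[of _ "\<lambda>_. 0"]) simp
      fix x y assume "x \<in> ?R" "y \<in> ?R"
      then obtain c e where "x = (\<Sum>i\<in>Q. c i *\<^sub>R a i)" "\<forall>i\<in>Q. 0 \<le> c i"
        "y = (\<Sum>i\<in>Q. e i *\<^sub>R a i)" "\<forall>i\<in>Q. 0 \<le> e i"
        by blast
      then show "x + y \<in> ?R"
        by (intro CollectI exI[of _ "\<lambda>i. c i + e i"]) (simp add: scaleR_left_distrib sum.distrib)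
    next
      fix x and t :: real assume "x \<in> ?R" "0 \<le> t"
      then obtain c where "x = (\<Sum>i\<in>Q. c i *\<^sub>R a i)" "\<forall>i\<in>Q. 0 \<le> c i"
        by blast
      then show "t *\<^sub>R x \<in> ?R"
        using \<open>0 \<le> t\<close> by (intro CollectI exI[of _ "\<lambda>i. t * c i"]) (simp add: scaleR_right.sum)
    qed
  qed
  show "?R \<subseteq> convex_cone hull {a i | i. i \<in> Q}"
  proof clarify
    fix c :: "_ \<Rightarrow> real" assume "\<forall>i\<in>Q. 0 \<le> c i"
    then show "(\<Sum>i\<in>Q. c i *\<^sub>R a i) \<in> convex_cone hull {a i | i. i \<in> Q}"
      by (intro convex_cone_sum convex_cone_convex_cone_hull convex_cone_hull_mul) (auto intro: hull_inc)
  qed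
qed

text \<open>For \<open>i\<close> and \<open>j\<close> both in \<open>P1\<close> the differences
  occur with both signs and generate the span; only the vectors \<open>d i\<close> need their
  negatives added.\<close>

definition cone_generators ::
    "(nat \<Rightarrow> 'a::real_inner) \<Rightarrow> (nat \<Rightarrow> 'a) \<Rightarrow> nat set \<Rightarrow> nat set \<Rightarrow> nat set \<Rightarrow> nat set \<Rightarrow> 'a set" where
  "cone_generators a d P1 Q1 P2 Q2 =
     {a i - a j | i j. i \<in> Q1 \<and> j \<in> P1} \<union> {d i | i. i \<in> Q2} \<union> {- d i | i. i \<in> P2}"

lemma finite_cone_generators:
  assumes "finite P1" "finite Q1" "finite P2" "finite Q2"
  shows "finite (cone_generators a d P1 Q1 P2 Q2)"
proof -
  have "{a i - a j | i j. i \<in> Q1 \<and> j \<in> P1} = (\<lambda>(i, j). a i - a j) ` (Q1 \<times> P1)"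
    by auto
  then show ?thesis
    using assms by (simp add: cone_generators_def setcompr_eq_image)
qed

lemma F_set_eq_hull:
  assumes "P1 \<subseteq> Q1" "P2 \<subseteq> Q2"
  shows "F_set a d P1 Q1 P2 Q2 = convex_cone hull (cone_generators a d P1 Q1 P2 Q2)"
proof -
  let ?A = "{a i - a j | i j. i \<in> P1 \<and> j \<in> P1}"
  have "uminus ` ?A \<subseteq> ?A"
    by (force simp: image_iff)
  then have "span ?A = convex_cone hull ?A"
    unfolding span_eq_convex_cone_hull by (simp add: Un_absorb2)
  moreover have "span {d i | i. i \<in> P2} = convex_cone hull ({d i | i. i \<in> P2} \<union> {- d i | i. i \<in> P2})"
    unfolding span_eq_convex_cone_hull by (rule arg_cong[where f = "(hull) convex_cone"]) auto
  moreover have "cone_generators a d P1 Q1 P2 Q2 =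
      ((?A \<union> {a i - a j | i j. i \<in> Q1 - P1 \<and> j \<in> P1}) \<union> ({d i | i. i \<in> P2} \<union> {- d i | i. i \<in> P2}))
      \<union> {d i | i. i \<in> Q2 - P2}"
    using assms unfolding cone_generators_def by blast
  ultimately show ?thesis
    by (simp only: F_set_def convex_cone_hull_Un_plus)
qed

lemma G_set_iff:
  assumes "P1 \<subseteq> Q1" "P2 \<subseteq> Q2"
  shows "u \<in> G_set a d P1 Q1 P2 Q2 \<longleftrightarrow>
    (\<forall>i\<in>Q1. \<forall>j\<in>P1. a i \<bullet> u \<le> a j \<bullet> u) \<and> (\<forall>i\<in>Q2. d i \<bullet> u \<le> 0) \<and> (\<forall>i\<in>P2. d i \<bullet> u = 0)"
  using assms unfolding G_set_def mem_Collect_eq inner_diff_left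
  by (smt (verit, ccfv_threshold) Diff_iff subset_iff)

lemma G_set_eq_polar:
  assumes "P1 \<subseteq> Q1" "P2 \<subseteq> Q2"
  shows "G_set a d P1 Q1 P2 Q2 = {u. \<forall>v\<in>cone_generators a d P1 Q1 P2 Q2. v \<bullet> u \<le> 0}"
proof -
  have gen: "(\<forall>v\<in>cone_generators a d P1 Q1 P2 Q2. v \<bullet> u \<le> 0) \<longleftrightarrow>
      (\<forall>i\<in>Q1. \<forall>j\<in>P1. (a i - a j) \<bullet> u \<le> 0) \<and> (\<forall>i\<in>Q2. d i \<bullet> u \<le> 0) \<and> (\<forall>i\<in>P2. - d i \<bullet> u \<le> 0)" for u
    unfolding cone_generators_def by blast
  have "(\<forall>v\<in>cone_generators a d P1 Q1 P2 Q2. v \<bullet> u \<le> 0) \<longleftrightarrow> u \<in> G_set a d P1 Q1 P2 Q2" for u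
  proof -
    have "(\<forall>i\<in>Q2. d i \<bullet> u \<le> 0) \<and> (\<forall>i\<in>P2. - d i \<bullet> u \<le> 0) \<longleftrightarrow>
        (\<forall>i\<in>Q2. d i \<bullet> u \<le> 0) \<and> (\<forall>i\<in>P2. d i \<bullet> u = 0)"
      using assms(2) by (force simp: order_antisym_conv)
    then show ?thesis
      unfolding G_set_iff[OF assms] gen[of u] by (simp add: inner_diff_left)
  qed
  then show ?thesis by blast
qed

text \<open>\<G> is the polar of the generators, so Farkas' lemma gives the reverse polarity.
  Membership in \<F> can then be tested on directions, in particular on displacements of graph
  points.\<close>

lemma F_set_iff:
  fixes a :: "nat \<Rightarrow> 'a::euclidean_space"
  assumes "P1 \<subseteq> Q1" "P2 \<subseteq> Q2" "finite Q1" "finite Q2"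
  shows "y \<in> F_set a d P1 Q1 P2 Q2 \<longleftrightarrow> (\<forall>u\<in>G_set a d P1 Q1 P2 Q2. y \<bullet> u \<le> 0)"
  using convex_cone_hull_iff_polar[OF finite_cone_generators, of P1 Q1 P2 Q2 y a d] assms
  by (auto simp: F_set_eq_hull G_set_eq_polar finite_subset)

lemma closed_F_set:
  fixes a :: "nat \<Rightarrow> 'a::euclidean_space"
  assumes "P1 \<subseteq> Q1" "P2 \<subseteq> Q2" "finite Q1" "finite Q2"
  shows "closed (F_set a d P1 Q1 P2 Q2)"
  unfolding F_set_eq_hull[OF assms(1,2)]
  using assms by (intro closed_convex_cone_hull finite_cone_generators) (auto intro: finite_subset)

lemma closed_G_set:
  assumes "P1 \<subseteq> Q1" "P2 \<subseteq> Q2"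
  shows "closed (G_set a d P1 Q1 P2 Q2)"
proof -
  have "G_set a d P1 Q1 P2 Q2 = (\<Inter>v\<in>cone_generators a d P1 Q1 P2 Q2. {u. v \<bullet> u \<le> 0})"
    unfolding G_set_eq_polar[OF assms] by auto
  then show ?thesis
    by (simp add: closed_INT closed_halfspace_le)
qed

lemma F_set_zero: "P1 \<subseteq> Q1 \<Longrightarrow> P2 \<subseteq> Q2 \<Longrightarrow> 0 \<in> F_set a d P1 Q1 P2 Q2"
  by (simp add: F_set_eq_hull convex_cone_hull_contains_0)

section \<open>Convex piecewise linear functions\<close>

text \<open>For the active sets of a point of the domain this is the subdifferential there; for
  smaller index sets it is the set that has to contain \<open>v\<close> in the definition of
  \<A>.\<close>

definition face :: "(nat \<Rightarrow> 'a::real_vector) \<Rightarrow> (nat \<Rightarrow> 'a) \<Rightarrow> nat set \<Rightarrow> nat set \<Rightarrow> 'a set" where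
  "face a d P1 P2 = convex hull {a i | i. i \<in> P1} + convex_cone hull {d i | i. i \<in> P2}"

text \<open>The index sets are exactly the supports, so small changes of the weights that preserve
  the sum over \<open>P1\<close> remain admissible.\<close>

definition strict_multipliers ::
    "(nat \<Rightarrow> 'a::real_vector) \<Rightarrow> (nat \<Rightarrow> 'a) \<Rightarrow> nat set \<Rightarrow> nat set \<Rightarrow> 'a \<Rightarrow>
     (nat \<Rightarrow> real) \<Rightarrow> (nat \<Rightarrow> real) \<Rightarrow> bool" where
  "strict_multipliers a d P1 P2 v lam mu \<longleftrightarrow>
     multipliers a d P1 P2 v lam mu \<and> (\<forall>i\<in>P1. 0 < lam i) \<and> (\<forall>i\<in>P2. 0 < mu i)"

lemma face_iff_multipliers:
  assumes "finite P1" "finite P2"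
  shows "v \<in> face a d P1 P2 \<longleftrightarrow> (\<exists>lam mu. multipliers a d P1 P2 v lam mu)"
  unfolding face_def multipliers_def convex_hull_indexed_family[OF assms(1)]
    convex_cone_hull_indexed_family[OF assms(2)] set_plus_def by blast

lemma strict_multipliers_face:
  assumes "strict_multipliers a d P1 P2 v lam mu" "finite P1" "finite P2"
  shows "v \<in> face a d P1 P2"
  using assms face_iff_multipliers unfolding strict_multipliers_def by blast

lemma face_mono: "P1 \<subseteq> Q1 \<Longrightarrow> P2 \<subseteq> Q2 \<Longrightarrow> face a d P1 P2 \<subseteq> face a d Q1 Q2"
  unfolding face_def by (intro set_plus_mono2 hull_mono) auto

lemma convex_face: "convex (face a d P1 P2)"
  unfolding face_def by (intro convex_set_plus convex_convex_hull convex_convex_cone_hull)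

lemma closed_face:
  fixes a d :: "nat \<Rightarrow> 'a::euclidean_space"
  assumes "finite P1" "finite P2"
  shows "closed (face a d P1 P2)"
proof -
  have "compact (convex hull {a i | i. i \<in> P1})"
    using assms(1) by (intro compact_convex_hull finite_imp_compact) (simp add: setcompr_eq_image)
  moreover have "closed (convex_cone hull {d i | i. i \<in> P2})"
    using assms(2) by (intro closed_convex_cone_hull) (simp add: setcompr_eq_image)
  ultimately have "closed (\<Union>x\<in>convex hull {a i | i. i \<in> P1}. \<Union>y\<in>convex_cone hull {d i | i. i \<in> P2}. {x + y})"
    by (rule compact_closed_sums)
  moreover have "face a d P1 P2 = (\<Union>x\<in>convex hull {a i | i. i \<in> P1}. \<Union>y\<in>convex_cone hull {d i | i. i \<in> P2}. {x + y})"
    unfolding face_def set_plus_def by blast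
  ultimately show ?thesis by simp
qed

lemma multipliers_support:
  assumes "finite Q1" "finite Q2" "multipliers a d Q1 Q2 v lam mu"
  shows "strict_multipliers a d (pos_support Q1 lam) (pos_support Q2 mu) v lam mu"
proof -
  have "sum lam (pos_support Q1 lam) = sum lam Q1"
    using assms by (intro sum.mono_neutral_left) (auto simp: pos_support_def multipliers_def intro: antisym)
  moreover have "(\<Sum>i\<in>pos_support Q1 lam. lam i *\<^sub>R a i) = (\<Sum>i\<in>Q1. lam i *\<^sub>R a i)"
    using assms by (intro sum.mono_neutral_left) (auto simp: pos_support_def multipliers_def intro: antisym)
  moreover have "(\<Sum>i\<in>pos_support Q2 mu. mu i *\<^sub>R d i) = (\<Sum>i\<in>Q2. mu i *\<^sub>R d i)"
    using assms by (intro sum.mono_neutral_left) (auto simp: pos_support_def multipliers_def intro: antisym)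
  ultimately show ?thesis
    using assms(3) by (auto simp: strict_multipliers_def multipliers_def pos_support_def)
qed

text \<open>Mixing in uniform weights on \<open>P1\<close> and adding \<open>t\<close> on
  \<open>P2\<close> makes every weight positive and moves \<open>v\<close> only by
  \<open>t *\<^sub>R c\<close>.\<close>

lemma face_strict_approx:
  fixes a d :: "nat \<Rightarrow> 'a::real_normed_vector"
  assumes "finite P1" "finite P2" "v \<in> face a d P1 P2" "0 < \<epsilon>"
  obtains v' lam mu where "dist v' v < \<epsilon>" "strict_multipliers a d P1 P2 v' lam mu"
proof -
  obtain lam mu where lm: "multipliers a d P1 P2 v lam mu"
    using assms face_iff_multipliers by blast
  then have "P1 \<noteq> {}"
    by (auto simp: multipliers_def)
  then have card: "0 < real (card P1)"
    using assms(1) by (simp add: card_gt_0_iff)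
  define c where "c = (\<Sum>i\<in>P1. (1 / real (card P1) - lam i) *\<^sub>R a i) + (\<Sum>i\<in>P2. d i)"
  define t where "t = min (1 / 2) (\<epsilon> / (norm c + 1))"
  have *: "0 < norm c + 1"
    by (simp add: add_nonneg_pos)
  then have t: "0 < t" "t < 1"
    using assms(4) by (auto simp: t_def)
  have "t \<le> \<epsilon> / (norm c + 1)"
    unfolding t_def by (rule min.cobounded2)
  then have "t * (norm c + 1) \<le> \<epsilon>"
    using pos_le_divide_eq[OF *] by blast
  then have tc: "t * norm c < \<epsilon>"
    using t(1) by (simp add: algebra_simps)
  define lam' where "lam' i = (1 - t) * lam i + t / real (card P1)" for i
  define mu' where "mu' i = mu i + t" for i
  have "strict_multipliers a d P1 P2 (v + t *\<^sub>R c) lam' mu'"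
    unfolding strict_multipliers_def multipliers_def
  proof (intro conjI ballI)
    have "sum lam P1 = 1"
      using lm by (simp add: multipliers_def)
    then show "sum lam' P1 = 1"
      using card by (simp add: lam'_def sum.distrib sum_distrib_left[symmetric])
    show pos: "0 < lam' i" if "i \<in> P1" for i
      using lm that t card by (auto simp: lam'_def multipliers_def intro!: add_nonneg_pos)
    then show "0 \<le> lam' i" if "i \<in> P1" for i
      using that by (simp add: less_imp_le)
    show pos: "0 < mu' i" if "i \<in> P2" for i
      using lm that t by (auto simp: mu'_def multipliers_def intro!: add_nonneg_pos)
    then show "0 \<le> mu' i" if "i \<in> P2" for i
      using that by (simp add: less_imp_le)
    have "lam' i *\<^sub>R a i = lam i *\<^sub>R a i + t *\<^sub>R ((1 / real (card P1) - lam i) *\<^sub>R a i)" for i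
      by (simp add: lam'_def algebra_simps)
    moreover have "mu' i *\<^sub>R d i = mu i *\<^sub>R d i + t *\<^sub>R d i" for i
      by (simp add: mu'_def algebra_simps)
    ultimately show "v + t *\<^sub>R c = (\<Sum>i\<in>P1. lam' i *\<^sub>R a i) + (\<Sum>i\<in>P2. mu' i *\<^sub>R d i)"
      using lm unfolding multipliers_def
      by (simp add: c_def sum.distrib scaleR_right_distrib scaleR_right.sum)
  qed
  moreover have "dist (v + t *\<^sub>R c) v < \<epsilon>"
    using tc t(1) by (simp add: dist_norm)
  ultimately show thesis
    using that by blast
qed

section \<open>The subdifferential and the normals to its graph\<close>

locale pl_function =
  fixes \<theta> :: "'a::euclidean_space \<Rightarrow> ereal" and l p :: nat
    and a d :: "nat \<Rightarrow> 'a" and \<alpha> \<beta> :: "nat \<Rightarrow> real"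
  assumes pl: "convex_pl \<theta> l a \<alpha> p d \<beta>"
begin

abbreviation K where "K \<equiv> active_max l a \<alpha>"
abbreviation I where "I \<equiv> active_con p d \<beta>"
abbreviation D where "D \<equiv> eff_dom \<theta>"

definition M :: "'a \<Rightarrow> real" where "M z = Max ((\<lambda>i. a i \<bullet> z - \<alpha> i) ` {1..l})"

lemma index_nonempty: "{1..l} \<noteq> {}"
  using pl by (simp add: convex_pl_def)

lemma finite_KI [simp]: "finite (K z)" "finite (I z)"
  by (simp_all add: active_max_def active_con_def)

lemma dom_iff: "z \<in> D \<longleftrightarrow> (\<forall>i\<in>{1..p}. d i \<bullet> z \<le> \<beta> i)"
  using pl by (simp add: convex_pl_def)

lemma theta_eq: "z \<in> D \<Longrightarrow> \<theta> z = ereal (M z)"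
  using pl by (simp add: convex_pl_def M_def)

lemma M_ge: "i \<in> {1..l} \<Longrightarrow> a i \<bullet> z - \<alpha> i \<le> M z"
  unfolding M_def by (intro Max_ge) auto

lemma M_le_iff: "M z \<le> c \<longleftrightarrow> (\<forall>i\<in>{1..l}. a i \<bullet> z - \<alpha> i \<le> c)"
  unfolding M_def using index_nonempty by (subst Max_le_iff) auto

lemma M_less_iff: "M z < c \<longleftrightarrow> (\<forall>i\<in>{1..l}. a i \<bullet> z - \<alpha> i < c)"
  unfolding M_def using index_nonempty by (subst Max_less_iff) auto

lemma K_iff: "i \<in> K z \<longleftrightarrow> i \<in> {1..l} \<and> a i \<bullet> z - \<alpha> i = M z"
  by (simp add: active_max_def M_def)

lemma I_iff: "i \<in> I z \<longleftrightarrow> i \<in> {1..p} \<and> d i \<bullet> z = \<beta> i"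
  by (simp add: active_con_def)

lemma K_nonempty: "K z \<noteq> {}"
proof -
  have "M z \<in> (\<lambda>i. a i \<bullet> z - \<alpha> i) ` {1..l}"
    unfolding M_def using index_nonempty by (intro Max_in) auto
  then show ?thesis
    using K_iff by fastforce
qed

lemma subdiff_iff: "v \<in> subdiff \<theta> x \<longleftrightarrow> x \<in> D \<and> (\<forall>y\<in>D. M x + v \<bullet> (y - x) \<le> M y)"
proof
  assume v: "v \<in> subdiff \<theta> x"
  then have "x \<in> D"
    by (auto simp: subdiff_def eff_dom_def)
  moreover have "M x + v \<bullet> (y - x) \<le> M y" if "y \<in> D" for y
  proof -
    have "\<theta> x + ereal (v \<bullet> (y - x)) \<le> \<theta> y"
      using v by (simp add: subdiff_def)
    then show ?thesis
      by (simp add: theta_eq that \<open>x \<in> D\<close>)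
  qed
  ultimately show "x \<in> D \<and> (\<forall>y\<in>D. M x + v \<bullet> (y - x) \<le> M y)" by blast
next
  assume *: "x \<in> D \<and> (\<forall>y\<in>D. M x + v \<bullet> (y - x) \<le> M y)"
  have "\<theta> x + ereal (v \<bullet> (y - x)) \<le> \<theta> y" for y
  proof (cases "y \<in> D")
    case True
    then show ?thesis using * by (simp add: theta_eq)
  next
    case False
    then show ?thesis by (simp add: eff_dom_def)
  qed
  then show "v \<in> subdiff \<theta> x"
    using * by (simp add: subdiff_def theta_eq)
qed

text \<open>The maximum at \<open>x\<close> stands on the smaller side of the subgradient
  inequality, so it splits into one inequality per piece and test point, each continuous in
  \<open>(x, v)\<close>.\<close>

lemma closed_gph_subdiff: "closed (gph (subdiff \<theta>))"
proof -
  have "gph (subdiff \<theta>) = (\<Inter>i\<in>{1..p}. {z. d i \<bullet> fst z \<le> \<beta> i}) \<inter>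
      (\<Inter>y\<in>D. \<Inter>i\<in>{1..l}. {z. a i \<bullet> fst z - \<alpha> i + snd z \<bullet> (y - fst z) \<le> M y})"
  proof -
    have "M x + c \<le> e \<longleftrightarrow> (\<forall>i\<in>{1..l}. a i \<bullet> x - \<alpha> i + c \<le> e)" for x c e
      using M_le_iff[of x "e - c"] by (simp add: algebra_simps)
    then show ?thesis
      unfolding gph_def subdiff_iff dom_iff[of "fst _"] by (auto simp: dom_iff)
  qed
  then show ?thesis
    by (auto intro!: closed_Int closed_INT closed_Collect_le continuous_intros)
qed

lemma face_subset_subdiff:
  assumes "x \<in> D"
  shows "face a d (K x) (I x) \<subseteq> subdiff \<theta> x"
proof -
  let ?C = "{c. \<forall>y\<in>D. c \<bullet> (y - x) \<le> 0}"
  let ?B = "{v. \<forall>y\<in>D. v \<bullet> (y - x) \<le> M y - M x}"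
  have "convex_cone hull {d i | i. i \<in> I x} \<subseteq> ?C"
  proof (rule hull_minimal)
    show "{d i | i. i \<in> I x} \<subseteq> ?C"
      by (auto simp: I_iff dom_iff inner_diff_right)
    show "convex_cone ?C"
      unfolding convex_cone_iff
      by (auto simp: inner_add_left mult_nonneg_nonpos intro: add_nonpos_nonpos)
  qed
  moreover have "convex hull {a i | i. i \<in> K x} \<subseteq> ?B"
  proof (rule hull_minimal)
    have "a i \<bullet> (y - x) \<le> M y - M x" if "i \<in> K x" for i y
      using that M_ge[of i y] by (simp add: K_iff inner_diff_right)
    then show "{a i | i. i \<in> K x} \<subseteq> ?B"
      by blast
    have "?B = (\<Inter>y\<in>D. {v. (y - x) \<bullet> v \<le> M y - M x})"
      by (auto simp: inner_commute)
    also have "convex \<dots>"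
      by (intro convex_INT convex_halfspace_le)
    finally show "convex ?B" .
  qed
  ultimately have *: "c1 \<bullet> (y - x) \<le> M y - M x" "c2 \<bullet> (y - x) \<le> 0"
    if "c1 \<in> convex hull {a i | i. i \<in> K x}" "c2 \<in> convex_cone hull {d i | i. i \<in> I x}" "y \<in> D" for c1 c2 y
    using that by blast+
  show ?thesis
  proof
    fix v assume "v \<in> face a d (K x) (I x)"
    then obtain c1 c2 where "c1 \<in> convex hull {a i | i. i \<in> K x}"
      "c2 \<in> convex_cone hull {d i | i. i \<in> I x}" "v = c1 + c2"
      unfolding face_def set_plus_def by blast
    then show "v \<in> subdiff \<theta> x"
      using *[of c1 c2] assms by (force simp: subdiff_iff inner_add_left)
  qed
qed

text \<open>If \<open>v\<close> were outside the face, separation would give a direction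
  \<open>h\<close> along which every active piece grows more slowly than \<open>v\<close> and no
  active constraint increases. A short step along \<open>h\<close> then violates the subgradient
  inequality.\<close>

lemma subdiff_eq_face:
  assumes "x \<in> D"
  shows "subdiff \<theta> x = face a d (K x) (I x)"
proof
  show "face a d (K x) (I x) \<subseteq> subdiff \<theta> x"
    using assms by (rule face_subset_subdiff)
  show "subdiff \<theta> x \<subseteq> face a d (K x) (I x)"
  proof
    fix v assume v: "v \<in> subdiff \<theta> x"
    show "v \<in> face a d (K x) (I x)"
    proof (rule ccontr)
      assume "v \<notin> face a d (K x) (I x)"
      then obtain g b where gb: "g \<bullet> v < b" "\<And>c. c \<in> face a d (K x) (I x) \<Longrightarrow> b < g \<bullet> c"
        using separating_hyperplane_closed_point[OF convex_face closed_face[OF finite_KI]] by blast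
      define h where "h = - g"
      have face: "a i + c \<in> face a d (K x) (I x)"
        if "i \<in> K x" "c \<in> convex_cone hull {d i | i. i \<in> I x}" for i c
        unfolding face_def using that(2) by (rule set_plus_intro[rotated]) (use that(1) in \<open>auto intro: hull_inc\<close>)
      have ah: "a i \<bullet> h < v \<bullet> h" if "i \<in> K x" for i
        using gb(1) gb(2)[OF face[OF that convex_cone_hull_contains_0]]
        by (simp add: h_def inner_commute)
      obtain i0 where "i0 \<in> K x"
        using K_nonempty by blast
      have dh: "d j \<bullet> h \<le> 0" if "j \<in> I x" for j
      proof (rule ccontr)
        assume "\<not> ?thesis"
        then have pos: "0 < d j \<bullet> h" by simp
        \<comment> \<open>A large enough multiple of \<open>d j\<close> stays in the cone and would
          push the face across the separating hyperplane.\<close>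
        define t where "t = max 0 ((v \<bullet> h - a i0 \<bullet> h) / (d j \<bullet> h))"
        have "t *\<^sub>R d j \<in> convex_cone hull {d i | i. i \<in> I x}"
          using that by (intro convex_cone_hull_mul hull_inc) (auto simp: t_def)
        from gb(1) gb(2)[OF face[OF \<open>i0 \<in> K x\<close> this]]
        have "a i0 \<bullet> h + t * (d j \<bullet> h) < v \<bullet> h"
          by (simp add: h_def inner_add_right inner_commute)
        moreover have "v \<bullet> h - a i0 \<bullet> h \<le> t * (d j \<bullet> h)"
        proof -
          have "(v \<bullet> h - a i0 \<bullet> h) / (d j \<bullet> h) \<le> t"
            unfolding t_def by (rule max.cobounded2)
          then show ?thesis
            using pos_divide_le_eq[OF pos] by blast
        qed
        ultimately show False by simp
      qed
      have "\<forall>\<^sub>F t in at_right 0. x + t *\<^sub>R h \<in> D"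
        unfolding dom_iff
      proof (intro eventually_ball_finite ballI)
        fix j assume j: "j \<in> {1..p}"
        show "\<forall>\<^sub>F t in at_right 0. d j \<bullet> (x + t *\<^sub>R h) \<le> \<beta> j"
        proof (cases "j \<in> I x")
          case True
          have "\<forall>\<^sub>F t in at_right (0::real). 0 < t"
            by (rule eventually_at_right_less)
          then show ?thesis
            by eventually_elim (use True dh[OF True] in \<open>auto simp: I_iff inner_add_right mult_nonneg_nonpos\<close>)
        next
          case False
          then have "d j \<bullet> x < \<beta> j"
            using j assms by (auto simp: I_iff dom_iff order_less_le)
          from eventually_affine_less[OF this, of "d j \<bullet> h" 0] show ?thesis
            by eventually_elim (simp add: inner_add_right)
        qed
      qed simp
      moreover have "\<forall>\<^sub>F t in at_right 0. \<forall>i\<in>{1..l}. a i \<bullet> (x + t *\<^sub>R h) - \<alpha> i < M x + t * (v \<bullet> h)"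
      proof (intro eventually_ball_finite ballI)
        fix i assume i: "i \<in> {1..l}"
        show "\<forall>\<^sub>F t in at_right 0. a i \<bullet> (x + t *\<^sub>R h) - \<alpha> i < M x + t * (v \<bullet> h)"
        proof (cases "i \<in> K x")
          case True
          have "\<forall>\<^sub>F t in at_right (0::real). 0 < t"
            by (rule eventually_at_right_less)
          then show ?thesis
          proof eventually_elim
            case (elim t)
            then have "t * (a i \<bullet> h) < t * (v \<bullet> h)"
              using ah[OF True] by simp
            then show ?case
              using True by (simp add: K_iff inner_add_right)
          qed
        next
          case False
          then have "a i \<bullet> x - \<alpha> i < M x"
            using i M_ge[OF i, of x] by (auto simp: K_iff order_less_le)
          from eventually_affine_less[OF this, of "a i \<bullet> h" "v \<bullet> h"] show ?thesis
            by eventually_elim (simp add: inner_add_right)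
        qed
      qed simp
      ultimately have "\<forall>\<^sub>F t in at_right 0. x + t *\<^sub>R h \<in> D \<and> M (x + t *\<^sub>R h) < M x + t * (v \<bullet> h)"
        unfolding M_less_iff by eventually_elim simp
      then obtain t where "x + t *\<^sub>R h \<in> D" "M (x + t *\<^sub>R h) < M x + t * (v \<bullet> h)"
        using eventually_happens'[OF trivial_limit_at_right_real] by blast
      then show False
        using v unfolding subdiff_iff by force
    qed
  qed
qed

lemma gph_subdiff_iff: "(x, v) \<in> gph (subdiff \<theta>) \<longleftrightarrow> x \<in> D \<and> v \<in> face a d (K x) (I x)"
proof -
  have "(x, v) \<in> gph (subdiff \<theta>) \<longleftrightarrow> x \<in> D \<and> v \<in> subdiff \<theta> x"
    by (auto simp: gph_def subdiff_iff)
  then show ?thesis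
    using subdiff_eq_face by blast
qed

text \<open>Inactive indices are inactive by a strict inequality, which persists nearby. For pieces
  the comparison is with one fixed \<open>j\<close> active at \<open>x\<close>, so only affine
  functions are compared.\<close>

lemma eventually_active_subset:
  assumes "x \<in> D"
  shows "\<forall>\<^sub>F x' in nhds x. K x' \<subseteq> K x \<and> I x' \<subseteq> I x"
proof (intro eventually_conj)
  obtain j where j: "j \<in> K x"
    using K_nonempty by blast
  have "\<forall>\<^sub>F x' in nhds x. \<forall>i\<in>{1..l} - K x. a i \<bullet> x' - \<alpha> i < a j \<bullet> x' - \<alpha> j"
  proof (intro eventually_ball_finite ballI)
    fix i assume i: "i \<in> {1..l} - K x"
    have "((\<lambda>x'. (a j \<bullet> x' - \<alpha> j) - (a i \<bullet> x' - \<alpha> i)) \<longlongrightarrow> (a j \<bullet> x - \<alpha> j) - (a i \<bullet> x - \<alpha> i)) (nhds x)"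
      by (intro tendsto_intros filterlim_ident)
    then have "\<forall>\<^sub>F x' in nhds x. 0 < (a j \<bullet> x' - \<alpha> j) - (a i \<bullet> x' - \<alpha> i)"
      by (rule order_tendstoD) (use i j M_ge[of i x] in \<open>auto simp: K_iff order_less_le\<close>)
    then show "\<forall>\<^sub>F x' in nhds x. a i \<bullet> x' - \<alpha> i < a j \<bullet> x' - \<alpha> j"
      by eventually_elim simp
  qed simp
  then show "\<forall>\<^sub>F x' in nhds x. K x' \<subseteq> K x"
  proof eventually_elim
    case (elim x')
    show ?case
    proof
      fix i assume i: "i \<in> K x'"
      have "a j \<bullet> x' - \<alpha> j \<le> a i \<bullet> x' - \<alpha> i"
        using M_ge[of j x'] i j by (simp add: K_iff)
      then show "i \<in> K x"
        using elim i unfolding K_iff[of i x'] by (meson DiffI not_le)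
    qed
  qed
  have "\<forall>\<^sub>F x' in nhds x. \<forall>i\<in>{1..p} - I x. d i \<bullet> x' < \<beta> i"
  proof (intro eventually_ball_finite ballI)
    fix i assume i: "i \<in> {1..p} - I x"
    have "((\<lambda>x'. d i \<bullet> x') \<longlongrightarrow> d i \<bullet> x) (nhds x)"
      by (intro tendsto_intros filterlim_ident)
    then show "\<forall>\<^sub>F x' in nhds x. d i \<bullet> x' < \<beta> i"
      by (rule order_tendstoD) (use i assms in \<open>auto simp: I_iff dom_iff order_less_le\<close>)
  qed simp
  then show "\<forall>\<^sub>F x' in nhds x. I x' \<subseteq> I x"
  proof eventually_elim
    case (elim x')
    show ?case
    proof
      fix i assume "i \<in> I x'"
      then show "i \<in> I x"
        using elim unfolding I_iff[of i x'] by (metis DiffI less_irrefl)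
    qed
  qed
qed

text \<open>The subdifferential takes finitely many values, all closed, so the faces avoiding \<open>v\<close> stay
  away from it.\<close>

lemma eventually_subdiff_contains: "\<forall>\<^sub>F v' in nhds v. \<forall>x'. v' \<in> subdiff \<theta> x' \<longrightarrow> v \<in> subdiff \<theta> x'"
proof -
  define \<F> where "\<F> = {C \<in> (\<lambda>(P1, P2). face a d P1 P2) ` (Pow {1..l} \<times> Pow {1..p}). v \<notin> C}"
  have "closed (\<Union>\<F>)"
    by (rule closed_Union) (auto simp: \<F>_def intro!: closed_face intro: finite_subset)
  moreover have "v \<notin> \<Union>\<F>"
    by (auto simp: \<F>_def)
  ultimately have "\<forall>\<^sub>F v' in nhds v. v' \<in> - \<Union>\<F>"
    by (intro eventually_nhds_in_open) auto
  then show ?thesis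
  proof eventually_elim
    case (elim v')
    show ?case
    proof (intro allI impI)
      fix x' assume v': "v' \<in> subdiff \<theta> x'"
      then have "x' \<in> D" by (simp add: subdiff_iff)
      have "(K x', I x') \<in> Pow {1..l} \<times> Pow {1..p}"
        by (auto simp: K_iff I_iff)
      then have "subdiff \<theta> x' \<in> (\<lambda>(P1, P2). face a d P1 P2) ` (Pow {1..l} \<times> Pow {1..p})"
        unfolding subdiff_eq_face[OF \<open>x' \<in> D\<close>] by (rule rev_image_eqI) simp
      then show "v \<in> subdiff \<theta> x'"
        using elim v' by (auto simp: \<F>_def)
    qed
  qed
qed

text \<open>Equality in \<open>\<theta>(x') \<ge> \<Sum> lam\<^sub>i (\<langle>a\<^sub>i, x'\<rangle> - \<alpha>\<^sub>i)\<close> forces every index carrying a positive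
  multiplier of \<open>v\<close> to be active at \<open>x'\<close> as well.\<close>

lemma support_active:
  assumes x: "x \<in> D" "P1 \<subseteq> K x" "P2 \<subseteq> I x" and v: "strict_multipliers a d P1 P2 v lam mu"
    and x': "v \<in> subdiff \<theta> x'"
  shows "P1 \<subseteq> K x'" "P2 \<subseteq> I x'"
proof -
  have fin: "finite P1" "finite P2"
    using x(2,3) by (auto intro: finite_subset)
  have "x' \<in> D"
    using x' by (simp add: subdiff_iff)
  have "M x' + v \<bullet> (x - x') \<le> M x"
    using x' x(1) by (simp add: subdiff_iff)
  then have le: "M x' \<le> M x + v \<bullet> (x' - x)"
    by (simp add: inner_diff_right)
  have sum1: "sum lam P1 = 1"
    using v by (simp add: strict_multipliers_def multipliers_def)
  have "M x = (\<Sum>i\<in>P1. lam i * M x)"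
    using sum1 by (simp add: sum_distrib_right[symmetric])
  also have "\<dots> = (\<Sum>i\<in>P1. lam i * (a i \<bullet> x - \<alpha> i))"
    using x(2) by (intro sum.cong refl) (auto simp: K_iff)
  finally have Mx: "M x = (\<Sum>i\<in>P1. lam i * (a i \<bullet> x - \<alpha> i))" .
  have "v = (\<Sum>i\<in>P1. lam i *\<^sub>R a i) + (\<Sum>i\<in>P2. mu i *\<^sub>R d i)"
    using v by (simp add: strict_multipliers_def multipliers_def)
  then have vx: "v \<bullet> (x' - x) = (\<Sum>i\<in>P1. lam i * (a i \<bullet> (x' - x))) + (\<Sum>i\<in>P2. mu i * (d i \<bullet> (x' - x)))"
    by (simp add: inner_add_left inner_sum_left)
  have "(\<Sum>i\<in>P2. mu i * (d i \<bullet> (x' - x))) = (\<Sum>i\<in>P2. mu i * (d i \<bullet> x' - \<beta> i))"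
    using x(3) by (intro sum.cong refl) (auto simp: I_iff inner_diff_right)
  then have "M x + v \<bullet> (x' - x) = (\<Sum>i\<in>P1. lam i * (a i \<bullet> x' - \<alpha> i)) + (\<Sum>i\<in>P2. mu i * (d i \<bullet> x' - \<beta> i))"
    unfolding Mx vx by (simp add: sum.distrib[symmetric] algebra_simps)
  moreover have "M x' = (\<Sum>i\<in>P1. lam i * M x')"
    using sum1 by (simp add: sum_distrib_right[symmetric])
  \<comment> \<open>The right side is minus two weighted sums of nonnegative slacks, so every slack
    with a positive weight vanishes.\<close>
  ultimately have "0 \<le> - (\<Sum>i\<in>P1. lam i * (M x' - (a i \<bullet> x' - \<alpha> i))) - (\<Sum>i\<in>P2. mu i * (\<beta> i - d i \<bullet> x'))"
    using le by (simp add: algebra_simps sum.distrib sum_subtractf)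
  moreover have nn1: "\<forall>i\<in>P1. 0 \<le> lam i * (M x' - (a i \<bullet> x' - \<alpha> i))"
  proof
    fix i assume "i \<in> P1"
    then have "0 < lam i" "i \<in> {1..l}"
      using v x(2) by (auto simp: strict_multipliers_def K_iff)
    then show "0 \<le> lam i * (M x' - (a i \<bullet> x' - \<alpha> i))"
      using M_ge[of i x'] by simp
  qed
  moreover have nn2: "\<forall>i\<in>P2. 0 \<le> mu i * (\<beta> i - d i \<bullet> x')"
  proof
    fix i assume "i \<in> P2"
    then have "0 < mu i" "i \<in> {1..p}"
      using v x(3) by (auto simp: strict_multipliers_def I_iff)
    then show "0 \<le> mu i * (\<beta> i - d i \<bullet> x')"
      using \<open>x' \<in> D\<close> by (simp add: dom_iff)
  qed
  moreover have "0 \<le> (\<Sum>i\<in>P1. lam i * (M x' - (a i \<bullet> x' - \<alpha> i)))" "0 \<le> (\<Sum>i\<in>P2. mu i * (\<beta> i - d i \<bullet> x'))"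
    using nn1 nn2 by (auto intro: sum_nonneg)
  ultimately have "(\<Sum>i\<in>P1. lam i * (M x' - (a i \<bullet> x' - \<alpha> i))) = 0" "(\<Sum>i\<in>P2. mu i * (\<beta> i - d i \<bullet> x')) = 0"
    by linarith+
  then have *: "\<forall>i\<in>P1. lam i * (M x' - (a i \<bullet> x' - \<alpha> i)) = 0" "\<forall>i\<in>P2. mu i * (\<beta> i - d i \<bullet> x') = 0"
    using sum_nonneg_eq_0_iff[OF fin(1), of "\<lambda>i. lam i * (M x' - (a i \<bullet> x' - \<alpha> i))"]
      sum_nonneg_eq_0_iff[OF fin(2), of "\<lambda>i. mu i * (\<beta> i - d i \<bullet> x')"] nn1 nn2 by simp_all
  show "P1 \<subseteq> K x'"
  proof
    fix i assume "i \<in> P1"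
    then have "lam i \<noteq> 0" "i \<in> {1..l}" "lam i * (M x' - (a i \<bullet> x' - \<alpha> i)) = 0"
      using v x(2) *(1) by (auto simp: strict_multipliers_def K_iff)
    then show "i \<in> K x'"
      by (simp add: K_iff)
  qed
  show "P2 \<subseteq> I x'"
  proof
    fix i assume "i \<in> P2"
    then have "mu i \<noteq> 0" "i \<in> {1..p}" "mu i * (\<beta> i - d i \<bullet> x') = 0"
      using v x(3) *(2) by (auto simp: strict_multipliers_def I_iff)
    then show "i \<in> I x'"
      by (simp add: I_iff)
  qed
qed

text \<open>Near \<open>(x, v)\<close> the vector \<open>v\<close> is still a subgradient at
  \<open>x'\<close>, so the supports stay active and \<open>x' - x\<close> lies in \<G>. Dually,
  \<open>v\<close> maximizes the inner product with \<open>q\<close> over a face containing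
  \<open>v'\<close>. The normal inequality thus holds without any error term.\<close>

lemma regular_normal_gph_subdiffI:
  assumes x: "x \<in> D" and P: "P1 \<subseteq> K x" "P2 \<subseteq> I x"
    and v: "strict_multipliers a d P1 P2 v lam mu"
    and y: "y \<in> F_set a d P1 (K x) P2 (I x)" and q: "q \<in> G_set a d P1 (K x) P2 (I x)"
  shows "(y, q) \<in> regular_normal_cone (x, v) (gph (subdiff \<theta>))"
proof -
  note G = G_set_iff[OF P, of _ a d]
  have "finite P1" "finite P2"
    using P by (auto intro: finite_subset)
  then have vx: "v \<in> subdiff \<theta> x"
    using strict_multipliers_face[OF v] face_mono[OF P, of a d] subdiff_eq_face[OF x] by blast
  have "\<forall>\<^sub>F z in nhds x \<times>\<^sub>F nhds v. (K (fst z) \<subseteq> K x \<and> I (fst z) \<subseteq> I x) \<and>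
      (\<forall>x'. snd z \<in> subdiff \<theta> x' \<longrightarrow> v \<in> subdiff \<theta> x')"
    using eventually_prodI[OF eventually_active_subset[OF x] eventually_subdiff_contains[of v]] by simp
  then obtain r where r: "0 < r" "\<And>x' v'. dist (x', v') (x, v) < r \<Longrightarrow>
      K x' \<subseteq> K x \<and> I x' \<subseteq> I x \<and> (\<forall>x''. v' \<in> subdiff \<theta> x'' \<longrightarrow> v \<in> subdiff \<theta> x'')"
    unfolding nhds_prod[symmetric] eventually_nhds_metric by (metis fst_conv snd_conv)
  show ?thesis
  proof (rule proximal_normal_imp_regular[OF r(1)])
    fix z assume z: "z \<in> gph (subdiff \<theta>)" "norm (z - (x, v)) < r"
    obtain x' v' where zeq: "z = (x', v')"
      by (cases z)
    have near: "K x' \<subseteq> K x" "I x' \<subseteq> I x" "\<And>x''. v' \<in> subdiff \<theta> x'' \<Longrightarrow> v \<in> subdiff \<theta> x''"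
      using r(2)[of x' v'] z(2) by (auto simp: zeq dist_norm[of "(x', v')"] simp del: dist_Pair_Pair)
    have v'x': "v' \<in> subdiff \<theta> x'" and "x' \<in> D"
      using z(1) by (auto simp: zeq gph_def subdiff_iff)
    note act = support_active[OF x P v near(3)[OF v'x']]
    have "x' - x \<in> G_set a d P1 (K x) P2 (I x)"
      unfolding G
    proof (intro conjI ballI)
      fix i j assume "i \<in> K x" "j \<in> P1"
      then show "a i \<bullet> (x' - x) \<le> a j \<bullet> (x' - x)"
      proof -
        have "j \<in> K x" "j \<in> K x'"
          using \<open>j \<in> P1\<close> P(1) act(1) by auto
        then show ?thesis
          using M_ge[of i x'] \<open>i \<in> K x\<close> by (simp add: K_iff inner_diff_right)
      qed
    next
      fix i assume "i \<in> I x"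
      then show "d i \<bullet> (x' - x) \<le> 0"
        using \<open>x' \<in> D\<close> by (auto simp: I_iff dom_iff inner_diff_right)
    next
      fix i assume "i \<in> P2"
      then show "d i \<bullet> (x' - x) = 0"
        using P(2) act(2) by (auto simp: I_iff inner_diff_right subset_iff)
    qed
    then have "y \<bullet> (x' - x) \<le> 0"
      using y F_set_iff[OF P finite_KI] by blast
    moreover have "q \<bullet> (v' - v) \<le> 0"
    proof -
      have "v' \<in> face a d (K x) (I x)"
        using v'x' face_mono[OF near(1,2), of a d] subdiff_eq_face[OF \<open>x' \<in> D\<close>] by blast
      then obtain lam' mu' where m': "multipliers a d (K x) (I x) v' lam' mu'"
        using face_iff_multipliers[OF finite_KI] by blast
      obtain j where j: "j \<in> P1"
        using v by (force simp: strict_multipliers_def multipliers_def)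
      have ub: "v' \<bullet> q \<le> a j \<bullet> q"
      proof -
        have "v' \<bullet> q = (\<Sum>i\<in>K x. lam' i * (a i \<bullet> q)) + (\<Sum>i\<in>I x. mu' i * (d i \<bullet> q))"
          using m' by (simp add: multipliers_def inner_add_left inner_sum_left)
        also have "\<dots> \<le> (\<Sum>i\<in>K x. lam' i * (a j \<bullet> q)) + 0"
          using m' q j unfolding G
          by (intro add_mono sum_mono sum_nonpos mult_left_mono mult_nonneg_nonpos) (auto simp: multipliers_def)
        also have "\<dots> = a j \<bullet> q"
          using m' by (simp add: multipliers_def sum_distrib_right[symmetric])
        finally show ?thesis .
      qed
      have "v \<bullet> q = a j \<bullet> q"
      proof -
        have "v \<bullet> q = (\<Sum>i\<in>P1. lam i * (a i \<bullet> q)) + (\<Sum>i\<in>P2. mu i * (d i \<bullet> q))"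
          using v by (simp add: strict_multipliers_def multipliers_def inner_add_left inner_sum_left)
        also have "(\<Sum>i\<in>P2. mu i * (d i \<bullet> q)) = 0"
          using q unfolding G by simp
        also have "(\<Sum>i\<in>P1. lam i * (a i \<bullet> q)) = (\<Sum>i\<in>P1. lam i * (a j \<bullet> q))"
        proof (intro sum.cong refl)
          fix i assume "i \<in> P1"
          then have "a i \<bullet> q = a j \<bullet> q"
            using q P(1) j unfolding G by (meson order_antisym subsetD)
          then show "lam i * (a i \<bullet> q) = lam i * (a j \<bullet> q)" by simp
        qed
        also have "\<dots> = a j \<bullet> q"
          using v by (simp add: strict_multipliers_def multipliers_def sum_distrib_right[symmetric])
        finally show ?thesis by simp
      qed
      then show ?thesis
        using ub by (simp add: inner_diff_right inner_commute[of q])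
    qed
    ultimately show "(y, q) \<bullet> (z - (x, v)) \<le> 0 * (norm (z - (x, v)))\<^sup>2"
      by (simp add: zeq)
  qed
qed

text \<open>Two kinds of rays suffice. Moving \<open>x\<close> along a direction in \<G> keeps the
  support of \<open>v\<close> active. Moving \<open>v\<close> by \<open>a i - a j\<close>,
  \<open>d i\<close> or \<open>- d i\<close> keeps all weights nonnegative for a while, because
  those that decrease start out positive.\<close>

lemma regular_normal_gph_subdiffD:
  assumes x: "x \<in> D" and P: "P1 \<subseteq> K x" "P2 \<subseteq> I x"
    and v: "strict_multipliers a d P1 P2 v lam mu"
    and n: "(y, q) \<in> regular_normal_cone (x, v) (gph (subdiff \<theta>))"
  shows "y \<in> F_set a d P1 (K x) P2 (I x)" "q \<in> G_set a d P1 (K x) P2 (I x)"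
proof -
  note G = G_set_iff[OF P, of _ a d]
  have fin: "finite P1" "finite P2"
    using P by (auto intro: finite_subset)
  show "y \<in> F_set a d P1 (K x) P2 (I x)"
    unfolding F_set_iff[OF P finite_KI]
  proof
    fix h assume h: "h \<in> G_set a d P1 (K x) P2 (I x)"
    have "\<forall>\<^sub>F t in at_right 0. x + t *\<^sub>R h \<in> D"
      unfolding dom_iff
    proof (intro eventually_ball_finite ballI)
      fix j assume j: "j \<in> {1..p}"
      show "\<forall>\<^sub>F t in at_right 0. d j \<bullet> (x + t *\<^sub>R h) \<le> \<beta> j"
      proof (cases "j \<in> I x")
        case True
        then have "d j \<bullet> h \<le> 0"
          using h by (simp add: G)
        moreover have "\<forall>\<^sub>F t in at_right (0::real). 0 < t"
          by (rule eventually_at_right_less)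
        ultimately show ?thesis
          using True by (auto elim!: eventually_mono simp: I_iff inner_add_right mult_nonneg_nonpos)
      next
        case False
        then have "d j \<bullet> x < \<beta> j"
          using j x by (auto simp: I_iff dom_iff order_less_le)
        from eventually_affine_less[OF this, of "d j \<bullet> h" 0] show ?thesis
          by eventually_elim (simp add: inner_add_right)
      qed
    qed simp
    moreover have "\<forall>\<^sub>F t in at_right 0. \<forall>i\<in>{1..l}. \<forall>j\<in>P1. a i \<bullet> (x + t *\<^sub>R h) - \<alpha> i \<le> a j \<bullet> (x + t *\<^sub>R h) - \<alpha> j"
    proof (intro eventually_ball_finite ballI)
      fix i j assume i: "i \<in> {1..l}" and j: "j \<in> P1"
      then have Mj: "a j \<bullet> x - \<alpha> j = M x"
        using P(1) by (auto simp: K_iff)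
      show "\<forall>\<^sub>F t in at_right 0. a i \<bullet> (x + t *\<^sub>R h) - \<alpha> i \<le> a j \<bullet> (x + t *\<^sub>R h) - \<alpha> j"
      proof (cases "i \<in> K x")
        case True
        then have "a i \<bullet> h \<le> a j \<bullet> h"
          using h j by (simp add: G)
        moreover have "\<forall>\<^sub>F t in at_right (0::real). 0 < t"
          by (rule eventually_at_right_less)
        ultimately show ?thesis
          using True Mj by (auto elim!: eventually_mono simp: K_iff inner_add_right algebra_simps intro: mult_left_mono)
      next
        case False
        then have "a i \<bullet> x - \<alpha> i < a j \<bullet> x - \<alpha> j"
          using i M_ge[OF i, of x] Mj by (auto simp: K_iff order_less_le)
        from eventually_affine_less[OF this, of "a i \<bullet> h" "a j \<bullet> h"] show ?thesis
          by eventually_elim (simp add: inner_add_right)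
      qed
    qed (use fin in simp_all)
    ultimately have "\<forall>\<^sub>F t in at_right 0. (x, v) + t *\<^sub>R (h, 0) \<in> gph (subdiff \<theta>)"
    proof eventually_elim
      case (elim t)
      have "P1 \<subseteq> K (x + t *\<^sub>R h)"
      proof
        fix j assume j: "j \<in> P1"
        then have "M (x + t *\<^sub>R h) \<le> a j \<bullet> (x + t *\<^sub>R h) - \<alpha> j"
          using elim(2) by (auto simp: M_le_iff)
        moreover have "j \<in> {1..l}"
          using j P(1) by (auto simp: K_iff)
        ultimately show "j \<in> K (x + t *\<^sub>R h)"
          unfolding K_iff using M_ge[of j "x + t *\<^sub>R h"] by simp
      qed
      moreover have "P2 \<subseteq> I (x + t *\<^sub>R h)"
        using P(2) h by (auto simp: I_iff G inner_add_right subset_iff)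
      ultimately have "v \<in> face a d (K (x + t *\<^sub>R h)) (I (x + t *\<^sub>R h))"
        using strict_multipliers_face[OF v fin] face_mono by blast
      then show ?case
        using elim(1) by (simp add: gph_subdiff_iff)
    qed
    from regular_normal_ray[OF n this] show "y \<bullet> h \<le> 0"
      by simp
  qed
  have vf: "v \<in> face a d (K x) (I x)"
    using strict_multipliers_face[OF v fin] face_mono[OF P] by blast
  have q_le: "q \<bullet> k \<le> 0" if "\<forall>\<^sub>F t in at_right 0. v + t *\<^sub>R k \<in> face a d (K x) (I x)" for k
  proof -
    have "\<forall>\<^sub>F t in at_right 0. (x, v) + t *\<^sub>R (0, k) \<in> gph (subdiff \<theta>)"
      using that by eventually_elim (simp add: gph_subdiff_iff x)
    from regular_normal_ray[OF n this] show ?thesis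
      by simp
  qed
  have pos: "\<forall>\<^sub>F t in at_right (0::real). 0 < t"
    by (rule eventually_at_right_less)
  have less: "\<forall>\<^sub>F t in at_right (0::real). t < c" if "0 < c" for c
    using eventually_affine_less[OF that, of 1 0] by simp
  have veq: "v = (\<Sum>i\<in>P1. lam i *\<^sub>R a i) + (\<Sum>i\<in>P2. mu i *\<^sub>R d i)"
    and lm: "sum lam P1 = 1" "\<And>i. i \<in> P1 \<Longrightarrow> 0 < lam i" "\<And>i. i \<in> P2 \<Longrightarrow> 0 < mu i"
    using v by (auto simp: strict_multipliers_def multipliers_def)
  \<comment> \<open>Weights extended by zero, so that changes may also involve active indices
    outside the support.\<close>
  define lam' where "lam' i = (if i \<in> P1 then lam i else 0)" for i
  define mu' where "mu' i = (if i \<in> P2 then mu i else 0)" for i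
  have ext: "(\<Sum>i\<in>K x. lam' i *\<^sub>R a i) = (\<Sum>i\<in>P1. lam i *\<^sub>R a i)" "sum lam' (K x) = sum lam P1"
    "(\<Sum>i\<in>I x. mu' i *\<^sub>R d i) = (\<Sum>i\<in>P2. mu i *\<^sub>R d i)"
    using P by (auto simp: lam'_def mu'_def intro!: sum.mono_neutral_cong_right)
  have nn: "0 \<le> lam' i" "0 \<le> mu' i" for i
    using lm by (auto simp: lam'_def mu'_def intro: less_imp_le)
  \<comment> \<open>\<open>e\<close> and \<open>e'\<close> are rates of change of the weights; those
    of the convex part sum to zero. Below they shift weight from \<open>j\<close> to
    \<open>i\<close>, or alter a single \<open>mu\<close>.\<close>
  have faceI: "v + t *\<^sub>R k \<in> face a d (K x) (I x)"
    if "k = (\<Sum>i\<in>K x. e i *\<^sub>R a i) + (\<Sum>i\<in>I x. e' i *\<^sub>R d i)" "sum e (K x) = 0"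
      "\<forall>i\<in>K x. 0 \<le> lam' i + t * e i" "\<forall>i\<in>I x. 0 \<le> mu' i + t * e' i" for t k e e'
    unfolding face_iff_multipliers[OF finite_KI] multipliers_def
    using that lm(1)
    by (intro exI[of _ "\<lambda>i. lam' i + t * e i"] exI[of _ "\<lambda>i. mu' i + t * e' i"])
      (simp add: veq ext[symmetric] scaleR_left_distrib sum.distrib sum_distrib_left[symmetric]
        scaleR_right_distrib scaleR_right.sum)
  show "q \<in> G_set a d P1 (K x) P2 (I x)"
    unfolding G
  proof (intro conjI ballI)
    fix i j assume ij: "i \<in> K x" "j \<in> P1"
    then have "j \<in> K x" using P(1) by blast
    have "\<forall>\<^sub>F t in at_right 0. v + t *\<^sub>R (a i - a j) \<in> face a d (K x) (I x)"
      using pos less[OF lm(2)[OF ij(2)]]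
    proof eventually_elim
      case (elim t)
      show ?case
      proof (rule faceI[of _ "\<lambda>k. (if k = i then 1 else 0) - (if k = j then 1 else 0)" "\<lambda>_. 0"])
        show "\<forall>k\<in>K x. 0 \<le> lam' k + t * ((if k = i then 1 else 0) - (if k = j then 1 else 0))"
          using elim ij nn(1) by (auto simp: lam'_def[of j] add_nonneg_nonneg)
      qed (use ij \<open>j \<in> K x\<close> nn in \<open>auto simp: scaleR_left_diff_distrib sum_subtractf if_distrib[of "\<lambda>c. c *\<^sub>R _"] cong: if_cong\<close>)
    qed
    from q_le[OF this] show "a i \<bullet> q \<le> a j \<bullet> q"
      by (simp add: inner_diff_right inner_commute)
  next
    fix i assume i: "i \<in> I x"
    have "\<forall>\<^sub>F t in at_right 0. v + t *\<^sub>R d i \<in> face a d (K x) (I x)"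
      using pos
    proof eventually_elim
      case (elim t)
      show ?case
        by (rule faceI[of _ "\<lambda>_. 0" "\<lambda>k. if k = i then 1 else 0"])
          (use elim i nn in \<open>auto simp: if_distrib[of "\<lambda>c. c *\<^sub>R _"] cong: if_cong\<close>)
    qed
    from q_le[OF this] show "d i \<bullet> q \<le> 0"
      by (simp add: inner_commute)
  next
    fix i assume i: "i \<in> P2"
    then have "i \<in> I x" using P(2) by blast
    have "\<forall>\<^sub>F t in at_right 0. v + t *\<^sub>R (- d i) \<in> face a d (K x) (I x)"
      using pos less[OF lm(3)[OF i]]
    proof eventually_elim
      case (elim t)
      show ?case
      proof (rule faceI[of _ "\<lambda>_. 0" "\<lambda>k. if k = i then - 1 else 0"])
        show "\<forall>k\<in>I x. 0 \<le> mu' k + t * (if k = i then - 1 else 0)"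
          using elim i nn(2) by (auto simp: mu'_def[of i])
      qed (use \<open>i \<in> I x\<close> nn in \<open>auto simp: if_distrib[of "\<lambda>c. c *\<^sub>R _"] cong: if_cong\<close>)
    qed
    from q_le[OF this] have "0 \<le> d i \<bullet> q"
      by (simp add: inner_commute)
    moreover have "\<forall>\<^sub>F t in at_right 0. v + t *\<^sub>R d i \<in> face a d (K x) (I x)"
      using pos
    proof eventually_elim
      case (elim t)
      show ?case
        by (rule faceI[of _ "\<lambda>_. 0" "\<lambda>k. if k = i then 1 else 0"])
          (use elim \<open>i \<in> I x\<close> nn in \<open>auto simp: if_distrib[of "\<lambda>c. c *\<^sub>R _"] cong: if_cong\<close>)
    qed
    ultimately show "d i \<bullet> q = 0"
      using q_le[of "d i"] by (simp add: inner_commute)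
  qed
qed

text \<open>A witness \<open>z\<close> for \<A> may be far from \<open>x\<close>. Inside the segment
  every slack is a positive combination of those at the ends, and the active sets of
  \<open>z\<close> lie within those of \<open>x\<close>, so exactly these remain active.\<close>

lemma active_segment:
  assumes "x \<in> D" "z \<in> D" "K z \<subseteq> K x" "I z \<subseteq> I x" "0 < t" "t < 1"
  shows "x + t *\<^sub>R (z - x) \<in> D" "K (x + t *\<^sub>R (z - x)) = K z" "I (x + t *\<^sub>R (z - x)) = I z"
proof -
  let ?x = "x + t *\<^sub>R (z - x)"
  have seg: "c \<bullet> ?x - e = (1 - t) * (c \<bullet> x - e) + t * (c \<bullet> z - e)" for c e
    by (simp add: inner_add_right inner_diff_right algebra_simps)
  have dle: "(1 - t) * (d i \<bullet> x - \<beta> i) \<le> 0" "t * (d i \<bullet> z - \<beta> i) \<le> 0" if "i \<in> {1..p}" for i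
    using assms that by (auto simp: dom_iff mult_nonneg_nonpos)
  have "d i \<bullet> ?x - \<beta> i \<le> 0" if "i \<in> {1..p}" for i
    unfolding seg using dle[OF that] by linarith
  then show "?x \<in> D"
    by (simp add: dom_iff)
  have "i \<in> I ?x \<longleftrightarrow> i \<in> I z" for i
  proof
    assume i: "i \<in> I ?x"
    then have ip: "i \<in> {1..p}" and "(1 - t) * (d i \<bullet> x - \<beta> i) + t * (d i \<bullet> z - \<beta> i) = 0"
      unfolding seg[symmetric] by (auto simp: I_iff)
    then have "t * (d i \<bullet> z - \<beta> i) = 0"
      using dle[OF ip] by linarith
    then show "i \<in> I z"
      using ip assms(5) by (simp add: I_iff)
  next
    assume "i \<in> I z"
    moreover have "i \<in> I x"
      using \<open>i \<in> I z\<close> assms(4) by blast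
    ultimately have "d i \<bullet> ?x - \<beta> i = 0" "i \<in> {1..p}"
      unfolding seg by (simp_all add: I_iff)
    then show "i \<in> I ?x"
      by (simp add: I_iff)
  qed
  then show "I ?x = I z" by blast
  have ale: "(1 - t) * (a i \<bullet> x - \<alpha> i) \<le> (1 - t) * M x" "t * (a i \<bullet> z - \<alpha> i) \<le> t * M z"
    if "i \<in> {1..l}" for i
    using assms M_ge[OF that] by (auto intro!: mult_left_mono)
  have Kz: "a i \<bullet> ?x - \<alpha> i = (1 - t) * M x + t * M z" if "i \<in> K z" for i
    using that assms(3) unfolding seg by (auto simp: K_iff)
  have Mx: "M ?x = (1 - t) * M x + t * M z"
  proof (rule antisym)
    have "a i \<bullet> ?x - \<alpha> i \<le> (1 - t) * M x + t * M z" if "i \<in> {1..l}" for i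
      unfolding seg using ale[OF that] by linarith
    then show "M ?x \<le> (1 - t) * M x + t * M z"
      by (simp only: M_le_iff) blast
    obtain j where "j \<in> K z"
      using K_nonempty by blast
    then show "(1 - t) * M x + t * M z \<le> M ?x"
      using Kz[of j] M_ge[of j ?x] by (simp add: K_iff)
  qed
  have "i \<in> K ?x \<longleftrightarrow> i \<in> K z" for i
  proof
    assume i: "i \<in> K ?x"
    then have il: "i \<in> {1..l}"
      and "(1 - t) * (a i \<bullet> x - \<alpha> i) + t * (a i \<bullet> z - \<alpha> i) = (1 - t) * M x + t * M z"
      unfolding seg[symmetric] Mx[symmetric] by (auto simp: K_iff)
    then have "t * (a i \<bullet> z - \<alpha> i) = t * M z"
      using ale[OF il] by linarith
    then show "i \<in> K z"
      using il assms(5) by (simp add: K_iff)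
  next
    assume "i \<in> K z"
    then show "i \<in> K ?x"
      using Kz[of i] Mx by (simp add: K_iff)
  qed
  then show "K ?x = K z" by blast
qed

text \<open>Two perturbations reach a point whose regular normals are given by the prescribed sets:
  \<open>x\<close> moves towards the witness to get the active sets \<open>Q1\<close>,
  \<open>Q2\<close>, and \<open>v\<close> moves inside its face to get full support
  \<open>P1\<close>, \<open>P2\<close>. The normal \<open>(y, q)\<close> stays fixed.\<close>

lemma limiting_normal_gph_subdiffI:
  assumes x: "x \<in> D" and A: "(P1, Q1, P2, Q2) \<in> A_set \<theta> l a \<alpha> p d \<beta> x v"
    and "y \<in> F_set a d P1 Q1 P2 Q2" "q \<in> G_set a d P1 Q1 P2 Q2"
  shows "(y, q) \<in> limiting_normal_cone (x, v) (gph (subdiff \<theta>))"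
proof (rule limiting_normal_coneI)
  fix \<epsilon> :: real assume "0 < \<epsilon>"
  obtain z where z: "z \<in> D" "K z = Q1" "I z = Q2"
    and PQ: "P1 \<subseteq> Q1" "Q1 \<subseteq> K x" "P2 \<subseteq> Q2" "Q2 \<subseteq> I x" and v: "v \<in> face a d P1 P2"
    using A unfolding A_set_def face_def by blast
  have fin: "finite P1" "finite P2"
    using z PQ by (auto intro: finite_subset)
  define t where "t = min (1 / 2) (\<epsilon> / 2 / (norm (z - x) + 1))"
  have *: "0 < norm (z - x) + 1"
    by (simp add: add_nonneg_pos)
  have t: "0 < t" "t < 1"
    using \<open>0 < \<epsilon>\<close> * by (auto simp: t_def)
  have "t \<le> \<epsilon> / 2 / (norm (z - x) + 1)"
    unfolding t_def by (rule min.cobounded2)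
  then have "t * (norm (z - x) + 1) \<le> \<epsilon> / 2"
    using pos_le_divide_eq[OF *] by blast
  then have tz: "t * norm (z - x) < \<epsilon> / 2"
    using t(1) by (simp add: algebra_simps)
  define x' where "x' = x + t *\<^sub>R (z - x)"
  have x': "x' \<in> D" "K x' = Q1" "I x' = Q2"
    using active_segment[OF x z(1) _ _ t] z PQ by (auto simp: x'_def)
  obtain v' lam mu where v': "dist v' v < \<epsilon> / 2" "strict_multipliers a d P1 P2 v' lam mu"
    using face_strict_approx[OF fin v, of "\<epsilon> / 2"] \<open>0 < \<epsilon>\<close> by auto
  have "(y, q) \<in> regular_normal_cone (x', v') (gph (subdiff \<theta>))"
    using regular_normal_gph_subdiffI[OF x'(1) _ _ v'(2)] assms(3,4) PQ x' by simp
  moreover have "(x', v') \<in> gph (subdiff \<theta>)"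
    unfolding gph_subdiff_iff x'(2,3)
    using x'(1) strict_multipliers_face[OF v'(2) fin] face_mono[OF PQ(1,3)] by blast
  moreover have "dist (x', v') (x, v) < \<epsilon>"
  proof -
    have "dist (x', v') (x, v) \<le> dist x' x + dist v' v"
      unfolding dist_norm by (simp add: norm_Pair_le)
    then show ?thesis
      using v'(1) tz t(1) by (simp add: x'_def dist_norm)
  qed
  ultimately show "\<exists>y'\<in>gph (subdiff \<theta>). \<exists>v'\<in>regular_normal_cone y' (gph (subdiff \<theta>)).
      dist y' (x, v) < \<epsilon> \<and> dist v' (y, q) < \<epsilon>"
    using \<open>0 < \<epsilon>\<close> by (metis dist_self)
qed

text \<open>There are finitely many quadruples of supports and active sets, so one recurs infinitely
  often along the sequence. Its face, \<F> and \<G> are closed and therefore contain the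
  limits.\<close>

lemma limiting_normal_gph_subdiffD:
  assumes x: "x \<in> D" and n: "(y, q) \<in> limiting_normal_cone (x, v) (gph (subdiff \<theta>))"
  obtains P1 Q1 P2 Q2 where "(P1, Q1, P2, Q2) \<in> A_set \<theta> l a \<alpha> p d \<beta> x v"
    "y \<in> F_set a d P1 Q1 P2 Q2" "q \<in> G_set a d P1 Q1 P2 Q2"
proof -
  obtain zs ns where zs: "\<And>k::nat. zs k \<in> gph (subdiff \<theta>)" "\<And>k. ns k \<in> regular_normal_cone (zs k) (gph (subdiff \<theta>))"
    "zs \<longlonglongrightarrow> (x, v)" "ns \<longlonglongrightarrow> (y, q)"
    using n unfolding limiting_normal_cone_def by blast
  define xs where "xs k = fst (zs k)" for k
  define vs where "vs k = snd (zs k)" for k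
  have xs: "xs \<longlonglongrightarrow> x" and vs: "vs \<longlonglongrightarrow> v"
    using tendsto_fst[OF zs(3)] tendsto_snd[OF zs(3)] by (simp_all add: xs_def[abs_def] vs_def[abs_def])
  have D: "xs k \<in> D" and face: "vs k \<in> face a d (K (xs k)) (I (xs k))" for k
    using zs(1)[of k] gph_subdiff_iff[of "xs k" "vs k"] by (simp_all add: xs_def vs_def)
  have "\<exists>P1 P2. P1 \<subseteq> K (xs k) \<and> P2 \<subseteq> I (xs k) \<and> vs k \<in> face a d P1 P2 \<and>
      fst (ns k) \<in> F_set a d P1 (K (xs k)) P2 (I (xs k)) \<and> snd (ns k) \<in> G_set a d P1 (K (xs k)) P2 (I (xs k))" for k
  proof -
    obtain lam mu where lm: "multipliers a d (K (xs k)) (I (xs k)) (vs k) lam mu"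
      using face[of k] face_iff_multipliers[OF finite_KI] by blast
    define P1 where "P1 = pos_support (K (xs k)) lam"
    define P2 where "P2 = pos_support (I (xs k)) mu"
    have P: "P1 \<subseteq> K (xs k)" "P2 \<subseteq> I (xs k)"
      by (auto simp: P1_def P2_def pos_support_def)
    have sm: "strict_multipliers a d P1 P2 (vs k) lam mu"
      unfolding P1_def P2_def using lm by (rule multipliers_support[OF finite_KI])
    moreover have "vs k \<in> face a d P1 P2"
      using sm P by (intro strict_multipliers_face) (auto intro: finite_subset)
    moreover have "(fst (ns k), snd (ns k)) \<in> regular_normal_cone (xs k, vs k) (gph (subdiff \<theta>))"
      using zs(2)[of k] by (simp add: xs_def vs_def)
    ultimately show ?thesis
      using regular_normal_gph_subdiffD[OF D P sm] P by blast
  qed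
  then obtain p1 p2 where P: "\<And>k. p1 k \<subseteq> K (xs k)" "\<And>k. p2 k \<subseteq> I (xs k)" "\<And>k. vs k \<in> face a d (p1 k) (p2 k)"
    "\<And>k. fst (ns k) \<in> F_set a d (p1 k) (K (xs k)) (p2 k) (I (xs k))"
    "\<And>k. snd (ns k) \<in> G_set a d (p1 k) (K (xs k)) (p2 k) (I (xs k))"
    by metis
  define idx where "idx k = (p1 k, K (xs k), p2 k, I (xs k))" for k
  define X where "X = Pow {1..l} \<times> Pow {1..l} \<times> Pow {1..p} \<times> Pow {1..p}"
  have KI: "K z \<subseteq> {1..l}" "I z \<subseteq> {1..p}" for z
    by (auto simp: K_iff I_iff)
  have "idx k \<in> X" for k
    using P(1)[of k] P(2)[of k] KI[of "xs k"] by (auto simp: idx_def X_def)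
  moreover have "finite X"
    by (simp add: X_def)
  ultimately have "\<exists>c\<in>X. \<exists>\<^sub>F k in sequentially. idx k = c"
  proof (rule_tac ccontr)
    assume "finite X" "\<And>k. idx k \<in> X" "\<not> (\<exists>c\<in>X. \<exists>\<^sub>F k in sequentially. idx k = c)"
    then have "\<forall>\<^sub>F k in sequentially. \<forall>c\<in>X. idx k \<noteq> c"
      by (intro eventually_ball_finite) (auto simp: not_frequently)
    then show False
      using \<open>\<And>k. idx k \<in> X\<close> eventually_happens'[OF sequentially_bot] by blast
  qed
  then obtain P1 Q1 P2 Q2 where freq: "\<exists>\<^sub>F k in sequentially. idx k = (P1, Q1, P2, Q2)"
    by (metis prod_cases4)
  have "\<forall>\<^sub>F k in sequentially. K (xs k) \<subseteq> K x \<and> I (xs k) \<subseteq> I x"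
    using eventually_active_subset[OF x] xs by (rule eventually_compose_filterlim)
  then have "\<exists>\<^sub>F k in sequentially. idx k = (P1, Q1, P2, Q2) \<and> K (xs k) \<subseteq> K x \<and> I (xs k) \<subseteq> I x"
    using frequently_eventually_frequently[OF freq] by blast
  then obtain k where k: "idx k = (P1, Q1, P2, Q2)" "K (xs k) \<subseteq> K x" "I (xs k) \<subseteq> I x"
    using frequently_ex by blast
  have sub: "P1 \<subseteq> Q1" "P2 \<subseteq> Q2" "Q1 \<subseteq> K x" "Q2 \<subseteq> I x"
    using k P(1)[of k] P(2)[of k] by (auto simp: idx_def)
  then have fin: "finite Q1" "finite Q2" "finite P1" "finite P2"
    by (meson finite_KI finite_subset)+
  have lim: "g \<in> C" if "f \<longlonglongrightarrow> g" "closed C" "\<And>k. idx k = (P1, Q1, P2, Q2) \<Longrightarrow> f k \<in> C"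
    for f :: "nat \<Rightarrow> 'a" and g C
  proof (rule ccontr)
    assume "g \<notin> C"
    then have "\<forall>\<^sub>F k in sequentially. f k \<in> - C"
      using that(1,2) by (intro topological_tendstoD) auto
    then have "\<exists>\<^sub>F k in sequentially. idx k = (P1, Q1, P2, Q2) \<and> f k \<in> - C"
      using frequently_eventually_frequently[OF freq] by blast
    then show False
      using that(3) frequently_ex by blast
  qed
  have "v \<in> face a d P1 P2"
    by (rule lim[OF vs closed_face[OF fin(3,4)]]) (use P(3) in \<open>auto simp: idx_def\<close>)
  moreover have "y \<in> F_set a d P1 Q1 P2 Q2"
    by (rule lim[OF tendsto_fst[OF zs(4), simplified] closed_F_set[OF sub(1,2) fin(1,2)]])
      (use P(4) in \<open>auto simp: idx_def\<close>)
  moreover have "q \<in> G_set a d P1 Q1 P2 Q2"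
    by (rule lim[OF tendsto_snd[OF zs(4), simplified] closed_G_set[OF sub(1,2)]])
      (use P(5) in \<open>auto simp: idx_def\<close>)
  \<comment> \<open>A term of the sequence itself witnesses that these active sets occur.\<close>
  moreover have "\<exists>z\<in>D. K z = Q1 \<and> I z = Q2"
    using D[of k] k(1) by (auto simp: idx_def)
  ultimately show thesis
    using that[of P1 Q1 P2 Q2] sub by (auto simp: A_set_def face_def)
qed

end

section \<open>Affine independence\<close>

text \<open>The difference of two multiplier systems is a linear relation among the lifted vectors:
  the weights on \<open>K\<close> have equal sums, which is what the extra coordinate 1
  records.\<close>

lemma AICQ_unique:
  assumes "AICQ a d K I" "finite K" "finite I"
    and "multipliers a d K I v lam mu" "multipliers a d K I v lam' mu'"
  shows "\<forall>i\<in>K. lam i = lam' i" "\<forall>i\<in>I. mu i = mu' i"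
proof -
  define g where "g = case_sum (\<lambda>i. (a i, 1::real)) (\<lambda>t. (d t, 0))"
  have g: "inj_on g (K <+> I)" "independent (g ` (K <+> I))"
    using assms(1) unfolding AICQ_def g_def Let_def by blast+
  define c where "c = case_sum (\<lambda>i. lam i - lam' i) (\<lambda>i. mu i - mu' i)"
  have fin: "finite (K <+> I)"
    using assms(2,3) by simp
  have "(\<Sum>s\<in>K <+> I. c s *\<^sub>R g s) =
      (\<Sum>i\<in>K. (lam i - lam' i) *\<^sub>R (a i, 1)) + (\<Sum>i\<in>I. (mu i - mu' i) *\<^sub>R (d i, 0))"
    using assms(2,3) by (simp add: sum.Plus c_def g_def)
  also have "\<dots> = 0"
  proof (rule prod_eqI)
    show "fst ((\<Sum>i\<in>K. (lam i - lam' i) *\<^sub>R (a i, 1::real)) + (\<Sum>i\<in>I. (mu i - mu' i) *\<^sub>R (d i, 0))) = fst 0"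
    proof -
      have "(\<Sum>i\<in>K. lam i *\<^sub>R a i) + (\<Sum>i\<in>I. mu i *\<^sub>R d i) =
          (\<Sum>i\<in>K. lam' i *\<^sub>R a i) + (\<Sum>i\<in>I. mu' i *\<^sub>R d i)"
        using assms(4,5) unfolding multipliers_def by metis
      then show ?thesis
        by (simp add: fst_sum scaleR_left_diff_distrib sum_subtractf algebra_simps)
    qed
    show "snd ((\<Sum>i\<in>K. (lam i - lam' i) *\<^sub>R (a i, 1::real)) + (\<Sum>i\<in>I. (mu i - mu' i) *\<^sub>R (d i, 0))) = snd 0"
      using assms(4,5) by (simp add: multipliers_def snd_sum sum_subtractf)
  qed
  \<comment> \<open>Injectivity of the family turns the sum over indices into a sum over the
    independent set of vectors.\<close>
  finally have *: "(\<Sum>w\<in>g ` (K <+> I). c (inv_into (K <+> I) g w) *\<^sub>R w) = 0"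
    using g(1) by (simp add: sum.reindex)
  have "c (inv_into (K <+> I) g (g s)) = 0" if "s \<in> K <+> I" for s
    using independentD[OF g(2) finite_imageI[OF fin] order_refl *, of "g s"] that by simp
  then have c0: "c s = 0" if "s \<in> K <+> I" for s
    using that g(1) by simp
  show "\<forall>i\<in>K. lam i = lam' i" "\<forall>i\<in>I. mu i = mu' i"
    using c0[of "Inl _"] c0[of "Inr _"] by (auto simp: c_def)
qed

text \<open>A linear functional may take prescribed values on an independent family: here 0 on the
  chosen indices and -1 on the others. Its coefficient on the last coordinate is
  \<open>- c\<close>.\<close>

lemma AICQ_separating_direction:
  fixes a d :: "nat \<Rightarrow> 'a::euclidean_space"
  assumes "AICQ a d K I" "Q1 \<subseteq> K" "Q2 \<subseteq> I"
  obtains h c where "\<And>i. i \<in> Q1 \<Longrightarrow> a i \<bullet> h = c" "\<And>i. i \<in> K - Q1 \<Longrightarrow> a i \<bullet> h < c"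
    "\<And>i. i \<in> Q2 \<Longrightarrow> d i \<bullet> h = 0" "\<And>i. i \<in> I - Q2 \<Longrightarrow> d i \<bullet> h < 0"
proof -
  define g where "g = case_sum (\<lambda>i. (a i, 1::real)) (\<lambda>t. (d t, 0))"
  have g: "inj_on g (K <+> I)" "independent (g ` (K <+> I))"
    using assms(1) unfolding AICQ_def g_def Let_def by blast+
  define r where "r = case_sum (\<lambda>i. if i \<in> Q1 then 0 else - 1) (\<lambda>i. if i \<in> Q2 then 0 else - 1 :: real)"
  obtain \<phi> where \<phi>: "linear \<phi>" "\<And>w. w \<in> g ` (K <+> I) \<Longrightarrow> \<phi> w = r (inv_into (K <+> I) g w)"
    using linear_independent_extend[OF g(2), of "\<lambda>w. r (inv_into (K <+> I) g w)"] by blast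
  obtain h e where he: "adjoint \<phi> 1 = (h, e)"
    by (cases "adjoint \<phi> 1")
  have \<phi>_eq: "\<phi> (x, s) = x \<bullet> h + s * e" for x s
    using adjoint_works[OF \<phi>(1), of "(x, s)" 1] by (simp add: he)
  have \<phi>_g: "\<phi> (g s) = r s" if "s \<in> K <+> I" for s
    using \<phi>(2)[of "g s"] that by (simp add: inv_into_f_f[OF g(1)])
  have "a i \<bullet> h + e = r (Inl i)" if "i \<in> K" for i
    using \<phi>_g[of "Inl i"] that by (simp add: g_def \<phi>_eq InlI)
  moreover have "d i \<bullet> h = r (Inr i)" if "i \<in> I" for i
    using \<phi>_g[of "Inr i"] that by (simp add: g_def \<phi>_eq InrI)
  ultimately show thesis
    using assms(2,3) by (intro that[of h "- e"]) (force simp: r_def)+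
qed

text \<open>Nonemptiness of \<open>J1\<close> makes \<open>I01\<close> and \<open>Igt1\<close>
  disjoint, so the set difference inside \<F> returns \<open>Igt1\<close>.\<close>

lemma C_set_eq_F_set:
  assumes "J1 \<noteq> {}"
  shows "C_set a d K I J1 u = F_set a d (I01 a K J1 u) (I01 a K J1 u \<union> Igt1 a K J1 u)
    (I02 d I u) (I02 d I u \<union> Igt2 d I u)"
proof -
  have "(I01 a K J1 u \<union> Igt1 a K J1 u) - I01 a K J1 u = Igt1 a K J1 u"
    using assms unfolding I01_def Igt1_def by fastforce
  moreover have "(I02 d I u \<union> Igt2 d I u) - I02 d I u = Igt2 d I u"
    unfolding I02_def Igt2_def by fastforce
  ultimately show ?thesis
    by (simp only: C_set_def F_set_def)
qed

section \<open>Normals under AICQ\<close>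

context pl_function
begin

text \<open>Step from \<open>x\<close> along the separating direction: the pieces in
  \<open>Q1\<close> change at the common rate \<open>c\<close>, the other active ones at a smaller
  rate, and the inactive ones do not catch up. Some piece is always maximal, hence the nonempty
  \<open>Q1\<close>.\<close>

lemma AICQ_realizes_active_sets:
  assumes x: "x \<in> D" and "AICQ a d (K x) (I x)" and Q: "Q1 \<subseteq> K x" "Q2 \<subseteq> I x" "Q1 \<noteq> {}"
  shows "\<exists>z\<in>D. K z = Q1 \<and> I z = Q2"
proof -
  obtain h c where h: "\<And>i. i \<in> Q1 \<Longrightarrow> a i \<bullet> h = c" "\<And>i. i \<in> K x - Q1 \<Longrightarrow> a i \<bullet> h < c"
    "\<And>i. i \<in> Q2 \<Longrightarrow> d i \<bullet> h = 0" "\<And>i. i \<in> I x - Q2 \<Longrightarrow> d i \<bullet> h < 0"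
    using AICQ_separating_direction[OF assms(2) Q(1,2)] by metis
  have pos: "\<forall>\<^sub>F t in at_right (0::real). 0 < t"
    by (rule eventually_at_right_less)
  have "\<forall>\<^sub>F t in at_right 0. \<forall>i\<in>{1..l} - Q1. a i \<bullet> (x + t *\<^sub>R h) - \<alpha> i < M x + t * c"
  proof (intro eventually_ball_finite ballI)
    fix i assume i: "i \<in> {1..l} - Q1"
    show "\<forall>\<^sub>F t in at_right 0. a i \<bullet> (x + t *\<^sub>R h) - \<alpha> i < M x + t * c"
    proof (cases "i \<in> K x")
      case True
      then have "a i \<bullet> h < c"
        using h(2) i by simp
      then show ?thesis
        using pos True by (auto elim!: eventually_mono simp: K_iff inner_add_right algebra_simps)
    next
      case False
      then have "a i \<bullet> x - \<alpha> i < M x"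
        using i M_ge[of i x] by (auto simp: K_iff order_less_le)
      from eventually_affine_less[OF this, of "a i \<bullet> h" c] show ?thesis
        by eventually_elim (simp add: inner_add_right)
    qed
  qed simp
  moreover have "\<forall>\<^sub>F t in at_right 0. \<forall>i\<in>{1..p} - Q2. d i \<bullet> (x + t *\<^sub>R h) < \<beta> i"
  proof (intro eventually_ball_finite ballI)
    fix i assume i: "i \<in> {1..p} - Q2"
    show "\<forall>\<^sub>F t in at_right 0. d i \<bullet> (x + t *\<^sub>R h) < \<beta> i"
    proof (cases "i \<in> I x")
      case True
      then have "d i \<bullet> h < 0"
        using h(4) i by simp
      then show ?thesis
        using pos True by (auto elim!: eventually_mono simp: I_iff inner_add_right mult_pos_neg)
    next
      case False
      then have "d i \<bullet> x < \<beta> i"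
        using i x by (auto simp: I_iff dom_iff order_less_le)
      from eventually_affine_less[OF this, of "d i \<bullet> h" 0] show ?thesis
        by eventually_elim (simp add: inner_add_right)
    qed
  qed simp
  ultimately have "\<forall>\<^sub>F t in at_right 0. (\<forall>i\<in>{1..l} - Q1. a i \<bullet> (x + t *\<^sub>R h) - \<alpha> i < M x + t * c) \<and>
      (\<forall>i\<in>{1..p} - Q2. d i \<bullet> (x + t *\<^sub>R h) < \<beta> i)"
    by (rule eventually_conj)
  then obtain t where t: "\<And>i. i \<in> {1..l} - Q1 \<Longrightarrow> a i \<bullet> (x + t *\<^sub>R h) - \<alpha> i < M x + t * c"
    "\<And>i. i \<in> {1..p} - Q2 \<Longrightarrow> d i \<bullet> (x + t *\<^sub>R h) < \<beta> i"
    using eventually_happens'[OF trivial_limit_at_right_real] by blast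
  define z where "z = x + t *\<^sub>R h"
  have Q1: "i \<in> {1..l}" "a i \<bullet> z - \<alpha> i = M x + t * c" if "i \<in> Q1" for i
    using that Q(1) h(1) by (auto simp: K_iff z_def inner_add_right)
  have Q2: "i \<in> {1..p}" "d i \<bullet> z = \<beta> i" if "i \<in> Q2" for i
    using that Q(2) h(3) by (auto simp: I_iff z_def inner_add_right)
  have Mz: "M z = M x + t * c"
  proof (rule antisym)
    have "a i \<bullet> z - \<alpha> i \<le> M x + t * c" if "i \<in> {1..l}" for i
      using that t(1)[of i] Q1(2)[of i] by (cases "i \<in> Q1") (auto simp: z_def)
    then show "M z \<le> M x + t * c"
      by (simp only: M_le_iff) blast
    show "M x + t * c \<le> M z"
      using Q(3) Q1 M_ge[of _ z] by fastforce
  qed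
  have "K z = Q1"
    using Q1 t(1) unfolding z_def[symmetric] set_eq_iff K_iff Mz by (metis DiffI less_irrefl)
  moreover have "I z = Q2"
    using Q2 t(2) unfolding z_def[symmetric] set_eq_iff I_iff by (metis DiffI less_irrefl)
  moreover have "z \<in> D"
    using Q2 t(2) unfolding z_def[symmetric] dom_iff by (metis DiffI less_imp_le order_refl)
  ultimately show ?thesis by blast
qed

text \<open>Uniqueness forces \<open>J1 \<subseteq> P1\<close> and \<open>J2 \<subseteq> P2\<close>
  for every member of \<A>. The sign conditions on \<open>u\<close> then confine all four index sets
  to those read off from \<open>u\<close>, and more generators give a larger \<F>. Conversely the
  sets read off from \<open>u\<close> form a member of \<A>, since their active sets are
  realized.\<close>

lemma AICQ_normals_iff:
  assumes x: "x \<in> D" and aicq: "AICQ a d (K x) (I x)"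
    and m: "multipliers a d (K x) (I x) v lam mu"
    and J: "J1 = pos_support (K x) lam" "J2 = pos_support (I x) mu"
  shows "(\<exists>P1 Q1 P2 Q2. (P1, Q1, P2, Q2) \<in> A_set \<theta> l a \<alpha> p d \<beta> x v \<and>
      y \<in> F_set a d P1 Q1 P2 Q2 \<and> - u \<in> G_set a d P1 Q1 P2 Q2) \<longleftrightarrow>
    - u \<in> G_set a d J1 J1 J2 J2 \<and> y \<in> C_set a d (K x) (I x) J1 u" (is "?L \<longleftrightarrow> ?R")
proof -
  define P where "P = I01 a (K x) J1 u"
  define P' where "P' = I02 d (I x) u"
  define Q where "Q = P \<union> Igt1 a (K x) J1 u"
  define Q' where "Q' = P' \<union> Igt2 d (I x) u"
  have sm: "strict_multipliers a d J1 J2 v lam mu"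
    unfolding J using multipliers_support[OF finite_KI m] .
  have sub: "J1 \<subseteq> K x" "J2 \<subseteq> I x" "P \<subseteq> K x" "P' \<subseteq> I x" "Q \<subseteq> K x" "Q' \<subseteq> I x" "P \<subseteq> Q" "P' \<subseteq> Q'"
    unfolding J pos_support_def P_def Q_def P'_def Q'_def I01_def Igt1_def I02_def Igt2_def by blast+
  obtain j where j: "j \<in> J1"
    using sm by (force simp: strict_multipliers_def multipliers_def)
  have C: "C_set a d (K x) (I x) J1 u = F_set a d P Q P' Q'"
    unfolding P_def Q_def P'_def Q'_def using j by (intro C_set_eq_F_set) auto
  have GJ: "- u \<in> G_set a d J1 J1 J2 J2 \<longleftrightarrow> (\<forall>i\<in>J1. \<forall>j\<in>J1. a i \<bullet> u = a j \<bullet> u) \<and> (\<forall>i\<in>J2. d i \<bullet> u = 0)"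
    by (auto simp: G_set_def inner_diff_left)
  show ?thesis
  proof
    assume R: ?R
    then have "\<forall>i\<in>J1. \<forall>k\<in>J1. (a i - a k) \<bullet> u = 0" "\<forall>i\<in>J2. d i \<bullet> u = 0"
      unfolding GJ inner_diff_left right_minus_eq by blast+
    then have JP: "J1 \<subseteq> P" "J2 \<subseteq> P'"
      using sub(1,2) unfolding P_def P'_def I01_def I02_def by blast+
    have "v \<in> face a d J1 J2"
      using sm by (rule strict_multipliers_face) (use sub in \<open>auto intro: finite_subset\<close>)
    then have "v \<in> face a d P P'"
      using face_mono[OF JP] by blast
    moreover have "\<exists>z\<in>D. K z = Q \<and> I z = Q'"
      using x aicq sub(5,6) by (rule AICQ_realizes_active_sets) (use JP sub j in auto)
    ultimately have "(P, Q, P', Q') \<in> A_set \<theta> l a \<alpha> p d \<beta> x v"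
      unfolding A_set_def face_def[symmetric] using sub by blast
    moreover have "- u \<in> G_set a d P Q P' Q'"
      unfolding G_set_iff[OF sub(7,8)]
    proof (intro conjI ballI)
      fix i k assume "i \<in> Q" "k \<in> P"
      have "a k \<bullet> u = a j \<bullet> u"
        using \<open>k \<in> P\<close> j by (simp add: P_def I01_def inner_diff_left)
      moreover have "a j \<bullet> u \<le> a i \<bullet> u"
        using \<open>i \<in> Q\<close> j by (auto simp: Q_def P_def I01_def Igt1_def inner_diff_left intro: less_imp_le)
      ultimately show "a i \<bullet> (- u) \<le> a k \<bullet> (- u)"
        by simp
    qed (auto simp: Q'_def P'_def I02_def Igt2_def)
    ultimately show ?L
      using R C by blast
  next
    assume ?L
    then obtain P1 Q1 P2 Q2 where A: "(P1, Q1, P2, Q2) \<in> A_set \<theta> l a \<alpha> p d \<beta> x v"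
      and y: "y \<in> F_set a d P1 Q1 P2 Q2" and u: "- u \<in> G_set a d P1 Q1 P2 Q2"
      by blast
    have PQ: "P1 \<subseteq> Q1" "P2 \<subseteq> Q2" "Q1 \<subseteq> K x" "Q2 \<subseteq> I x" and "v \<in> face a d P1 P2"
      using A unfolding A_set_def face_def by blast+
    have PK: "P1 \<subseteq> K x" "P2 \<subseteq> I x"
      using PQ by auto
    have "finite P1" "finite P2"
      using PK by (auto intro: finite_subset)
    then obtain lam' mu' where m': "multipliers a d P1 P2 v lam' mu'"
      using \<open>v \<in> face a d P1 P2\<close> face_iff_multipliers by blast
    \<comment> \<open>Extended by zero these are multipliers on all of \<open>K x\<close> and
      \<open>I x\<close>, hence equal to \<open>lam\<close> and \<open>mu\<close> there; so the
      positive weights sit inside \<open>P1\<close> and \<open>P2\<close>.\<close>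
    define lam'' where "lam'' i = (if i \<in> P1 then lam' i else 0)" for i
    define mu'' where "mu'' i = (if i \<in> P2 then mu' i else 0)" for i
    have "(\<Sum>i\<in>K x. lam'' i *\<^sub>R a i) = (\<Sum>i\<in>P1. lam' i *\<^sub>R a i)" "sum lam'' (K x) = sum lam' P1"
      "(\<Sum>i\<in>I x. mu'' i *\<^sub>R d i) = (\<Sum>i\<in>P2. mu' i *\<^sub>R d i)"
      using PK by (auto simp: lam''_def mu''_def intro!: sum.mono_neutral_cong_right)
    then have "multipliers a d (K x) (I x) v lam'' mu''"
      using m' by (simp add: multipliers_def lam''_def mu''_def)
    from AICQ_unique[OF aicq finite_KI m this]
    have JP: "J1 \<subseteq> P1" "J2 \<subseteq> P2"
      by (auto simp: J pos_support_def lam''_def mu''_def split: if_splits)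
    have uG: "\<And>i k. \<lbrakk>i \<in> Q1; k \<in> P1\<rbrakk> \<Longrightarrow> a k \<bullet> u \<le> a i \<bullet> u" "\<And>i. i \<in> Q2 \<Longrightarrow> 0 \<le> d i \<bullet> u"
      "\<And>i. i \<in> P2 \<Longrightarrow> d i \<bullet> u = 0"
      using u unfolding G_set_iff[OF PQ(1,2)] by auto
    have eq: "a i \<bullet> u = a k \<bullet> u" if "i \<in> P1" "k \<in> P1" for i k
      using uG(1) that PQ(1) by (meson order_antisym subsetD)
    then have eq0: "(a i - a k) \<bullet> u = 0" if "i \<in> P1" "k \<in> P1" for i k
      unfolding inner_diff_left right_minus_eq using that by blast
    have "- u \<in> G_set a d J1 J1 J2 J2"
      unfolding GJ using eq uG(3) JP by blast
    moreover have "P1 \<subseteq> P"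
      unfolding P_def I01_def using eq0 JP PK by blast
    moreover have "P2 \<subseteq> P'"
      using uG(3) PK by (auto simp: P'_def I02_def)
    moreover have "Q1 \<subseteq> Q"
    proof
      fix i assume i: "i \<in> Q1"
      \<comment> \<open>The inner products with \<open>u\<close> agree on \<open>J1\<close>, so the
        comparison with the single \<open>j\<close> decides between \<open>I01\<close> and
        \<open>Igt1\<close>.\<close>
      have *: "(a i - a k) \<bullet> u = (a i - a j) \<bullet> u" if "k \<in> J1" for k
        using eq[of k j] that j JP by (auto simp: inner_diff_left)
      have "0 \<le> (a i - a j) \<bullet> u"
        using uG(1)[OF i, of j] j JP by (auto simp: inner_diff_left)
      then consider "(a i - a j) \<bullet> u = 0" | "0 < (a i - a j) \<bullet> u"
        by linarith
      then show "i \<in> Q"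
        using i PQ(3) * unfolding Q_def P_def I01_def Igt1_def by cases auto
    qed
    moreover have "Q2 \<subseteq> Q'"
      using uG(2) PQ(4) by (force simp: Q'_def P'_def I02_def Igt2_def)
    ultimately have "F_set a d P1 Q1 P2 Q2 \<subseteq> F_set a d P Q P' Q'"
      unfolding F_set_eq_hull[OF PQ(1,2)] F_set_eq_hull[OF sub(7,8)]
      by (intro hull_mono) (unfold cone_generators_def, blast)
    then show ?R
      using y \<open>- u \<in> G_set a d J1 J1 J2 J2\<close> C by blast
  qed
qed

end

section \<open>Stability of the solution map\<close>

text \<open>With equal index sets only equations remain, so the set is a subspace; under AICQ it is
  the domain of the second-order subdifferential.\<close>

lemma uminus_mem_G_set_iff: "- u \<in> G_set a d J1 J1 J2 J2 \<longleftrightarrow> u \<in> G_set a d J1 J1 J2 J2"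
  by (simp add: G_set_def)

theorem theorem4p1:
  fixes \<theta> :: "real ^ 'n \<Rightarrow> ereal"
    and l p :: nat
    and a d :: "nat \<Rightarrow> real ^ 'n"
    and \<alpha> \<beta> :: "nat \<Rightarrow> real"
    and f :: "(real ^ 'n) \<times> (real ^ 'd) \<Rightarrow> real ^ 'n"
    and S :: "real ^ 'd \<Rightarrow> (real ^ 'n) set"
    and xb vb :: "real ^ 'n"
    and wb :: "real ^ 'd"
    and K I :: "nat set"
    and \<A> :: "(nat set \<times> nat set \<times> nat set \<times> nat set) set"
  assumes pl: "convex_pl \<theta> l a \<alpha> p d \<beta>"
    and S: "S = solution_map f \<theta>"
    and gph: "(wb, xb) \<in> gph S"
    and strict: "strictly_differentiable_at f (xb, wb)"
    and surj: "surj (partial_w f xb wb)"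
    and vb: "vb = - f (xb, wb)"
    and K: "K = active_max l a \<alpha> xb"
    and I: "I = active_con p d \<beta> xb"
    and A: "\<A> = A_set \<theta> l a \<alpha> p d \<beta> xb vb"
  shows
    "(lipschitz_like S wb xb \<longleftrightarrow>
        (\<forall>(P1, Q1, P2, Q2)\<in>\<A>. \<forall>u.
           - adjoint (partial_x f xb wb) u \<in> F_set a d P1 Q1 P2 Q2 \<and> - u \<in> G_set a d P1 Q1 P2 Q2
             \<longrightarrow> u = 0)) \<and>
     lip_bound S wb xb =
       Sup {ereal (norm (adjoint (partial_w f xb wb) u)) | u y P1 Q1 P2 Q2.
              - u \<in> G_set a d P1 Q1 P2 Q2 \<and> y \<in> F_set a d P1 Q1 P2 Q2 \<and> (P1, Q1, P2, Q2) \<in> \<A> \<and>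
              norm (y + adjoint (partial_x f xb wb) u) \<le> 1} \<and>
     (AICQ a d K I \<longrightarrow>
        (\<forall>lam mu J1 J2.
           multipliers a d K I vb lam mu \<and> J1 = pos_support K lam \<and> J2 = pos_support I mu \<longrightarrow>
           (lipschitz_like S wb xb \<longleftrightarrow>
              (\<forall>u. - u \<in> dom_second_subdiff \<theta> xb vb \<and>
                   - adjoint (partial_x f xb wb) u \<in> C_set a d K I J1 u \<longrightarrow> u = 0)) \<and>
           lip_bound S wb xb =
             Sup {ereal (norm (adjoint (partial_w f xb wb) u)) | u y.
                    - u \<in> G_set a d J1 J1 J2 J2 \<and> y \<in> C_set a d K I J1 u \<and>
                    norm (y + adjoint (partial_x f xb wb) u) \<le> 1}))"
proof -
  interpret PL: pl_function \<theta> l p a d \<alpha> \<beta>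
    by unfold_locales (rule pl)
  let ?A = "partial_x f xb wb" and ?B = "partial_w f xb wb"
  obtain D where D: "has_strict_derivative f D (xb, wb)"
    using strict unfolding strictly_differentiable_at_def by blast
  have linD: "linear D"
    using D by (simp add: has_strict_derivative_def bounded_linear.linear)
  have partial: "?A = (\<lambda>h. D (h, 0))" "?B = (\<lambda>k. D (0, k))"
    using has_derivative_partial[OF has_strict_derivative_imp_has_derivative[OF D]] by auto
  have D_eq: "D = (\<lambda>(h, k). ?A h + ?B k)"
    unfolding partial using linear_add[OF linD] by (auto simp: fun_eq_iff simp flip: linear_add[OF linD])
  have mem: "x \<in> S w \<longleftrightarrow> - f (x, w) \<in> subdiff \<theta> x" for x w
    unfolding S solution_map_def set_plus_def
    by (auto simp: add_eq_0_iff eq_commute[of 0])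
  interpret parametric_inclusion f ?A ?B xb wb "gph (subdiff \<theta>)" S vb
  proof (intro parametric_inclusion.intro strict_parametrization.intro parametric_inclusion_axioms.intro)
    show "has_strict_derivative f (\<lambda>(h, k). ?A h + ?B k) (xb, wb)"
      using D unfolding D_eq[symmetric] .
    have "linear (\<lambda>h::real^'n. (h, 0::real^'d))" "linear (\<lambda>k::real^'d. (0::real^'n, k))"
      by (simp_all add: linear_iff)
    then show "linear ?A" "linear ?B"
      unfolding partial using linear_compose[OF _ linD] by (auto simp: o_def)
    show "S w = {x. (x, - f (x, w)) \<in> gph (subdiff \<theta>)}" for w
      using mem by (auto simp: gph_def)
  qed (use surj vb PL.closed_gph_subdiff in auto)
  have base: "(xb, vb) \<in> gph (subdiff \<theta>)"
    using gph unfolding gph_iff vb .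
  then have xD: "xb \<in> eff_dom \<theta>"
    by (simp add: PL.gph_subdiff_iff)
  let ?N = "limiting_normal_cone (xb, vb) (gph (subdiff \<theta>))"
  have N_iff: "(y, q) \<in> ?N \<longleftrightarrow> (\<exists>P1 Q1 P2 Q2. (P1, Q1, P2, Q2) \<in> \<A> \<and>
      y \<in> F_set a d P1 Q1 P2 Q2 \<and> q \<in> G_set a d P1 Q1 P2 Q2)" for y q
    unfolding A using PL.limiting_normal_gph_subdiffI[OF xD] PL.limiting_normal_gph_subdiffD[OF xD] by metis
  have i1: "lipschitz_like S wb xb \<longleftrightarrow>
        (\<forall>(P1, Q1, P2, Q2)\<in>\<A>. \<forall>u.
           - adjoint ?A u \<in> F_set a d P1 Q1 P2 Q2 \<and> - u \<in> G_set a d P1 Q1 P2 Q2 \<longrightarrow> u = 0)"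
    unfolding lipschitz_like_iff N_iff by fast
  have i2: "lip_bound S wb xb =
       Sup {ereal (norm (adjoint ?B u)) | u y P1 Q1 P2 Q2.
              - u \<in> G_set a d P1 Q1 P2 Q2 \<and> y \<in> F_set a d P1 Q1 P2 Q2 \<and> (P1, Q1, P2, Q2) \<in> \<A> \<and>
              norm (y + adjoint ?A u) \<le> 1}"
    unfolding lip_bound_eq[OF base] N_iff by (rule arg_cong[where f = Sup]) blast
  have ii: "(lipschitz_like S wb xb \<longleftrightarrow>
              (\<forall>u. - u \<in> dom_second_subdiff \<theta> xb vb \<and>
                   - adjoint ?A u \<in> C_set a d K I J1 u \<longrightarrow> u = 0)) \<and>
           lip_bound S wb xb =
             Sup {ereal (norm (adjoint ?B u)) | u y.
                    - u \<in> G_set a d J1 J1 J2 J2 \<and> y \<in> C_set a d K I J1 u \<and>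
                    norm (y + adjoint ?A u) \<le> 1}"
    if aicq: "AICQ a d K I" and m: "multipliers a d K I vb lam mu"
      and J: "J1 = pos_support K lam" "J2 = pos_support I mu" for lam mu J1 J2
  proof -
    have N_C: "(y, - u) \<in> ?N \<longleftrightarrow> - u \<in> G_set a d J1 J1 J2 J2 \<and> y \<in> C_set a d K I J1 u" for y u
      unfolding N_iff A using PL.AICQ_normals_iff[OF xD aicq[unfolded K I] m[unfolded K I]] J
      by (simp add: K I)
    have "J1 \<noteq> {}"
    proof
      assume "J1 = {}"
      have "sum lam K \<le> 0"
        using \<open>J1 = {}\<close> unfolding J pos_support_def by (intro sum_nonpos) force
      then show False
        using m by (simp add: multipliers_def)
    qed
    then have "0 \<in> C_set a d K I J1 u" for u
      unfolding C_set_eq_F_set[OF \<open>J1 \<noteq> {}\<close>] by (intro F_set_zero) auto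
    \<comment> \<open>\<open>0\<close> belongs to \<open>C_set\<close> for every \<open>u\<close>,
      so the fibre over a direction is nonempty as soon as the condition on \<G> holds. The sign in
      \<open>second_subdiff\<close> is absorbed by the symmetry of that subspace.\<close>
    then have dom: "- u \<in> dom_second_subdiff \<theta> xb vb \<longleftrightarrow> - u \<in> G_set a d J1 J1 J2 J2" for u
      unfolding dom_second_subdiff_def second_subdiff_def using N_C[of _ "- u"]
      by (auto simp: uminus_mem_G_set_iff)
    show ?thesis
      unfolding lipschitz_like_iff lip_bound_eq[OF base] dom N_C by (simp add: conj_assoc)
  qed
  show ?thesis
    using i1 i2 ii by blast
qed

end
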